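(* Let $n\ge 1$ be an integer, $\gamma>0$, $1<q<\infty$, $\alpha\in\mathbb{R}$, $0<p<\infty$, and let $k$ be a nonnegative integer such that $pk+\alpha>-1$. For a holomorphic function $f$ on $\mathbb{B}_n$ and $z\in\mathbb{B}_n$ define $$A^{(q)}_{\gamma}(\mathcal{R}^{k} f)(z)=\left(\int_{D(z,\gamma)}\big|(1-|w|^2)^{k}\,\mathcal{R}^{k} f(w)\big|^q\,d\tau(w)\right)^{1/q}$$ and $$M^{(q)}_{\gamma}(\mathcal{R}^k f)(z)=\sup_{w\in\mathbb{B}_n:\ z\in D(w,\gamma)}\left(\int_{D(w,\gamma)}\big|(1-|u|^2)^k\,\mathcal{R}^k f(u)\big|^q\,\frac{dv_\alpha(u)}{v_\alpha(D(w,\gamma))}\right)^{1/q}.$$ Then for any $f$ holomorphic on $\mathbb{B}_n$, the following are equivalent: $f\in\mathcal{A}^p_{\alpha}$; $A^{(q)}_{\gamma}(\mathcal{R}^{k} f)\in L^p(\mathbb{B}_n,dv_{\alpha})$; $M^{(q)}_{\gamma}(\mathcal{R}^{k} f)\in L^p(\mathbb{B}_n,dv_{\alpha})$. Moreover, $$\|f\|_{p,\alpha}\approx |f(0)|+\left(\int_{\mathbb{B}_n}A^{(q)}_{\gamma}(\mathcal{R}^{k} f)^p\,dv_{\alpha}\right)^{1/p}\approx |f(0)|+\left(\int_{\mathbb{B}_n}M^{(q)}_{\gamma}(\mathcal{R}^{k} f)^p\,dv_{\alpha}\right)^{1/p},$$ where "$\approx$" means that each side is bounded by a constant times the other, the constants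 depending only on $\gamma,q,\alpha,p,k,n$ (and not on $f$).
   Context: $\mathbb{B}_n$ is the open unit ball of $\mathbb{C}^n$ and $\langle z,w\rangle=\sum_j z_j\overline{w_j}$. $dv$ is Lebesgue (volume) measure on $\mathbb{B}_n$ normalized to have total mass $1$; for $\alpha\in\mathbb{R}$, $dv_\alpha(z)=c_\alpha(1-|z|^2)^\alpha dv(z)$, where $c_\alpha=1$ if $\alpha\le -1$ and $c_\alpha=\Gamma(n+\alpha+1)/[n!\,\Gamma(\alpha+1)]$ if $\alpha>-1$. The invariant measure is $d\tau(z)=(1-|z|^2)^{-(n+1)}dv(z)$. The radial derivative is $\mathcal{R}f(z)=\sum_{j=1}^n z_j\,\partial f/\partial z_j(z)$; $\mathcal{R}^k$ is its $k$-th iterate ($\mathcal{R}^0 f=f$). The Bergman metric is $\beta(z,w)=\frac12\log\frac{1+|\varphi_z(w)|}{1-|\varphi_z(w)|}$, where $\varphi_z$ is the standard involutive automorphism of $\mathbb{B}_n$ with $\varphi_z(0)=z$, $\varphi_z(z)=0$, $\varphi_z\circ\varphi_z=\mathrm{id}$; explicitly $\varphi_0(w)=-w$ and, for $z\ne0$, $\varphi_z(w)=\frac{z-P_z w-\sqrt{1-|z|^2}\,(w-P_zw)}{1-\langle w,z\rangle}$ with $P_z w=\frac{\langle w,z\rangle}{|z|^2}z$. For $\gamma>0$, $D(z,\gamma)=\{w\in\mathbb{B}_n:\beta(z,w)<\gamma\}$. Generalized Bergman spaces: for $0<p<\infty$ and $\alpha\in\mathbb{R}$, $\mathcal{A}^p_\alpha$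 is the space of all holomorphic $f$ on $\mathbb{B}_n$ such that $(1-|z|^2)^k\mathcal{R}^k f\in L^p(\mathbb{B}_n,dv_\alpha)$, where $k$ is a fixed nonnegative integer with $pk+\alpha>-1$ (the space is independent of the choice of $k$, and for $\alpha>-1$ it is the space of holomorphic functions in $L^p(\mathbb{B}_n,dv_\alpha)$). With $N$ the smallest nonnegative integer such that $pN+\alpha>-1$, put $$\|f\|_{p,\alpha}=|f(0)|+\left(\int_{\mathbb{B}_n}(1-|z|^2)^{pN}|\mathcal{R}^N f(z)|^p\,dv_\alpha(z)\right)^{1/p},\qquad f\in\mathcal{A}^p_\alpha .$$ *)

theory Defs
  imports "HOL-Analysis.Analysis"
begin

text \<open>
  The ambient space is \<open>complex ^ 'n\<close>, with \<open>CARD('n)\<close> in the role of the dimension \<open>n\<close>;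
  the open unit ball is \<open>ball 0 1\<close>. Integrals of nonnegative functions, and functions
  defined through suprema or roots of such integrals, take values in \<^typ>\<open>ennreal\<close>, so
  that divergence is recorded as \<open>\<infinity>\<close>.
\<close>

definition hinner :: "complex ^ 'n \<Rightarrow> complex ^ 'n \<Rightarrow> complex" where
  "hinner z w = (\<Sum>j\<in>UNIV. z $ j * cnj (w $ j))"

definition holomorphic_ball :: "(complex ^ 'n \<Rightarrow> complex) \<Rightarrow> bool" where
  "holomorphic_ball f \<longleftrightarrow>
     (\<forall>z\<in>ball 0 1. \<exists>L. (f has_derivative L) (at z) \<and> (\<forall>c v. L (c *s v) = c * L v))"

definition partial_deriv :: "'n \<Rightarrow> (complex ^ 'n \<Rightarrow> complex) \<Rightarrow> complex ^ 'n \<Rightarrow> complex" where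
  "partial_deriv j f z = deriv (\<lambda>t. f (z + axis j t)) 0"

definition radial_deriv :: "(complex ^ 'n \<Rightarrow> complex) \<Rightarrow> complex ^ 'n \<Rightarrow> complex" where
  "radial_deriv f z = (\<Sum>j\<in>UNIV. z $ j * partial_deriv j f z)"

definition weighted_deriv :: "nat \<Rightarrow> (complex ^ 'n \<Rightarrow> complex) \<Rightarrow> complex ^ 'n \<Rightarrow> complex" where
  "weighted_deriv k f z = complex_of_real ((1 - (norm z)\<^sup>2) ^ k) * (radial_deriv ^^ k) f z"

text \<open>The underlying space of the measures below is the ball itself, so values of functions
  outside the ball are irrelevant, also for measurability.\<close>

definition ball_measure :: "(complex ^ 'n) measure" where
  "ball_measure = restrict_space (uniform_measure lborel (ball 0 1)) (ball 0 1)"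

definition weight_const :: "nat \<Rightarrow> real \<Rightarrow> real" where
  "weight_const n \<alpha> =
     (if \<alpha> \<le> -1 then 1 else Gamma (real n + \<alpha> + 1) / (fact n * Gamma (\<alpha> + 1)))"

definition weighted_measure :: "real \<Rightarrow> (complex ^ 'n) measure" where
  "weighted_measure \<alpha> =
     density ball_measure
       (\<lambda>z. ennreal (weight_const CARD('n) \<alpha> * (1 - (norm z)\<^sup>2) powr \<alpha>))"

definition invariant_measure :: "(complex ^ 'n) measure" where
  "invariant_measure =
     density ball_measure (\<lambda>z. ennreal ((1 - (norm z)\<^sup>2) powr (- (real CARD('n) + 1))))"

definition proj_line :: "complex ^ 'n \<Rightarrow> complex ^ 'n \<Rightarrow> complex ^ 'n" where
  "proj_line z w = (hinner w z / complex_of_real ((norm z)\<^sup>2)) *s z"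

definition ball_involution :: "complex ^ 'n \<Rightarrow> complex ^ 'n \<Rightarrow> complex ^ 'n" where
  "ball_involution z w =
     (if z = 0 then - w
      else inverse (1 - hinner w z) *s
        (z - proj_line z w - sqrt (1 - (norm z)\<^sup>2) *\<^sub>R (w - proj_line z w)))"

definition bergman_metric :: "complex ^ 'n \<Rightarrow> complex ^ 'n \<Rightarrow> real" where
  "bergman_metric z w =
     1 / 2 * ln ((1 + norm (ball_involution z w)) / (1 - norm (ball_involution z w)))"

definition bergman_ball :: "complex ^ 'n \<Rightarrow> real \<Rightarrow> (complex ^ 'n) set" where
  "bergman_ball z \<gamma> = {w \<in> ball 0 1. bergman_metric z w < \<gamma>}"

text \<open>Real powers of extended nonnegative numbers; only used for exponents \<open>p > 0\<close>.\<close>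

definition epowr :: "ennreal \<Rightarrow> real \<Rightarrow> ennreal" where
  "epowr x p = (if x = \<infinity> then \<infinity> else ennreal (enn2real x powr p))"

definition in_Lp :: "real \<Rightarrow> 'a measure \<Rightarrow> ('a \<Rightarrow> ennreal) \<Rightarrow> bool" where
  "in_Lp p M g \<longleftrightarrow> g \<in> borel_measurable M \<and> (\<integral>\<^sup>+z. epowr (g z) p \<partial>M) < \<infinity>"

definition in_Lp_complex :: "real \<Rightarrow> 'a measure \<Rightarrow> ('a \<Rightarrow> complex) \<Rightarrow> bool" where
  "in_Lp_complex p M g \<longleftrightarrow>
     g \<in> borel_measurable M \<and> (\<integral>\<^sup>+z. ennreal (norm (g z) powr p) \<partial>M) < \<infinity>"

definition min_order :: "real \<Rightarrow> real \<Rightarrow> nat" where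
  "min_order p \<alpha> = (LEAST N. p * real N + \<alpha> > -1)"

text \<open>Any \<open>k\<close> with \<open>p * k + \<alpha> > -1\<close> yields the same space;
  the definition fixes the smallest one, which is also the one used in the norm.\<close>

definition gen_bergman :: "real \<Rightarrow> real \<Rightarrow> (complex ^ 'n \<Rightarrow> complex) set" where
  "gen_bergman p \<alpha> =
     {f. holomorphic_ball f \<and>
         in_Lp_complex p (weighted_measure \<alpha>) (weighted_deriv (min_order p \<alpha>) f)}"

definition gen_bergman_norm :: "real \<Rightarrow> real \<Rightarrow> (complex ^ 'n \<Rightarrow> complex) \<Rightarrow> ennreal" where
  "gen_bergman_norm p \<alpha> f =
     ennreal (norm (f 0)) +
     epowr (\<integral>\<^sup>+z. ennreal ((1 - (norm z)\<^sup>2) powr (p * real (min_order p \<alpha>))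
                         * norm ((radial_deriv ^^ min_order p \<alpha>) f z) powr p)
            \<partial>weighted_measure \<alpha>) (1 / p)"

definition area_fun ::
  "real \<Rightarrow> real \<Rightarrow> nat \<Rightarrow> (complex ^ 'n \<Rightarrow> complex) \<Rightarrow> complex ^ 'n \<Rightarrow> ennreal" where
  "area_fun \<gamma> q k f z =
     epowr (\<integral>\<^sup>+w\<in>bergman_ball z \<gamma>. ennreal (norm (weighted_deriv k f w) powr q)
            \<partial>invariant_measure) (1 / q)"

definition maximal_fun ::
  "real \<Rightarrow> real \<Rightarrow> real \<Rightarrow> nat \<Rightarrow> (complex ^ 'n \<Rightarrow> complex) \<Rightarrow> complex ^ 'n \<Rightarrow> ennreal" where
  "maximal_fun \<gamma> q \<alpha> k f z =
     (SUP w\<in>{w \<in> ball 0 1. z \<in> bergman_ball w \<gamma>}.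
        epowr ((\<integral>\<^sup>+u\<in>bergman_ball w \<gamma>. ennreal (norm (weighted_deriv k f u) powr q)
                \<partial>weighted_measure \<alpha>)
               / emeasure (weighted_measure \<alpha>) (bergman_ball w \<gamma>)) (1 / q))"

definition comparable_on :: "'a set \<Rightarrow> ('a \<Rightarrow> ennreal) \<Rightarrow> ('a \<Rightarrow> ennreal) \<Rightarrow> bool" where
  "comparable_on S F G \<longleftrightarrow>
     (\<exists>C::real. C > 0 \<and> (\<forall>f\<in>S. F f \<le> ennreal C * G f \<and> G f \<le> ennreal C * F f))"

end

theory Submission
  imports Defs "HOL-Complex_Analysis.Complex_Analysis"
begin

text \<open>
  Write \<open>d(z) = 1 - \<bar>z\<bar>\<^sup>2\<close> and \<open>h = \<R>\<^sup>k f\<close>. Averaging \<open>h\<close> over circles in complex lines and then over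
  a circled set about \<open>z\<close>, of size \<open>d(z)\<close> in the direction of \<open>z\<close> and of size \<open>d(z)\<^bsup>1/2\<^esup>\<close> in the
  orthogonal ones, bounds \<open>\<bar>h(z)\<bar>\<^sup>p\<close> by its mean over a Bergman ball, for every \<open>p > 0\<close>. Since Bergman
  balls satisfy a quasi-triangle inequality and \<open>d\<close> is nearly constant on them, the \<open>p\<close>-th powers of
  the area function and of the maximal function at \<open>z\<close> are, up to constants, bounded below by
  \<open>(d(z)\<^sup>k \<bar>h(z)\<bar>)\<^sup>p\<close> and above by the mean of \<open>(d\<^sup>k \<bar>h\<bar>)\<^sup>p\<close> over a larger Bergman ball. By Fubini's
  theorem both have \<open>L\<^sup>p\<close> norms comparable to that of \<open>d\<^sup>k \<bar>h\<bar>\<close>.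

  It remains to pass from \<open>k\<close> to the minimal order. One direction is a Cauchy estimate. For the other,
  \<open>\<bar>g(z)\<bar>\<^sup>p \<le> 2\<^sup>p \<bar>g(t z)\<bar>\<^sup>p + \<dots>\<close> with a remainder controlled by \<open>\<R> g\<close>; averaging over \<open>t\<close> with
  \<open>1 - t \<approx> L (1 - \<bar>z\<bar>)\<close> and integrating against \<open>d\<^sup>a\<close>, \<open>a > -1\<close>, multiplies the integral of
  \<open>\<bar>g\<bar>\<^sup>p d\<^sup>a\<close> by a constant times \<open>L\<^bsup>-(a+1)\<^esup>\<close>, which is absorbed for large \<open>L\<close>.
\<close>

section \<open>Holomorphy along complex lines\<close>

text \<open>The exponent n + 1 governs the proof: a Bergman ball has extent d in one complex
  direction and d^(1/2) in the n - 1 others, hence volume about d^2 d^(n-1) = d^(n+1). Its invariant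
  volume is therefore bounded, and integrating over it against \<tau> or averaging against
  v_\<alpha> gives comparable results. The exponents p and q are never compared with each other. The
  supremum of d^k |h| over a Bergman ball is bounded by its p-mean over a larger one, and this
  bounds any q-mean. The price is a sub-mean-value inequality for small p, where Jensen's inequality
  fails. Absorbing a term requires it to be finite, so integrals are first truncated to |z| < 1 -
  \<epsilon>. Averages are taken over points t z with t \<le> 1, which lie further inside, so the
  same truncated integral returns on the right, with a constant free of \<epsilon>. All functionals
  take values in [0, \<infinity>] and are compared for every holomorphic f. One two-sided estimate
  thus yields both the equivalence of memberships and the comparison of norms.\<close>

lemma norm_smult: "norm (c *s v) = cmod c * norm v" for v :: "complex ^ 'n"
  unfolding norm_vec_def by (simp add: norm_mult L2_set_right_distrib)

lemma smult_of_real: "complex_of_real r *s v = r *\<^sub>R v" for v :: "complex ^ 'n"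
  by (simp add: vec_eq_iff) (simp add: scaleR_conv_of_real)

lemma bounded_bilinear_smult: "bounded_bilinear ((*s) :: complex \<Rightarrow> complex ^ 'n \<Rightarrow> complex ^ 'n)"
proof
  fix a b :: complex and x y :: "complex ^ 'n" and r :: real
  show "(a + b) *s x = a *s x + b *s x" by (rule vector_sadd_rdistrib)
  show "a *s (x + y) = a *s x + a *s y" by (rule vector_add_ldistrib)
  show "(r *\<^sub>R a) *s x = r *\<^sub>R (a *s x)"
    by (simp add: vec_eq_iff)
  show "a *s (r *\<^sub>R x) = r *\<^sub>R (a *s x)"
    by (simp add: vec_eq_iff)
  show "\<exists>K. \<forall>a (x :: complex ^ 'n). norm (a *s x) \<le> norm a * norm x * K"
    by (rule exI[of _ 1]) (simp add: norm_smult)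
qed

lemmas continuous_on_smult [continuous_intros] =
  bounded_bilinear.continuous_on[OF bounded_bilinear_smult]

text \<open>Holomorphy in the sense of Gateaux: continuity, together with holomorphy on the
  intersection of the ball with every complex line. It is easier to establish than
  Frechet differentiability, to which it is equivalent.\<close>

definition line_hol :: "(complex ^ 'n \<Rightarrow> complex) \<Rightarrow> bool" where
  "line_hol h \<longleftrightarrow> continuous_on (ball 0 1) h \<and>
     (\<forall>z v. (\<lambda>t. h (z + t *s v)) holomorphic_on {t. z + t *s v \<in> ball 0 1})"

definition dir_deriv :: "complex ^ 'n \<Rightarrow> (complex ^ 'n \<Rightarrow> complex) \<Rightarrow> complex ^ 'n \<Rightarrow> complex" where
  "dir_deriv v h z = deriv (\<lambda>t. h (z + t *s v)) 0"

lemma open_line: "open {t. z + t *s v \<in> (ball 0 1 :: (complex ^ 'n) set)}"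
proof -
  have "continuous_on UNIV (\<lambda>t. z + t *s v)" by (intro continuous_intros)
  then have "open ((\<lambda>t. z + t *s v) -` ball 0 1)"
    by (metis open_ball open_vimage)
  then show ?thesis by (simp add: vimage_def)
qed

lemma line_hol_cont: "line_hol h \<Longrightarrow> continuous_on (ball 0 1) h"
  by (simp add: line_hol_def)

lemma line_hol_holomorphic:
  "line_hol h \<Longrightarrow> (\<lambda>t. h (z + t *s v)) holomorphic_on {t. z + t *s v \<in> ball 0 1}"
  by (simp add: line_hol_def)

lemma line_hol_derivative:
  assumes "line_hol h" "z + t *s v \<in> ball 0 1"
  shows "((\<lambda>t. h (z + t *s v)) has_field_derivative dir_deriv v h (z + t *s v)) (at t)"
proof -
  have "(\<lambda>s. h (z + s *s v)) field_differentiable (at t)"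
    by (rule holomorphic_on_imp_differentiable_at[OF line_hol_holomorphic[OF assms(1)] open_line])
      (use assms(2) in simp)
  then obtain D where D: "((\<lambda>s. h (z + s *s v)) has_field_derivative D) (at t)"
    by (auto simp: field_differentiable_def)
  then have "((\<lambda>s. h (z + (t + s) *s v)) has_field_derivative D) (at 0)"
    using DERIV_at_within_shift[of "\<lambda>s. h (z + s *s v)" D t 0 UNIV] by simp
  moreover have "z + (t + s) *s v = (z + t *s v) + s *s v" for s
    by (simp add: vector_sadd_rdistrib add.assoc)
  ultimately have "dir_deriv v h (z + t *s v) = D"
    by (simp add: dir_deriv_def DERIV_imp_deriv add.assoc)
  with D show ?thesis by simp
qed

text \<open>Cauchy's formulas on the unit circle, parametrised by the angle. The first recovers a
  derivative from values of \<open>h\<close> alone, so that regularity of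
  \<open>dir_deriv v h\<close> in the base point becomes regularity of a parameter integral.\<close>

lemma circle_mean_deriv:
  assumes h: "line_hol h" and b: "\<And>t. cmod t \<le> 1 \<Longrightarrow> z + t *s v \<in> ball 0 1"
  shows "dir_deriv v h z = integral {0..2*pi} (\<lambda>\<theta>. h (z + cis \<theta> *s v) / cis \<theta>) / (2 * pi)"
    and "h z = integral {0..2*pi} (\<lambda>\<theta>. h (z + cis \<theta> *s v)) / (2 * pi)"
proof -
  let ?f = "\<lambda>t. h (z + t *s v)"
  have hol: "?f holomorphic_on cball 0 1"
    using line_hol_holomorphic[OF h, of z v]
    by (rule holomorphic_on_subset) (use b in \<open>auto simp: dist_norm\<close>)
  then have c: "continuous_on (cball 0 1) ?f" by (rule holomorphic_on_imp_continuous_on)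
  have hb: "?f holomorphic_on ball 0 1" using hol by (rule holomorphic_on_subset) auto
  have eq: "circlepath 0 1 = part_circlepath 0 1 0 (2*pi)" by (simp add: circlepath_def)
  have I1: "((\<lambda>u. ?f u / (u - 0)) has_contour_integral (2 * of_real pi * \<i> * ?f 0)) (circlepath 0 1)"
    by (rule Cauchy_integral_circlepath[OF c hb]) auto
  then have "((\<lambda>\<theta>. \<i> * ?f (cis \<theta>)) has_integral (2 * of_real pi * \<i> * ?f 0)) {0..2*pi}"
    unfolding eq by (subst (asm) has_contour_integral_part_circlepath_iff) (simp_all add: mult_ac)
  from integral_unique[OF this] show "h z = integral {0..2*pi} (\<lambda>\<theta>. h (z + cis \<theta> *s v)) / (2 * pi)"
    by (simp add: field_simps)
  have "(?f has_field_derivative (1 / (2 * of_real pi * \<i>) *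
      contour_integral (circlepath 0 1) (\<lambda>u. ?f u / (u - 0)\<^sup>2))) (at 0)"
    by (rule Cauchy_derivative_integral_circlepath[OF c hb]) auto
  then have 1: "dir_deriv v h z = 1 / (2 * of_real pi * \<i>) * contour_integral (circlepath 0 1) (\<lambda>u. ?f u / (u - 0)\<^sup>2)"
    by (simp add: dir_deriv_def DERIV_imp_deriv)
  have "(\<lambda>u. ?f u / (u - 0)\<^sup>2) contour_integrable_on circlepath 0 1"
    by (rule Cauchy_derivative_integral_circlepath[OF c hb]) auto
  then have "((\<lambda>u. ?f u / (u - 0)\<^sup>2) has_contour_integral
      contour_integral (circlepath 0 1) (\<lambda>u. ?f u / (u - 0)\<^sup>2)) (circlepath 0 1)"
    by (rule has_contour_integral_integral)
  then have "((\<lambda>\<theta>. \<i> * (?f (cis \<theta>) / cis \<theta>)) has_integral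
      contour_integral (circlepath 0 1) (\<lambda>u. ?f u / (u - 0)\<^sup>2)) {0..2*pi}"
    unfolding eq
    by (subst (asm) has_contour_integral_part_circlepath_iff)
       (simp_all add: mult_ac power2_eq_square)
  then have "\<i> * integral {0..2*pi} (\<lambda>\<theta>. ?f (cis \<theta>) / cis \<theta>) =
      contour_integral (circlepath 0 1) (\<lambda>u. ?f u / (u - 0)\<^sup>2)"
    by (simp add: integral_unique flip: integral_mult_right)
  with 1 have "\<i> * (2 * pi * dir_deriv v h z) = \<i> * integral {0..2*pi} (\<lambda>\<theta>. ?f (cis \<theta>) / cis \<theta>)"
    by (simp add: field_simps)
  then show "dir_deriv v h z = integral {0..2*pi} (\<lambda>\<theta>. h (z + cis \<theta> *s v) / cis \<theta>) / (2 * pi)"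
    by (simp add: field_simps)
qed

lemma dir_deriv_scale: "line_hol h \<Longrightarrow> z \<in> ball 0 1 \<Longrightarrow> dir_deriv (c *s v) h z = c * dir_deriv v h z"
proof -
  assume h: "line_hol h" "z \<in> ball 0 1"
  have "((\<lambda>t. h (z + t *s v)) has_field_derivative dir_deriv v h z) (at (c * 0))"
    using line_hol_derivative[of h z 0 v] h by simp
  then have "((\<lambda>t. h (z + (c * t) *s v)) has_field_derivative dir_deriv v h z * c) (at 0)"
    by (rule DERIV_chain2) (auto intro!: derivative_eq_intros)
  then show ?thesis
    by (simp add: dir_deriv_def DERIV_imp_deriv vector_smult_assoc mult_ac)
qed

lemma circle_in_ball:
  fixes z0 :: "complex ^ 'n"
  assumes "z0 \<in> ball 0 1"
  obtains r where "r > 0" "\<And>z (v :: complex ^ 'n). z \<in> ball z0 r \<Longrightarrow> norm v \<le> r \<Longrightarrow> z + v \<in> ball 0 1"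
proof
  show "(1 - norm z0) / 2 > 0" using assms by simp
  fix z v :: "complex ^ 'n" assume *: "z \<in> ball z0 ((1 - norm z0) / 2)" "norm v \<le> (1 - norm z0) / 2"
  have "norm (z + v) \<le> norm (z - z0) + norm z0 + norm v"
    using norm_triangle_ineq[of z v] norm_triangle_ineq[of "z - z0" z0] by simp
  also have "\<dots> < 1" using * by (simp add: dist_norm norm_minus_commute field_simps)
  finally show "z + v \<in> ball 0 1" by simp
qed

text \<open>The circle formulas are tied to the unit circle. Near the boundary the direction is
  shortened instead of the circle, and \<open>dir_deriv_scale\<close> undoes the change.\<close>

lemma shrink_vector:
  fixes v :: "complex ^ 'n"
  assumes "r > 0"
  shows "\<exists>c>0. norm (complex_of_real c *s v) \<le> r"
proof (intro exI conjI)
  show "r / (norm v + 1) > 0" using assms by (simp add: add_nonneg_pos)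
  have "r / (norm v + 1) * norm v \<le> r / (norm v + 1) * (norm v + 1)"
    using assms by (intro mult_left_mono) auto
  also have "\<dots> = r" using norm_ge_zero[of v] by (simp del: norm_ge_zero)
  finally show "norm (complex_of_real (r / (norm v + 1)) *s v) \<le> r"
    using assms unfolding smult_of_real norm_scaleR by (simp add: abs_of_nonneg)
qed

text \<open>Near \<open>z0\<close> the derivative is a circle integral whose integrand is jointly
  continuous in the point and the angle.\<close>

lemma isCont_dir_deriv:
  fixes v z0 :: "complex ^ 'n"
  assumes h: "line_hol h" and z0: "z0 \<in> ball 0 1"
  shows "isCont (dir_deriv v h) z0"
proof -
  obtain r where r: "r > 0" "\<And>z (v :: complex ^ 'n). z \<in> ball z0 r \<Longrightarrow> norm v \<le> r \<Longrightarrow> z + v \<in> ball 0 1"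
    using circle_in_ball[OF z0] by blast
  obtain c where c: "c > 0" "norm (complex_of_real c *s v) \<le> r"
    using shrink_vector[OF r(1), of v] by blast
  define u where "u = complex_of_real c *s v"
  have u: "norm u \<le> r" using c by (simp add: u_def)
  have b: "z + t *s u \<in> ball 0 1" if "z \<in> ball z0 r" "cmod t \<le> 1" for z t
    by (rule r(2)) (use that u r in \<open>auto simp: norm_smult intro: order_trans[OF mult_right_mono, of _ 1]\<close>)
  have "continuous_on (ball z0 r \<times> {0..2*pi}) (\<lambda>(z, \<theta>). h (z + cis \<theta> *s u) / cis \<theta>)"
    unfolding split_beta
    by (intro continuous_intros continuous_on_compose2[OF line_hol_cont[OF h]]) (use b in auto)
  then have "continuous_on (ball z0 r) (\<lambda>z. integral {0..2*pi} (\<lambda>\<theta>. h (z + cis \<theta> *s u) / cis \<theta>))"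
    using integral_continuous_on_param[of "ball z0 r" 0 "2*pi" "\<lambda>z \<theta>. h (z + cis \<theta> *s u) / cis \<theta>"]
    by simp
  then have 1: "continuous_on (ball z0 r) (\<lambda>z. integral {0..2*pi} (\<lambda>\<theta>. h (z + cis \<theta> *s u) / cis \<theta>) / (2 * pi) / c)"
    using c by (intro continuous_intros) auto
  have "continuous_on (ball z0 r) (dir_deriv v h)"
  proof (rule continuous_on_eq[OF 1])
    fix z assume z: "z \<in> ball z0 r"
    have zb: "z \<in> ball 0 1" using b[OF z, of 0] by simp
    show "integral {0..2*pi} (\<lambda>\<theta>. h (z + cis \<theta> *s u) / cis \<theta>) / (2 * pi) / c = dir_deriv v h z"
      using circle_mean_deriv(1)[OF h b[OF z]] dir_deriv_scale[OF h zb, of c v] c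
      by (simp add: u_def field_simps)
  qed
  then show ?thesis using r(1) by (simp add: continuous_on_interior)
qed

lemma continuous_on_dir_deriv: "line_hol h \<Longrightarrow> continuous_on (ball 0 1) (dir_deriv v h)"
  by (simp add: continuous_at_imp_continuous_on isCont_dir_deriv)

text \<open>The circle integral is differentiated along a second line under the integral sign. The
  integrand then involves \<open>dir_deriv w h\<close>, whose continuity is already known.\<close>

lemma line_hol_dir_deriv:
  assumes h: "line_hol h"
  shows "line_hol (dir_deriv v h)"
  unfolding line_hol_def
proof (intro conjI allI)
  show "continuous_on (ball 0 1) (dir_deriv v h)" by (rule continuous_on_dir_deriv[OF h])
  fix a w :: "complex ^ 'a"
  show "(\<lambda>t. dir_deriv v h (a + t *s w)) holomorphic_on {t. a + t *s w \<in> ball 0 1}"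
  proof (rule holomorphic_on_open[THEN iffD2, OF open_line], safe)
    fix s assume "a + s *s w \<in> (ball 0 1 :: (complex ^ 'a) set)"
    then obtain r where r: "r > 0" "\<And>z (v :: complex ^ 'a). z \<in> ball (a + s *s w) r \<Longrightarrow> norm v \<le> r \<Longrightarrow> z + v \<in> ball 0 1"
      using circle_in_ball by blast
    obtain c where c: "c > 0" "norm (complex_of_real c *s v) \<le> r"
      using shrink_vector[OF r(1), of v] by blast
    define u where "u = complex_of_real c *s v"
    have u: "norm u \<le> r" using c by (simp add: u_def)
    have b: "z + t *s u \<in> ball 0 1" if "z \<in> ball (a + s *s w) r" "cmod t \<le> 1" for z t
      by (rule r(2)) (use that u r in \<open>auto simp: norm_smult intro: order_trans[OF mult_right_mono, of _ 1]\<close>)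
    \<comment> \<open>Points \<open>a + t *s w\<close> with \<open>t\<close> within \<open>e\<close>
      of \<open>s\<close> stay within \<open>r\<close> of \<open>a + s *s w\<close>; the
      \<open>+ 1\<close> covers \<open>w = 0\<close>.\<close>
    define e where "e = r / (norm w + 1)"
    have e: "e > 0" using r by (simp add: e_def add_nonneg_pos)
    have inb: "a + t *s w \<in> ball (a + s *s w) r" if "t \<in> ball s e" for t
    proof -
      have "norm (s *s w - t *s w) = cmod (s - t) * norm w"
        by (simp add: norm_smult flip: vector_sub_rdistrib)
      moreover have "cmod (s - t) * norm w \<le> cmod (s - t) * (norm w + 1)" by (intro mult_left_mono) auto
      moreover have "cmod (s - t) * (norm w + 1) < r"
        using that unfolding e_def mem_ball dist_norm by (simp add: pos_less_divide_eq add_nonneg_pos)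
      ultimately show ?thesis by (simp add: dist_norm norm_smult)
    qed
    have b': "a + t *s w + cis \<theta> *s u \<in> ball 0 1" if "t \<in> ball s e" for t \<theta>
      by (rule b[OF inb[OF that]]) simp
    have "(\<lambda>t. integral (cbox 0 (2*pi)) (\<lambda>\<theta>. h (a + t *s w + cis \<theta> *s u) / cis \<theta>)) holomorphic_on ball s e"
    proof (rule leibniz_rule_holomorphic)
      fix t \<theta> assume t: "t \<in> ball s e"
      have "((\<lambda>t. h ((a + cis \<theta> *s u) + t *s w)) has_field_derivative
          dir_deriv w h ((a + cis \<theta> *s u) + t *s w)) (at t)"
        by (rule line_hol_derivative[OF h]) (use b'[OF t, of \<theta>] in \<open>simp add: add_ac\<close>)
      then have "((\<lambda>t. h (a + t *s w + cis \<theta> *s u)) has_field_derivative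
          dir_deriv w h (a + t *s w + cis \<theta> *s u)) (at t)" by (simp add: add_ac)
      then show "((\<lambda>t. h (a + t *s w + cis \<theta> *s u) / cis \<theta>) has_field_derivative
          dir_deriv w h (a + t *s w + cis \<theta> *s u) / cis \<theta>) (at t within ball s e)"
        by (intro DERIV_cdivide) (rule has_field_derivative_at_within)
    next
      fix t assume t: "t \<in> ball s e"
      show "(\<lambda>\<theta>. h (a + t *s w + cis \<theta> *s u) / cis \<theta>) integrable_on cbox 0 (2*pi)"
        by (intro integrable_continuous continuous_intros continuous_on_compose2[OF line_hol_cont[OF h]])
          (use b'[OF t] in auto)
    next
      show "continuous_on (ball s e \<times> cbox 0 (2*pi))
          (\<lambda>(t, \<theta>). dir_deriv w h (a + t *s w + cis \<theta> *s u) / cis \<theta>)"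
        unfolding split_beta
        by (intro continuous_intros continuous_on_compose2[OF continuous_on_dir_deriv[OF h]])
          (use b' in auto)
    qed simp
    then have "(\<lambda>t. integral {0..2*pi} (\<lambda>\<theta>. h (a + t *s w + cis \<theta> *s u) / cis \<theta>) / (2 * pi) / c) holomorphic_on ball s e"
      using c by (auto intro!: holomorphic_intros)
    then have "(\<lambda>t. dir_deriv v h (a + t *s w)) holomorphic_on ball s e"
    proof (rule holomorphic_transform)
      fix t assume t: "t \<in> ball s e"
      have zb: "a + t *s w \<in> ball 0 1" using b[OF inb[OF t], of 0] by simp
      show "integral {0..2*pi} (\<lambda>\<theta>. h (a + t *s w + cis \<theta> *s u) / cis \<theta>) / (2 * pi) / c = dir_deriv v h (a + t *s w)"
        using circle_mean_deriv(1)[OF h b[OF inb[OF t]]] dir_deriv_scale[OF h zb, of c v] c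
        by (simp add: u_def field_simps)
    qed
    then show "\<exists>f'. ((\<lambda>t. dir_deriv v h (a + t *s w)) has_field_derivative f') (at s)"
      using e by (meson centre_in_ball holomorphic_on_open open_ball)
  qed
qed

text \<open>Two directions are combined through the function \<open>h (z + x *s v + y *s w)\<close>
  of two complex variables. Continuity of its partial derivative in \<open>y\<close> makes it
  differentiable at the origin, and its derivative along the diagonal is the sum.\<close>

lemma dir_deriv_add:
  fixes v w z :: "complex ^ 'n"
  assumes h: "line_hol h" and z: "z \<in> ball 0 1"
  shows "dir_deriv (v + w) h z = dir_deriv v h z + dir_deriv w h z"
proof -
  let ?S = "{p :: complex \<times> complex. z + fst p *s v + snd p *s w \<in> ball 0 1}"
  have "continuous_on UNIV (\<lambda>p :: complex \<times> complex. z + fst p *s v + snd p *s w)"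
    by (intro continuous_intros)
  then have "open ((\<lambda>p :: complex \<times> complex. z + fst p *s v + snd p *s w) -` ball 0 1)"
    by (rule open_vimage[OF open_ball])
  then have "open ?S" by (simp add: vimage_def)
  moreover have "(0, 0) \<in> ?S" using z by simp
  ultimately obtain A B where AB: "open A" "open B" "0 \<in> A" "0 \<in> B" "A \<times> B \<subseteq> ?S"
    by (auto elim!: open_prod_elim)
  \<comment> \<open>The criterion through partial derivatives needs a convex second factor, hence a
    ball inside \<open>B\<close>.\<close>
  obtain e where e: "e > 0" "ball 0 e \<subseteq> B" using AB by (meson open_contains_ball)
  have inS: "z + x *s v + y *s w \<in> ball 0 1" if "x \<in> A" "y \<in> ball 0 e" for x y
    using AB(5) e(2) that by fastforce
  have "((\<lambda>(x, y). h (z + x *s v + y *s w)) has_derivative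
      (\<lambda>(tx, ty). dir_deriv v h z * tx + blinfun_apply (blinfun_mult_right (dir_deriv w h (z + 0 *s v + 0 *s w))) ty))
      (at (0, 0) within A \<times> ball 0 e)"
  proof (rule has_derivative_partialsI[where f="\<lambda>x y. h (z + x *s v + y *s w)" and
        fy="\<lambda>x y. blinfun_mult_right (dir_deriv w h (z + x *s v + y *s w))"])
    have "((\<lambda>x. h (z + x *s v)) has_field_derivative dir_deriv v h z) (at 0)"
      using line_hol_derivative[OF h, of z 0 v] z by simp
    then show "((\<lambda>x. h (z + x *s v + 0 *s w)) has_derivative (*) (dir_deriv v h z)) (at 0 within A)"
      by (simp add: has_field_derivative_def has_derivative_at_withinI)
  next
    fix x y assume "x \<in> A" "y \<in> ball (0 :: complex) e"
    then show "((\<lambda>y. h (z + x *s v + y *s w)) has_derivative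
        blinfun_apply (blinfun_mult_right (dir_deriv w h (z + x *s v + y *s w)))) (at y within ball 0 e)"
      using line_hol_derivative[OF h inS]
      by (simp add: has_field_derivative_def has_derivative_at_withinI)
  next
    have "continuous_on (A \<times> ball 0 e) (\<lambda>p. dir_deriv w h (z + fst p *s v + snd p *s w))"
      by (intro continuous_on_compose2[OF continuous_on_dir_deriv[OF h]] continuous_intros) (use inS in auto)
    then have "continuous_on (A \<times> ball 0 e) (\<lambda>(x, y). blinfun_mult_right (dir_deriv w h (z + x *s v + y *s w)))"
      unfolding split_beta by (intro continuous_intros)
    then show "continuous (at (0, 0) within A \<times> ball 0 e)
        (\<lambda>(x, y). blinfun_mult_right (dir_deriv w h (z + x *s v + y *s w)))"
      unfolding continuous_on_eq_continuous_within by (rule bspec) (use AB e in simp)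
  qed (use e in auto)
  then have F: "((\<lambda>(x, y). h (z + x *s v + y *s w)) has_derivative
      (\<lambda>(tx, ty). dir_deriv v h z * tx + dir_deriv w h z * ty)) (at (0, 0))"
    using AB e by (subst (asm) at_within_open) (auto simp: open_Times)
  have "((\<lambda>t::complex. (t, t)) has_derivative (\<lambda>t. (t, t))) (at 0)"
    by (auto intro!: derivative_eq_intros)
  from has_derivative_compose[OF this F]
  have "((\<lambda>t. h (z + t *s v + t *s w)) has_derivative (\<lambda>t. dir_deriv v h z * t + dir_deriv w h z * t)) (at 0)"
    by simp
  then have "((\<lambda>t. h (z + t *s (v + w))) has_field_derivative (dir_deriv v h z + dir_deriv w h z)) (at 0)"
    unfolding has_field_derivative_def
    by (simp add: vector_add_ldistrib add.assoc distrib_right[abs_def])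
  then show ?thesis by (simp add: dir_deriv_def DERIV_imp_deriv)
qed

lemma linear_dir_deriv:
  assumes h: "line_hol h" and z: "z \<in> ball 0 1"
  shows "linear (\<lambda>v. dir_deriv v h z)"
proof (rule linearI)
  show "dir_deriv (v + w) h z = dir_deriv v h z + dir_deriv w h z" for v w
    by (rule dir_deriv_add[OF h z])
  show "dir_deriv (r *\<^sub>R v) h z = r *\<^sub>R dir_deriv v h z" for r v
    using dir_deriv_scale[OF h z, of "complex_of_real r" v]
    by (simp add: smult_of_real scaleR_conv_of_real)
qed

text \<open>The mean value inequality on the unit disc, applied in \<open>t\<close> to
  \<open>h (z + t *s v) - dir_deriv v h z * t\<close>, whose derivative is at most
  \<open>e * norm v\<close> uniformly in the direction.\<close>

lemma line_hol_has_derivative: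
  fixes h :: "complex ^ 'n \<Rightarrow> complex"
  assumes h: "line_hol h" and z: "z \<in> ball 0 1"
  shows "(h has_derivative (\<lambda>v. dir_deriv v h z)) (at z)"
  unfolding has_derivative_within_alt
proof (intro conjI allI impI)
  show "bounded_linear (\<lambda>v. dir_deriv v h z)"
    using linear_dir_deriv[OF h z] by (simp add: linear_conv_bounded_linear)
  fix e :: real assume e: "e > 0"
  \<comment> \<open>\<open>Q y\<close> controls the change of the derivative in all directions at
    once: by linearity finitely many real basis directions suffice.\<close>
  define Q where "Q y = (\<Sum>b\<in>Basis. cmod (dir_deriv b h y - dir_deriv b h z))" for y
  have "isCont Q z" unfolding Q_def
    by (intro continuous_intros isCont_dir_deriv[OF h z])
  then have "\<forall>\<^sub>F y in at z. dist (Q y) (Q z) < e"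
    using e by (simp add: continuous_within tendstoD)
  moreover have "Q z = 0" by (simp add: Q_def)
  ultimately have "\<forall>\<^sub>F y in nhds z. Q y < e"
    using e by (simp add: eventually_at_filter dist_norm) (smt (verit) eventually_mono)
  then obtain d where d: "d > 0" "\<And>y. dist y z < d \<Longrightarrow> Q y < e"
    unfolding eventually_nhds_metric by blast
  have "open (ball z d \<inter> ball 0 1)" by (intro open_Int open_ball)
  then obtain d' where d': "d' > 0" "ball z d' \<subseteq> ball z d \<inter> ball 0 1"
    using z d(1) by (auto elim!: openE)
  show "\<exists>d>0. \<forall>y\<in>UNIV. norm (y - z) < d \<longrightarrow> norm (h y - h z - dir_deriv (y - z) h z) \<le> e * norm (y - z)"
  proof (intro exI conjI ballI impI)
    show "d' > 0" by fact
    fix y :: "complex ^ 'n" assume y: "norm (y - z) < d'"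
    define v where "v = y - z"
    have inb: "z + t *s v \<in> ball z d'" if "t \<in> cball 0 1" for t
    proof -
      have "cmod t * norm v \<le> 1 * norm v" using that by (intro mult_right_mono) auto
      then have "norm (t *s v) < d'" using y unfolding norm_smult v_def by linarith
      then show ?thesis by (simp add: dist_norm)
    qed
    have "cmod ((h (z + 1 *s v) - dir_deriv v h z * 1) - (h (z + 0 *s v) - dir_deriv v h z * 0)) \<le> (e * norm v) * cmod (1 - 0)"
    proof (rule field_differentiable_bound)
      fix t assume t: "t \<in> cball (0::complex) 1"
      have b: "z + t *s v \<in> ball 0 1" using inb[OF t] d' by blast
      show "((\<lambda>t. h (z + t *s v) - dir_deriv v h z * t) has_field_derivative
          dir_deriv v h (z + t *s v) - dir_deriv v h z) (at t within cball 0 1)"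
        by (rule has_field_derivative_at_within)
          (auto intro!: derivative_eq_intros line_hol_derivative[OF h b])
      have lin: "dir_deriv v h y = (\<Sum>b\<in>Basis. (v \<bullet> b) *\<^sub>R dir_deriv b h y)" if "y \<in> ball 0 1" for y
      proof -
        note L = linear_dir_deriv[OF h that]
        have "dir_deriv (\<Sum>b\<in>Basis. (v \<bullet> b) *\<^sub>R b) h y = (\<Sum>b\<in>Basis. dir_deriv ((v \<bullet> b) *\<^sub>R b) h y)"
          by (rule linear_sum[OF L])
        also have "\<dots> = (\<Sum>b\<in>Basis. (v \<bullet> b) *\<^sub>R dir_deriv b h y)"
          by (intro sum.cong refl linear_scale[OF L])
        finally show ?thesis by (simp add: euclidean_representation)
      qed
      have "dir_deriv v h (z + t *s v) - dir_deriv v h z =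
          (\<Sum>b\<in>Basis. (v \<bullet> b) *\<^sub>R (dir_deriv b h (z + t *s v) - dir_deriv b h z))"
        unfolding lin[OF b] lin[OF z] by (simp add: sum_subtractf scaleR_diff_right)
      also have "cmod \<dots> \<le> (\<Sum>b\<in>Basis. norm v * cmod (dir_deriv b h (z + t *s v) - dir_deriv b h z))"
        by (rule sum_norm_le) (simp add: mult_right_mono Basis_le_norm)
      also have "\<dots> = norm v * Q (z + t *s v)" by (simp add: Q_def sum_distrib_left)
      also have "\<dots> \<le> norm v * e"
        using d(2)[of "z + t *s v"] inb[OF t] d' by (intro mult_left_mono) (force simp: dist_commute)+
      finally show "cmod (dir_deriv v h (z + t *s v) - dir_deriv v h z) \<le> e * norm v"
        by (simp add: mult.commute)
    qed auto
    then show "norm (h y - h z - dir_deriv (y - z) h z) \<le> e * norm (y - z)"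
      by (simp add: v_def algebra_simps)
  qed
qed

text \<open>From here on \<open>line_hol\<close> replaces the Frechet notion; it passes to iterated
  radial derivatives without further work.\<close>

lemma holomorphic_ball_iff_line_hol: "holomorphic_ball h \<longleftrightarrow> line_hol h"
proof
  assume "line_hol h"
  then show "holomorphic_ball h"
    unfolding holomorphic_ball_def
    using line_hol_has_derivative dir_deriv_scale by blast
next
  assume h: "holomorphic_ball h"
  show "line_hol h"
    unfolding line_hol_def
  proof (intro conjI allI)
    show "continuous_on (ball 0 1) h"
      using h unfolding holomorphic_ball_def
      by (meson continuous_at_imp_continuous_on has_derivative_continuous)
    fix z v
    show "(\<lambda>t. h (z + t *s v)) holomorphic_on {t. z + t *s v \<in> ball 0 1}"
    proof (rule holomorphic_on_open[THEN iffD2, OF open_line], safe)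
      fix t assume "z + t *s v \<in> ball 0 1"
      then obtain L where L: "(h has_derivative L) (at (z + t *s v))" "\<And>c v. L (c *s v) = c * L v"
        using h unfolding holomorphic_ball_def by blast
      have "((\<lambda>t. z + t *s v) has_derivative (\<lambda>t. t *s v)) (at t)"
        using bounded_linear.has_derivative[OF bounded_bilinear.bounded_linear_left[OF bounded_bilinear_smult, of v], of "\<lambda>t. t" "\<lambda>t. t"]
        by (auto intro!: derivative_eq_intros)
      from has_derivative_compose[OF this L(1)]
      have "((\<lambda>t. h (z + t *s v)) has_derivative (\<lambda>t. t * L v)) (at t)" by (simp add: L(2))
      then show "\<exists>D. ((\<lambda>t. h (z + t *s v)) has_field_derivative D) (at t)"
        unfolding has_field_derivative_def by (auto simp: mult.commute[of _ "L v"])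
    qed
  qed
qed

section \<open>The radial derivative\<close>

lemma partial_deriv_eq:
  fixes z :: "complex ^ 'n"
  shows "partial_deriv j h z = dir_deriv (axis j 1) h z"
proof -
  have "(axis j t :: complex ^ 'n) = t *s axis j 1" for t by (simp add: vec_eq_iff axis_def)
  then have "(\<lambda>t. h (z + axis j t)) = (\<lambda>t. h (z + t *s axis j 1))" by metis
  then show ?thesis by (simp add: partial_deriv_def dir_deriv_def)
qed

text \<open>By linearity the partial derivatives combine to one derivative along \<open>z\<close>,
  so one-variable estimates on the complex line through 0 and \<open>z\<close> apply.\<close>

lemma radial_deriv_eq:
  fixes h :: "complex ^ 'n \<Rightarrow> complex"
  assumes h: "line_hol h" and z: "z \<in> ball 0 1"
  shows "radial_deriv h z = dir_deriv z h z"
proof -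
  have "dir_deriv (\<Sum>j\<in>UNIV. (z $ j) *s axis j 1) h z = (\<Sum>j\<in>UNIV. dir_deriv ((z $ j) *s axis j 1) h z)"
    by (rule linear_sum[OF linear_dir_deriv[OF h z]])
  then show ?thesis
    by (simp add: radial_deriv_def partial_deriv_eq dir_deriv_scale[OF h z] basis_expansion)
qed

text \<open>The coordinate form is used here, because the partial derivatives have fixed directions
  and so fall under \<open>line_hol_dir_deriv\<close>, while the direction \<open>z\<close>
  varies.\<close>

lemma line_hol_radial_deriv:
  assumes h: "line_hol h"
  shows "line_hol (radial_deriv h)"
  unfolding line_hol_def radial_deriv_def partial_deriv_eq
proof (intro conjI allI)
  show "continuous_on (ball 0 1) (\<lambda>z. \<Sum>j\<in>UNIV. z $ j * dir_deriv (axis j 1) h z)"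
    by (intro continuous_intros continuous_on_dir_deriv[OF h])
  show "(\<lambda>t. \<Sum>j\<in>UNIV. (z + t *s v) $ j * dir_deriv (axis j 1) h (z + t *s v)) holomorphic_on {t. z + t *s v \<in> ball 0 1}" for z v
    unfolding vector_add_component vector_smult_component
    by (intro holomorphic_intros line_hol_holomorphic line_hol_dir_deriv h)
qed

lemma line_hol_radial_deriv_iterate: "line_hol h \<Longrightarrow> line_hol ((radial_deriv ^^ k) h)"
  by (induction k) (auto intro: line_hol_radial_deriv)

section \<open>Geometry of Bergman balls\<close>

lemma hinner_add_left: "hinner (x + y) z = hinner x z + hinner y z"
  by (simp add: hinner_def distrib_right sum.distrib)

lemma hinner_diff_left: "hinner (x - y) z = hinner x z - hinner y z"
  by (simp add: hinner_def left_diff_distrib sum_subtractf)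

lemma hinner_diff_right: "hinner z (x - y) = hinner z x - hinner z y"
  by (simp add: hinner_def right_diff_distrib sum_subtractf)

lemma hinner_smult_left: "hinner (c *s x) z = c * hinner x z"
  by (simp add: hinner_def sum_distrib_left mult.assoc)

lemma hinner_smult_right: "hinner z (c *s x) = cnj c * hinner z x"
  by (simp add: hinner_def sum_distrib_left mult_ac)

lemma hinner_scaleR_left: "hinner (c *\<^sub>R x) z = of_real c * hinner x z"
  by (simp add: hinner_smult_left flip: smult_of_real)

lemma hinner_scaleR_right: "hinner z (c *\<^sub>R x) = of_real c * hinner z x"
  by (simp add: hinner_smult_right flip: smult_of_real)

lemma hinner_zero [simp]: "hinner 0 z = 0" "hinner z 0 = 0"
  by (simp_all add: hinner_def)

lemma hinner_commute: "hinner x y = cnj (hinner y x)"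
  by (simp add: hinner_def mult.commute)

lemma norm_one_minus_hinner_commute: "cmod (1 - hinner x y) = cmod (1 - hinner y x)"
  by (subst hinner_commute) (metis complex_cnj_diff complex_cnj_one complex_mod_cnj)

lemma Re_hinner: "Re (hinner x y) = x \<bullet> y"
  by (simp add: hinner_def inner_vec_def inner_complex_def)

lemma hinner_self: "hinner x x = complex_of_real ((norm x)\<^sup>2)"
proof -
  have "Im (hinner x x) = 0" by (simp add: hinner_def)
  then show ?thesis by (simp add: complex_eq_iff Re_hinner power2_norm_eq_inner)
qed

lemma norm_diff_hinner: "(norm (x - y))\<^sup>2 = (norm x)\<^sup>2 + (norm y)\<^sup>2 - 2 * Re (hinner x y)"
  by (simp add: Re_hinner power2_norm_eq_inner inner_diff_left inner_diff_right inner_commute)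

lemma norm_add_hinner: "(norm (x + y))\<^sup>2 = (norm x)\<^sup>2 + (norm y)\<^sup>2 + 2 * Re (hinner x y)"
  by (simp add: Re_hinner power2_norm_eq_inner inner_add_left inner_add_right inner_commute)

lemma norm_hinner_le: "cmod (hinner x y) \<le> norm x * norm y"
proof (cases "hinner x y = 0")
  case False
  define c where "c = cnj (sgn (hinner x y))"
  have c: "cmod c = 1" using False by (simp add: c_def norm_sgn)
  have "c * hinner x y = (hinner x y * cnj (hinner x y)) / cmod (hinner x y)"
    by (simp add: c_def sgn_eq)
  also have "\<dots> = cmod (hinner x y)"
    using False by (simp add: power2_eq_square flip: complex_norm_square)
  finally have "c * hinner x y = cmod (hinner x y)" .
  then have "cmod (hinner x y) = Re (hinner (c *s x) y)"
    by (simp only: hinner_smult_left Re_complex_of_real)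
  also have "\<dots> \<le> norm (c *s x) * norm y" unfolding Re_hinner by (rule norm_cauchy_schwarz)
  finally show ?thesis by (simp add: norm_smult c)
qed simp

lemma continuous_on_hinner [continuous_intros]:
  "continuous_on S f \<Longrightarrow> continuous_on S g \<Longrightarrow> continuous_on S (\<lambda>x. hinner (f x) (g x))"
  unfolding hinner_def by (intro continuous_intros)

section \<open>Bergman balls described by the Hermitian product\<close>

definition bdist :: "complex ^ 'n \<Rightarrow> real" where
  "bdist z = 1 - (norm z)\<^sup>2"

text \<open>Since \<open>1 - \<bar>\<phi>\<^sub>z w\<bar>\<^sup>2 = (1 - \<bar>z\<bar>\<^sup>2) (1 - \<bar>w\<bar>\<^sup>2) / \<bar>1 - \<langle>w,z\<rangle>\<bar>\<^sup>2\<close>, the Bergman balls are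
  exactly the following sets, with \<open>K = cosh\<^sup>2 \<gamma>\<close>.\<close>

definition hyp_ball :: "real \<Rightarrow> complex ^ 'n \<Rightarrow> (complex ^ 'n) set" where
  "hyp_ball K z = {w \<in> ball 0 1. (cmod (1 - hinner w z))\<^sup>2 < K * bdist z * bdist w}"

lemma bdist_pos: "z \<in> ball 0 1 \<Longrightarrow> bdist z > 0"
  by (simp add: bdist_def power_less_one_iff abs_square_less_1)

lemma bdist_le_1: "bdist z \<le> 1"
  by (simp add: bdist_def)

lemma continuous_on_bdist [continuous_intros]:
  "continuous_on S f \<Longrightarrow> continuous_on S (\<lambda>x. bdist (f x))"
  unfolding bdist_def by (intro continuous_intros)

lemma bdist_le_hinner:
  assumes "norm z \<le> 1" "norm w \<le> 1"
  shows "bdist w \<le> 2 * cmod (1 - hinner w z)"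
proof -
  have "1 - norm w \<le> cmod (1 - hinner w z)"
  proof -
    have "cmod (hinner w z) \<le> norm w * 1"
      using norm_hinner_le[of w z] mult_left_mono[OF assms(1), of "norm w"] by simp
    then show ?thesis using norm_triangle_ineq2[of 1 "hinner w z"] by simp
  qed
  moreover have "bdist w \<le> (1 - norm w) * 2"
  proof -
    have "bdist w = (1 - norm w) * (1 + norm w)"
      by (simp add: bdist_def power2_eq_square algebra_simps)
    also have "\<dots> \<le> (1 - norm w) * 2" using assms by (intro mult_left_mono) auto
    finally show ?thesis .
  qed
  ultimately show ?thesis by simp
qed

lemma norm_diff_le_hinner:
  assumes "norm z \<le> 1" "norm w \<le> 1"
  shows "(norm (w - z))\<^sup>2 \<le> 2 * cmod (1 - hinner w z)"
proof -
  have "(norm w)\<^sup>2 \<le> 1" "(norm z)\<^sup>2 \<le> 1" using assms by (simp_all add: power_le_one)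
  moreover have "1 - Re (hinner w z) \<le> cmod (1 - hinner w z)"
    using complex_Re_le_cmod[of "1 - hinner w z"] by simp
  ultimately show ?thesis unfolding norm_diff_hinner by linarith
qed

text \<open>Takes the place of the triangle inequality for the Bergman metric. Each of the two extra
  terms in \<open>eq\<close> is at most \<open>?A + ?B\<close>: \<open>bdist w\<close> by
  \<open>bdist_le_hinner\<close>, the product of differences by Cauchy-Schwarz and
  \<open>norm_diff_le_hinner\<close>. This accounts for the factor 3.\<close>

lemma hinner_quasi_triangle:
  assumes "norm u \<le> 1" "norm w \<le> 1" "norm z \<le> 1"
  shows "cmod (1 - hinner u z) \<le> 3 * (cmod (1 - hinner u w) + cmod (1 - hinner w z))"
proof -
  let ?A = "cmod (1 - hinner u w)" and ?B = "cmod (1 - hinner w z)"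
  have eq: "1 - hinner u z = (1 - hinner u w) + (1 - hinner w z) - of_real (bdist w) + hinner (u - w) (w - z)"
    by (simp add: hinner_diff_left hinner_diff_right hinner_self bdist_def)
  have "cmod (hinner (u - w) (w - z)) \<le> norm (u - w) * norm (w - z)" by (rule norm_hinner_le)
  also have "2 * \<dots> \<le> (norm (u - w))\<^sup>2 + (norm (w - z))\<^sup>2"
    using sum_squares_bound[of "norm (u - w)" "norm (w - z)"] by (simp add: mult.assoc)
  finally have "cmod (hinner (u - w) (w - z)) \<le> ?A + ?B"
    using norm_diff_le_hinner[of w u] norm_diff_le_hinner[of z w] assms by linarith
  moreover have "\<bar>bdist w\<bar> \<le> ?A + ?B"
  proof -
    have "bdist w \<le> 2 * ?A"
      using bdist_le_hinner[of u w] assms norm_one_minus_hinner_commute[of w u] by simp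
    moreover have "bdist w \<le> 2 * ?B" using bdist_le_hinner[of z w] assms by simp
    moreover have "bdist w \<ge> 0" using assms by (simp add: bdist_def power_le_one)
    ultimately show ?thesis by linarith
  qed
  moreover have "cmod (1 - hinner u z) \<le> ?A + ?B + \<bar>bdist w\<bar> + cmod (hinner (u - w) (w - z))"
    unfolding eq
    by (rule order_trans[OF norm_triangle_ineq] add_mono order_refl order_trans[OF norm_triangle_ineq4])+
      (simp_all add: norm_triangle_ineq)
  ultimately show ?thesis by (simp add: distrib_left)
qed

lemma hyp_ball_subset: "hyp_ball K z \<subseteq> ball 0 1"
  by (auto simp: hyp_ball_def)

lemma hyp_ball_sym: "z \<in> ball 0 1 \<Longrightarrow> w \<in> ball 0 1 \<Longrightarrow> w \<in> hyp_ball K z \<longleftrightarrow> z \<in> hyp_ball K w"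
  by (simp add: hyp_ball_def norm_one_minus_hinner_commute[of w z] mult_ac)

lemma hyp_ball_mono:
  assumes "K \<le> K'" "z \<in> ball 0 1"
  shows "hyp_ball K z \<subseteq> hyp_ball K' z"
proof
  fix w assume w: "w \<in> hyp_ball K z"
  then have "w \<in> ball 0 1" by (simp add: hyp_ball_def)
  then have "K * (bdist z * bdist w) \<le> K' * (bdist z * bdist w)"
    using assms bdist_pos[of z] bdist_pos[of w] by (intro mult_right_mono) auto
  with w show "w \<in> hyp_ball K' z" by (simp add: hyp_ball_def mult.assoc)
qed

lemma center_in_hyp_ball:
  assumes "K > 1" "z \<in> ball 0 1"
  shows "z \<in> hyp_ball K z"
proof -
  have "1 - hinner z z = of_real (bdist z)" by (simp add: hinner_self bdist_def)
  then have "cmod (1 - hinner z z) = bdist z" using bdist_pos[OF assms(2)] by simp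
  then show ?thesis using assms bdist_pos[OF assms(2)] by (simp add: hyp_ball_def power2_eq_square)
qed

text \<open>The square of \<open>bdist w\<close> is at most four times the left side of the
  inequality defining the ball, and one factor \<open>bdist w\<close> cancels. The third claim holds
  because the ball contains a point.\<close>

lemma hyp_ball_bdist:
  assumes w: "w \<in> hyp_ball K z" and z: "z \<in> ball 0 1"
  shows "bdist w \<le> 4 * K * bdist z" "bdist z \<le> 4 * K * bdist w" "K > 0"
proof -
  have wb: "w \<in> ball 0 1" and wk: "(cmod (1 - hinner w z))\<^sup>2 < K * bdist z * bdist w"
    using w by (auto simp: hyp_ball_def)
  note p = bdist_pos[OF wb] bdist_pos[OF z]
  have "(bdist w)\<^sup>2 \<le> (2 * cmod (1 - hinner w z))\<^sup>2"
    using bdist_le_hinner[of z w] z wb p by (intro power_mono) auto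
  then have "bdist w * bdist w \<le> (4 * K * bdist z) * bdist w"
    using wk by (simp add: power2_eq_square mult_ac)
  then show "bdist w \<le> 4 * K * bdist z" using p by simp
  have "(bdist z)\<^sup>2 \<le> (2 * cmod (1 - hinner w z))\<^sup>2"
    using bdist_le_hinner[of w z] z wb p norm_one_minus_hinner_commute[of w z] by (intro power_mono) auto
  then have "bdist z * bdist z \<le> (4 * K * bdist w) * bdist z"
    using wk by (simp add: power2_eq_square mult_ac)
  then show "bdist z \<le> 4 * K * bdist w" using p by simp
  have "0 < K * (bdist z * bdist w)"
    using wk zero_le_power2[of "cmod (1 - hinner w z)"] by (simp only: mult.assoc)
  then show "K > 0" by (rule zero_less_mult_pos2) (use p in simp)
qed

text \<open>The constant is 18 * (4 + 4). Squaring the quasi-triangle inequality gives 18 times the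
  sum of squares, and eliminating \<open>bdist w\<close> with \<open>hyp_ball_bdist\<close> costs
  \<open>4 * K * K'\<close> in each of the two terms.\<close>

lemma hyp_ball_trans:
  assumes u: "u \<in> hyp_ball K w" and w: "w \<in> hyp_ball K' z" and z: "z \<in> ball 0 1"
  shows "u \<in> hyp_ball (144 * K * K') z"
proof -
  let ?A = "cmod (1 - hinner u w)" and ?B = "cmod (1 - hinner w z)"
  have ub: "u \<in> ball 0 1" and wb: "w \<in> ball 0 1" using u w by (auto simp: hyp_ball_def)
  note p = bdist_pos[OF wb] bdist_pos[OF z] bdist_pos[OF ub]
  have K: "K > 0" "K' > 0" using hyp_ball_bdist(3) u w z wb by blast+
  have A: "?A\<^sup>2 < K * bdist w * bdist u" and B: "?B\<^sup>2 < K' * bdist z * bdist w"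
    using u w by (auto simp: hyp_ball_def)
  have "(cmod (1 - hinner u z))\<^sup>2 \<le> (3 * (?A + ?B))\<^sup>2"
    using hinner_quasi_triangle[of u w z] ub wb z by (intro power_mono) auto
  also have "\<dots> \<le> 18 * (?A\<^sup>2 + ?B\<^sup>2)"
    using sum_squares_bound[of ?A ?B] by (simp add: power2_eq_square algebra_simps)
  also have "\<dots> < 18 * (K * bdist w * bdist u + K' * bdist z * bdist w)" using A B by simp
  also have "\<dots> \<le> 18 * (K * (4 * K' * bdist z) * bdist u + K' * bdist z * (4 * K * bdist u))"
    using hyp_ball_bdist(1)[OF w z] hyp_ball_bdist(2)[OF u wb] p K
    by (intro mult_left_mono add_mono mult_right_mono) auto
  also have "\<dots> = 144 * K * K' * bdist z * bdist u" by simp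
  finally show ?thesis using ub by (simp add: hyp_ball_def)
qed

text \<open>Split \<open>w = l *s z + Q\<close> with \<open>Q\<close> orthogonal to
  \<open>z\<close>. The numerator of the involution is then (1 - l) z - s Q, whose norm is given by
  Pythagoras.\<close>

lemma norm_ball_involution:
  assumes z: "z \<in> ball 0 1" and w: "w \<in> ball 0 1"
  shows "1 - (norm (ball_involution z w))\<^sup>2 = bdist z * bdist w / (cmod (1 - hinner w z))\<^sup>2"
proof (cases "z = 0")
  case True
  then show ?thesis by (simp add: ball_involution_def bdist_def)
next
  case False
  define m where "m = (norm z)\<^sup>2"
  define l where "l = hinner w z / complex_of_real m"
  define Q where "Q = w - l *s z"
  define s where "s = sqrt (1 - m)"
  have m: "m > 0" "m < 1" using False z by (auto simp: m_def power_less_one_iff abs_square_less_1)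
  have wz: "hinner w z = m * l" using m by (simp add: l_def)
  have Qz: "hinner Q z = 0"
    by (simp add: Q_def hinner_diff_left hinner_smult_left hinner_self wz m_def)
  have nz: "1 - hinner w z \<noteq> 0"
    using bdist_le_hinner[of z w] bdist_pos[OF w] w z by auto
  have nQ: "(norm Q)\<^sup>2 = (norm w)\<^sup>2 - (cmod l)\<^sup>2 * m"
  proof -
    have "(norm (Q + l *s z))\<^sup>2 = (norm Q)\<^sup>2 + (cmod l)\<^sup>2 * m"
      by (simp add: norm_add_hinner hinner_smult_right Qz norm_smult m_def power_mult_distrib)
    then show ?thesis by (simp add: Q_def)
  qed
  have "proj_line z w = l *s z" by (simp add: proj_line_def l_def m_def)
  then have "ball_involution z w = inverse (1 - hinner w z) *s ((1 - l) *s z - s *\<^sub>R Q)"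
    using False by (simp add: ball_involution_def Q_def s_def m_def vector_sub_rdistrib)
  then have "norm (ball_involution z w) = norm ((1 - l) *s z - s *\<^sub>R Q) / cmod (1 - hinner w z)"
    by (simp only: norm_smult norm_inverse) (simp add: field_simps)
  then have "(norm (ball_involution z w))\<^sup>2 * (cmod (1 - hinner w z))\<^sup>2 = (norm ((1 - l) *s z - s *\<^sub>R Q))\<^sup>2"
    using nz by (simp add: power_divide)
  also have "\<dots> = (cmod (1 - l))\<^sup>2 * m + (1 - m) * ((norm w)\<^sup>2 - (cmod l)\<^sup>2 * m)"
  proof -
    have "hinner z Q = 0" using Qz hinner_commute[of z Q] by simp
    then have "hinner ((1 - l) *s z) (s *\<^sub>R Q) = 0"
      by (simp only: hinner_smult_left hinner_scaleR_right) simp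
    moreover have "s\<^sup>2 = 1 - m" using m by (simp add: s_def)
    ultimately show ?thesis
      by (simp only: norm_diff_hinner[of "(1 - l) *s z"] norm_smult norm_scaleR power_mult_distrib nQ)
        (simp add: m_def)
  qed
  finally have "(1 - (norm (ball_involution z w))\<^sup>2) * (cmod (1 - hinner w z))\<^sup>2 =
      (cmod (1 - m * l))\<^sup>2 - ((cmod (1 - l))\<^sup>2 * m + (1 - m) * ((norm w)\<^sup>2 - (cmod l)\<^sup>2 * m))"
    by (simp add: left_diff_distrib wz)
  also have "\<dots> = bdist z * bdist w"
    unfolding cmod_power2 bdist_def m_def[symmetric]
    by (simp add: power2_eq_square algebra_simps)
  finally show ?thesis using nz by (simp add: field_simps)
qed

text \<open>With X = exp(2 \<gamma>) and r the norm of the involution, the metric is below \<gamma>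
  iff r < (X - 1) / (X + 1) = tanh \<gamma>, that is, iff 1 - r^2 > 4 X / (X + 1)^2 = 1 / cosh^2
  \<gamma>.\<close>

lemma bergman_ball_eq_hyp_ball:
  assumes "\<gamma> > 0" and z: "z \<in> ball 0 1"
  shows "bergman_ball z \<gamma> = hyp_ball ((exp (2 * \<gamma>) + 1)\<^sup>2 / (4 * exp (2 * \<gamma>))) z"
proof -
  define X where "X = exp (2 * \<gamma>)"
  have X: "X > 1" using assms by (simp add: X_def)
  have "bergman_metric z w < \<gamma> \<longleftrightarrow> (cmod (1 - hinner w z))\<^sup>2 < (X + 1)\<^sup>2 / (4 * X) * bdist z * bdist w"
    if w: "w \<in> ball 0 1" for w
  proof -
    define r where "r = norm (ball_involution z w)"
    define D where "D = (cmod (1 - hinner w z))\<^sup>2"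
    have nz: "D > 0"
      using bdist_le_hinner[of z w] bdist_pos[OF w] w z by (auto simp: D_def)
    have r: "1 - r\<^sup>2 = bdist z * bdist w / D"
      using norm_ball_involution[OF z w] by (simp add: r_def D_def)
    moreover have "\<dots> > 0" using nz bdist_pos[OF z] bdist_pos[OF w] by simp
    ultimately have "r\<^sup>2 < 1" by linarith
    then have r1: "r < 1" "r \<ge> 0" by (auto simp: r_def abs_square_less_1)
    have "bergman_metric z w < \<gamma> \<longleftrightarrow> ln ((1 + r) / (1 - r)) < ln X"
      by (simp add: bergman_metric_def r_def X_def field_simps)
    also have "\<dots> \<longleftrightarrow> (1 + r) / (1 - r) < X"
      using X r1 by (intro ln_less_cancel_iff) auto
    also have "\<dots> \<longleftrightarrow> r * (X + 1) < X - 1" using r1 by (simp add: field_simps)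
    also have "\<dots> \<longleftrightarrow> (r * (X + 1))\<^sup>2 < (X - 1)\<^sup>2"
      using X r1 power_strict_mono[of "r * (X + 1)" "X - 1" 2] power2_less_imp_less[of "r * (X + 1)" "X - 1"]
      by auto
    also have "\<dots> \<longleftrightarrow> 4 * X < (X + 1)\<^sup>2 * (1 - r\<^sup>2)"
      by (simp add: power2_eq_square algebra_simps)
    also have "\<dots> \<longleftrightarrow> D < (X + 1)\<^sup>2 / (4 * X) * bdist z * bdist w"
      unfolding r using nz X by (simp add: field_simps)
    finally show ?thesis by (simp add: D_def)
  qed
  then show ?thesis by (auto simp: bergman_ball_def hyp_ball_def X_def)
qed

section \<open>Volumes\<close>

lemma borel_measurable_linear:
  fixes L :: "'a::euclidean_space \<Rightarrow> 'b::euclidean_space"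
  assumes "linear L"
  shows "L \<in> borel_measurable borel"
  using assms by (intro borel_measurable_continuous_onI linear_continuous_on)
    (simp add: linear_conv_bounded_linear)

lemma nn_integral_lborel_translate:
  fixes f :: "'a::euclidean_space \<Rightarrow> ennreal"
  assumes [measurable]: "f \<in> borel_measurable borel"
  shows "(\<integral>\<^sup>+x. f (c + x) \<partial>lborel) = (\<integral>\<^sup>+x. f x \<partial>lborel)"
proof -
  have "(\<integral>\<^sup>+x. f x \<partial>lborel) = (\<integral>\<^sup>+x. f x \<partial>distr lborel borel ((+) c))"
    by (simp add: lborel_distr_plus)
  also have "\<dots> = (\<integral>\<^sup>+x. f (c + x) \<partial>lborel)" by (subst nn_integral_distr) auto
  finally show ?thesis by simp
qed

lemma nn_integral_lborel_scale:
  fixes f :: "'a::euclidean_space \<Rightarrow> ennreal"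
  assumes [measurable]: "f \<in> borel_measurable borel" and c: "c > 0"
  shows "(\<integral>\<^sup>+x. f x \<partial>lborel) = ennreal (c ^ DIM('a)) * (\<integral>\<^sup>+x. f (c *\<^sub>R x) \<partial>lborel)"
  using c by (subst lborel_affine[of c 0])
    (simp_all add: nn_integral_density nn_integral_distr nn_integral_cmult)

text \<open>Both integrals times the volume of the unit ball \<open>b\<close> are equal to
  \<open>\<integral>\<integral> 1\<^sub>b(x) f(y + L x)\<close>, as translations preserve the measure and \<open>L\<close> preserves \<open>b\<close>.\<close>

lemma nn_integral_lborel_isometry:
  fixes f :: "'a::euclidean_space \<Rightarrow> ennreal" and L :: "'a \<Rightarrow> 'a"
  assumes [measurable]: "f \<in> borel_measurable borel" and L: "linear L" "\<And>x. norm (L x) = norm x"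
  shows "(\<integral>\<^sup>+x. f (L x) \<partial>lborel) = (\<integral>\<^sup>+x. f x \<partial>lborel)"
proof -
  note [measurable] = borel_measurable_linear[OF L(1)]
  have "inj L"
    using L by (metis linear_injective_0 norm_eq_zero)
  then obtain L' where L': "linear L'" "\<And>x. L (L' x) = x"
    using linear_injective_isomorphism[OF L(1)] by auto
  note [measurable] = borel_measurable_linear[OF L'(1)]
  let ?b = "ball 0 1 :: 'a set"
  let ?I = "indicator ?b :: 'a \<Rightarrow> ennreal"
  have [measurable]: "ball x 1 \<in> sets borel" for x :: 'a by simp
  have "(\<integral>\<^sup>+x. f x \<partial>lborel) * emeasure lborel ?b = (\<integral>\<^sup>+x. ?I x * (\<integral>\<^sup>+y. f y \<partial>lborel) \<partial>lborel)"
  proof -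
    have "(\<integral>\<^sup>+x. ?I x * (\<integral>\<^sup>+y. f y \<partial>lborel) \<partial>lborel) = (\<integral>\<^sup>+x. ?I x \<partial>lborel) * (\<integral>\<^sup>+y. f y \<partial>lborel)"
      by (rule nn_integral_multc) simp
    also have "(\<integral>\<^sup>+x. ?I x \<partial>lborel) = emeasure lborel ?b"
      by (rule nn_integral_indicator) simp
    finally show ?thesis by (simp only: mult.commute)
  qed
  also have "\<dots> = (\<integral>\<^sup>+x. ?I x * (\<integral>\<^sup>+y. f (L x + y) \<partial>lborel) \<partial>lborel)"
    by (simp add: nn_integral_lborel_translate)
  also have "\<dots> = (\<integral>\<^sup>+x. \<integral>\<^sup>+y. ?I x * f (L x + y) \<partial>lborel \<partial>lborel)"
    by (simp add: nn_integral_cmult)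
  also have "\<dots> = (\<integral>\<^sup>+y. \<integral>\<^sup>+x. ?I x * f (L x + y) \<partial>lborel \<partial>lborel)"
    by (rule lborel_pair.Fubini'[symmetric]) simp
  \<comment> \<open>Shifting \<open>x\<close> by \<open>- L' y\<close> turns \<open>L x + y\<close>
    into \<open>L x\<close>. As \<open>L\<close> preserves norms, the indicator becomes a condition
    on the distance from \<open>L x\<close> to \<open>y\<close>, which is then integrated over
    \<open>y\<close>.\<close>
  also have "\<dots> = (\<integral>\<^sup>+y. \<integral>\<^sup>+x. ?I (- L' y + x) * f (L (- L' y + x) + y) \<partial>lborel \<partial>lborel)"
    by (intro nn_integral_cong nn_integral_lborel_translate[symmetric]) simp
  also have "\<dots> = (\<integral>\<^sup>+y. \<integral>\<^sup>+x. indicator {..<1} (norm (L x - y)) * f (L x) \<partial>lborel \<partial>lborel)"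
  proof (intro nn_integral_cong)
    fix x y
    have "L (- L' y + x) = L x - y" by (simp add: L' linear_diff[OF L(1)])
    moreover from this have "norm (- L' y + x) = norm (L x - y)" by (metis L(2))
    then have "- L' y + x \<in> ?b \<longleftrightarrow> norm (L x - y) < 1" by simp
    ultimately show "?I (- L' y + x) * f (L (- L' y + x) + y) = indicator {..<1} (norm (L x - y)) * f (L x)"
      by (simp add: indicator_def del: mem_ball)
  qed
  also have "\<dots> = (\<integral>\<^sup>+x. \<integral>\<^sup>+y. indicator {..<1} (norm (L x - y)) * f (L x) \<partial>lborel \<partial>lborel)"
    by (rule lborel_pair.Fubini'[symmetric]) simp
  also have "\<dots> = (\<integral>\<^sup>+x. emeasure lborel ?b * f (L x) \<partial>lborel)"
  proof (intro nn_integral_cong)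
    fix x
    have "(\<integral>\<^sup>+y. indicator {..<1} (norm (L x - y)) * f (L x) \<partial>lborel) =
        (\<integral>\<^sup>+y. indicator (ball (L x) 1) y \<partial>lborel) * f (L x)"
      by (subst nn_integral_multc[symmetric]) (measurable, auto intro!: nn_integral_cong simp: indicator_def dist_norm)
    then show "(\<integral>\<^sup>+y. indicator {..<1} (norm (L x - y)) * f (L x) \<partial>lborel) = emeasure lborel ?b * f (L x)"
      by (simp add: emeasure_ball)
  qed
  also have "\<dots> = (\<integral>\<^sup>+x. f (L x) \<partial>lborel) * emeasure lborel ?b"
    by (subst nn_integral_cmult) (simp_all only: mult.commute, measurable)
  finally have "emeasure lborel ?b * (\<integral>\<^sup>+x. f (L x) \<partial>lborel) = emeasure lborel ?b * (\<integral>\<^sup>+x. f x \<partial>lborel)"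
    by (simp only: mult.commute)
  moreover have "emeasure lborel ?b \<noteq> 0" "emeasure lborel ?b \<noteq> top"
    using unit_ball_vol_pos[of "DIM('a)"] by (simp_all add: emeasure_ball del: unit_ball_vol_pos)
  ultimately show ?thesis by (simp add: ennreal_mult_cancel_left)
qed

section \<open>Slabs and their volume\<close>

lemma ball_borel [measurable]: "ball c r \<in> sets borel"
  by simp

text \<open>The bound \<open>a\<close> is put on all of \<open>v\<close>, not on its part orthogonal
  to \<open>z\<close>. No basis has to be chosen, the set makes sense for \<open>z = 0\<close>, and
  it is invariant under unit complex scalars, as averaging over circles requires.\<close>

definition slab :: "real \<Rightarrow> real \<Rightarrow> complex ^ 'n \<Rightarrow> (complex ^ 'n) set" where
  "slab a b z = {v. norm v < a \<and> cmod (hinner v z) < b}"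

lemma open_slab: "open (slab a b z)"
  unfolding slab_def by (intro open_Collect_conj open_Collect_less continuous_intros)

lemma slab_borel [measurable]: "slab a b z \<in> sets borel"
  by (simp add: open_slab)

lemma borel_measurable_hinner [measurable]:
  assumes [measurable]: "f \<in> borel_measurable M" "g \<in> borel_measurable M"
  shows "(\<lambda>x. hinner (f x) (g x)) \<in> borel_measurable M"
proof -
  have "continuous_on UNIV (\<lambda>p :: (complex ^ 'b) \<times> (complex ^ 'b). hinner (fst p) (snd p))"
    by (intro continuous_intros)
  then have [measurable]: "(\<lambda>p :: (complex ^ 'b) \<times> (complex ^ 'b). hinner (fst p) (snd p)) \<in> borel_measurable borel"
    by (rule borel_measurable_continuous_onI)
  have "(\<lambda>x. (f x, g x)) \<in> M \<rightarrow>\<^sub>M borel" by measurable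
  from measurable_compose[OF this, of "\<lambda>p. hinner (fst p) (snd p)"] show ?thesis by simp
qed

lemma borel_measurable_smult [measurable]:
  fixes g :: "_ \<Rightarrow> complex ^ 'b"
  assumes [measurable]: "f \<in> borel_measurable M" "g \<in> borel_measurable M"
  shows "(\<lambda>x. f x *s g x) \<in> borel_measurable M"
proof -
  have "continuous_on UNIV (\<lambda>p :: complex \<times> (complex ^ 'b). fst p *s snd p)"
    by (intro continuous_intros)
  then have [measurable]: "(\<lambda>p :: complex \<times> (complex ^ 'b). fst p *s snd p) \<in> borel_measurable borel"
    by (rule borel_measurable_continuous_onI)
  have "(\<lambda>x. (f x, g x)) \<in> M \<rightarrow>\<^sub>M borel" by measurable
  from measurable_compose[OF this, of "\<lambda>p. fst p *s snd p"] show ?thesis by simp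
qed

lemma emeasure_disc:
  assumes "m > 0" "b > 0"
  shows "emeasure lborel {\<mu>. cmod (\<zeta> - \<mu> * complex_of_real m) < b} = ennreal (pi * (b / m)\<^sup>2)"
proof -
  have "cmod (\<zeta> - \<mu> * complex_of_real m) = m * cmod (\<zeta> / m - \<mu>)" for \<mu>
  proof -
    have "\<zeta> - \<mu> * complex_of_real m = of_real m * (\<zeta> / m - \<mu>)"
      using assms by (simp add: field_simps)
    then show ?thesis using assms by (simp add: norm_mult)
  qed
  then have "{\<mu>. cmod (\<zeta> - \<mu> * complex_of_real m) < b} = ball (\<zeta> / m) (b / m)"
    using assms by (auto simp: dist_norm field_simps)
  then show ?thesis
    using assms emeasure_ball[of "b / m" "\<zeta> / m"] by (simp add: unit_ball_vol_2)
qed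

lemma ennreal_le_divideI:
  assumes "X * ennreal c \<le> ennreal d" "c > 0" "d \<ge> 0"
  shows "X \<le> ennreal (d / c)"
proof (cases X)
  case (real r)
  then show ?thesis using assms by (simp add: field_simps flip: ennreal_mult)
next
  case top
  then show ?thesis using assms by (simp add: ennreal_top_mult top_unique)
qed

lemma ennreal_divide_leI:
  assumes "ennreal d \<le> X * ennreal c" "c > 0" "d \<ge> 0"
  shows "ennreal (d / c) \<le> X"
proof (cases X)
  case (real r)
  then show ?thesis using assms by (simp add: field_simps flip: ennreal_mult)
qed simp

abbreviation unit_vol :: "'n itself \<Rightarrow> real" where
  "unit_vol (_ :: 'n itself) \<equiv> unit_ball_vol (real (2 * CARD('n)))"

lemma emeasure_ball_vec: "r \<ge> 0 \<Longrightarrow>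
  emeasure lborel (ball (c :: complex ^ 'n) r) = ennreal (unit_vol TYPE('n) * r ^ (2 * CARD('n)))"
  by (simp add: emeasure_ball mult.commute)

text \<open>Both volume bounds compute the double integral of \<open>1\<^bsub>slab\<^esub>(v - \<mu> z)\<close> over
  vectors \<open>v\<close> and scalars \<open>\<mu>\<close> in two ways.\<close>

lemma nn_integral_shear:
  fixes z :: "complex ^ 'n" and f :: "complex ^ 'n \<Rightarrow> ennreal" and g :: "complex \<Rightarrow> ennreal"
  assumes [measurable]: "f \<in> borel_measurable borel" "g \<in> borel_measurable borel"
  shows "(\<integral>\<^sup>+\<mu>. \<integral>\<^sup>+v. g \<mu> * f (v - \<mu> *s z) \<partial>lborel \<partial>lborel) = (\<integral>\<^sup>+\<mu>. g \<mu> \<partial>lborel) * (\<integral>\<^sup>+v. f v \<partial>lborel)"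
proof -
  have "(\<integral>\<^sup>+v. g \<mu> * f (v - \<mu> *s z) \<partial>lborel) = g \<mu> * (\<integral>\<^sup>+v. f v \<partial>lborel)" for \<mu>
    using nn_integral_lborel_translate[of f "- (\<mu> *s z)"]
    by (subst nn_integral_cmult) simp_all
  then show ?thesis by (simp add: nn_integral_multc)
qed

lemma emeasure_slab_le:
  fixes z :: "complex ^ 'n"
  assumes ab: "0 < a" "0 < b" and z: "1 / 2 \<le> norm z" "norm z \<le> 1"
  shows "emeasure lborel (slab a b z) \<le> ennreal (16 * unit_vol TYPE('n) * (4 * a\<^sup>2) ^ CARD('n) * (b / a)\<^sup>2)"
proof -
  define m where "m = (norm z)\<^sup>2"
  have m: "m \<ge> 1 / 4" using power_mono[OF z(1), of 2] by (simp add: m_def power2_eq_square)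
  have "emeasure lborel (slab a b z) * emeasure lborel (ball (0::complex) a) =
      (\<integral>\<^sup>+\<mu>. indicator (ball (0::complex) a) \<mu> \<partial>lborel) * (\<integral>\<^sup>+v. indicator (slab a b z) v \<partial>lborel)"
    by (simp add: mult.commute)
  also have "\<dots> = (\<integral>\<^sup>+\<mu>. \<integral>\<^sup>+v. indicator (ball (0::complex) a) \<mu> * indicator (slab a b z) (v - \<mu> *s z) \<partial>lborel \<partial>lborel)"
    by (rule nn_integral_shear[symmetric]) simp_all
  also have "\<dots> = (\<integral>\<^sup>+v. \<integral>\<^sup>+\<mu>. indicator (ball (0::complex) a) \<mu> * indicator (slab a b z) (v - \<mu> *s z) \<partial>lborel \<partial>lborel)"
    by (rule lborel_pair.Fubini') measurable
  \<comment> \<open>If \<open>v - \<mu> *s z\<close> is in the slab and \<open>\<mu>\<close> has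
    modulus below \<open>a\<close>, then \<open>v\<close> has norm below \<open>2 * a\<close>, and
    for fixed \<open>v\<close> the scalar is confined to a disc of radius
    \<open>b / m\<close>.\<close>
  also have "\<dots> \<le> (\<integral>\<^sup>+v. \<integral>\<^sup>+\<mu>. indicator (ball 0 (2 * a)) v * indicator {\<mu>. cmod (hinner v z - \<mu> * of_real m) < b} \<mu> \<partial>lborel \<partial>lborel)"
  proof (intro nn_integral_mono)
    fix v \<mu>
    show "indicator (ball (0::complex) a) \<mu> * indicator (slab a b z) (v - \<mu> *s z)
        \<le> (indicator (ball 0 (2 * a)) v * indicator {\<mu>. cmod (hinner v z - \<mu> * of_real m) < b} \<mu> :: ennreal)"
    proof (cases "cmod \<mu> < a \<and> v - \<mu> *s z \<in> slab a b z")
      case True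
      have "norm v \<le> norm (v - \<mu> *s z) + norm (\<mu> *s z)" by (metis diff_add_cancel norm_triangle_ineq)
      also have "norm (\<mu> *s z) \<le> cmod \<mu> * 1" unfolding norm_smult using z by (intro mult_left_mono) auto
      finally have "norm v < 2 * a" using True by (simp add: slab_def)
      moreover have "cmod (hinner v z - \<mu> * of_real m) < b"
        using True by (simp add: slab_def hinner_diff_left hinner_smult_left hinner_self m_def)
      ultimately show ?thesis by (simp add: indicator_def)
    qed (auto simp: indicator_def)
  qed
  also have "\<dots> = (\<integral>\<^sup>+v. indicator (ball 0 (2 * a)) v * ennreal (pi * (b / m)\<^sup>2) \<partial>(lborel :: (complex ^ 'n) measure))"
  proof (intro nn_integral_cong)
    fix v :: "complex ^ 'n"
    have "(\<integral>\<^sup>+\<mu>. indicator {\<mu>. cmod (hinner v z - \<mu> * of_real m) < b} \<mu> \<partial>lborel) = ennreal (pi * (b / m)\<^sup>2)"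
      using m ab by (subst nn_integral_indicator) (simp_all add: emeasure_disc)
    then show "(\<integral>\<^sup>+\<mu>. indicator (ball 0 (2 * a)) v * indicator {\<mu>. cmod (hinner v z - \<mu> * of_real m) < b} \<mu> \<partial>lborel) =
        indicator (ball 0 (2 * a)) v * ennreal (pi * (b / m)\<^sup>2)"
      by (subst nn_integral_cmult) simp_all
  qed
  also have "\<dots> = emeasure lborel (ball (0 :: complex ^ 'n) (2 * a)) * ennreal (pi * (b / m)\<^sup>2)"
    by (subst nn_integral_multc) simp_all
  also have "\<dots> = ennreal (unit_vol TYPE('n) * (4 * a\<^sup>2) ^ CARD('n) * (pi * (b / m)\<^sup>2))"
    using ab by (simp add: emeasure_ball_vec ennreal_mult power_mult power_mult_distrib)
  also have "\<dots> \<le> ennreal (unit_vol TYPE('n) * (4 * a\<^sup>2) ^ CARD('n) * (pi * (16 * b\<^sup>2)))"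
  proof (intro ennreal_leI mult_left_mono)
    have "b / m \<le> 4 * b" using m ab by (simp add: field_simps)
    then have "(b / m)\<^sup>2 \<le> (4 * b)\<^sup>2" using m ab by (intro power_mono) auto
    then show "(b / m)\<^sup>2 \<le> 16 * b\<^sup>2" by (simp add: power2_eq_square)
  qed auto
  finally have "emeasure lborel (slab a b z) * ennreal (pi * a\<^sup>2) \<le> \<dots>"
    using ab by (simp add: emeasure_ball unit_ball_vol_2)
  then have "emeasure lborel (slab a b z) \<le> ennreal (unit_vol TYPE('n) * (4 * a\<^sup>2) ^ CARD('n) * (pi * (16 * b\<^sup>2)) / (pi * a\<^sup>2))"
    using ab by (intro ennreal_le_divideI) auto
  also have "unit_vol TYPE('n) * (4 * a\<^sup>2) ^ CARD('n) * (pi * (16 * b\<^sup>2)) / (pi * a\<^sup>2) =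
      16 * unit_vol TYPE('n) * (4 * a\<^sup>2) ^ CARD('n) * (b / a)\<^sup>2"
    using ab by (simp add: field_simps)
  finally show ?thesis .
qed

lemma emeasure_slab_ge:
  fixes z :: "complex ^ 'n"
  assumes ab: "0 < b" "b \<le> a" and z: "1 / 2 \<le> norm z" "norm z \<le> 1"
  shows "ennreal (unit_vol TYPE('n) * (a\<^sup>2) ^ CARD('n) * (b / a)\<^sup>2 / 64) \<le> emeasure lborel (slab (9 * a) b z)"
proof -
  define m where "m = (norm z)\<^sup>2"
  have m: "m \<ge> 1 / 4" "m \<le> 1"
    using power_mono[OF z(1), of 2] z by (simp_all add: m_def power2_eq_square power_le_one mult_le_one)
  have "ennreal (unit_vol TYPE('n) * (a\<^sup>2) ^ CARD('n) * (pi * b\<^sup>2)) \<le>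
      ennreal (unit_vol TYPE('n) * (a\<^sup>2) ^ CARD('n) * (pi * (b / m)\<^sup>2))"
  proof (intro ennreal_leI mult_left_mono power_mono)
    show "b \<le> b / m" using m ab by (simp add: field_simps)
  qed (use ab in auto)
  also have "\<dots> = emeasure lborel (ball (0 :: complex ^ 'n) a) * ennreal (pi * (b / m)\<^sup>2)"
    using ab by (simp add: emeasure_ball_vec ennreal_mult power_mult power_mult_distrib)
  also have "\<dots> = (\<integral>\<^sup>+v. indicator (ball 0 a) v * ennreal (pi * (b / m)\<^sup>2) \<partial>(lborel :: (complex ^ 'n) measure))"
    by (subst nn_integral_multc) simp_all
  also have "\<dots> = (\<integral>\<^sup>+v. \<integral>\<^sup>+\<mu>. indicator (ball 0 a) v * indicator {\<mu>. cmod (hinner v z - \<mu> * of_real m) < b} \<mu> \<partial>lborel \<partial>lborel)"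
  proof (intro nn_integral_cong)
    fix v :: "complex ^ 'n"
    have "(\<integral>\<^sup>+\<mu>. indicator {\<mu>. cmod (hinner v z - \<mu> * of_real m) < b} \<mu> \<partial>lborel) = ennreal (pi * (b / m)\<^sup>2)"
      using m ab by (subst nn_integral_indicator) (simp_all add: emeasure_disc)
    then show "indicator (ball 0 a) v * ennreal (pi * (b / m)\<^sup>2) =
        (\<integral>\<^sup>+\<mu>. indicator (ball 0 a) v * indicator {\<mu>. cmod (hinner v z - \<mu> * of_real m) < b} \<mu> \<partial>lborel)"
      by (subst nn_integral_cmult) simp_all
  qed
  \<comment> \<open>Conversely, \<open>norm v < a\<close> and \<open>b \<le> a\<close> give
    \<open>cmod \<mu> * m < 2 * a\<close>, so \<open>cmod \<mu> < 8 * a\<close> because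
    \<open>m \<ge> 1 / 4\<close>; hence \<open>v - \<mu> *s z\<close> has norm below
    \<open>9 * a\<close>.\<close>
  also have "\<dots> \<le> (\<integral>\<^sup>+v. \<integral>\<^sup>+\<mu>. indicator (ball (0::complex) (8 * a)) \<mu> * indicator (slab (9 * a) b z) (v - \<mu> *s z) \<partial>lborel \<partial>lborel)"
  proof (intro nn_integral_mono)
    fix v :: "complex ^ 'n" and \<mu> :: complex
    show "(indicator (ball 0 a) v * indicator {\<mu>. cmod (hinner v z - \<mu> * of_real m) < b} \<mu> :: ennreal)
        \<le> indicator (ball (0::complex) (8 * a)) \<mu> * indicator (slab (9 * a) b z) (v - \<mu> *s z)"
    proof (cases "norm v < a \<and> cmod (hinner v z - \<mu> * of_real m) < b")
      case True
      have 1: "norm v * norm z \<le> norm v * 1" using z by (intro mult_left_mono) auto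
      have "cmod (\<mu> * of_real m) \<le> cmod (hinner v z - \<mu> * of_real m) + cmod (hinner v z)"
        by (metis norm_minus_commute norm_triangle_sub add.commute)
      then have 2: "cmod \<mu> * m < 2 * a"
        using True 1 norm_hinner_le[of v z] m ab by (simp add: norm_mult)
      have "cmod \<mu> * (1 / 4) \<le> cmod \<mu> * m" using m by (intro mult_left_mono) auto
      with 2 have 3: "cmod \<mu> < 8 * a" by simp
      have "norm (v - \<mu> *s z) \<le> norm v + norm (\<mu> *s z)" by (rule norm_triangle_ineq4)
      also have "norm (\<mu> *s z) \<le> cmod \<mu> * 1" unfolding norm_smult using z by (intro mult_left_mono) auto
      finally have "v - \<mu> *s z \<in> slab (9 * a) b z"
        using True 3 by (simp add: slab_def hinner_diff_left hinner_smult_left hinner_self m_def)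
      then show ?thesis using 3 by (simp add: indicator_def)
    qed (auto simp: indicator_def)
  qed
  also have "\<dots> = (\<integral>\<^sup>+\<mu>. \<integral>\<^sup>+v. indicator (ball (0::complex) (8 * a)) \<mu> * indicator (slab (9 * a) b z) (v - \<mu> *s z) \<partial>lborel \<partial>lborel)"
    by (rule lborel_pair.Fubini'[symmetric]) measurable
  also have "\<dots> = (\<integral>\<^sup>+\<mu>. indicator (ball (0::complex) (8 * a)) \<mu> \<partial>lborel) * (\<integral>\<^sup>+v. indicator (slab (9 * a) b z) v \<partial>lborel)"
    by (rule nn_integral_shear) simp_all
  also have "\<dots> = emeasure lborel (slab (9 * a) b z) * ennreal (pi * (64 * a\<^sup>2))"
    using ab by (simp add: mult.commute emeasure_ball unit_ball_vol_2 power_mult_distrib)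
  finally have "ennreal (unit_vol TYPE('n) * (a\<^sup>2) ^ CARD('n) * (pi * b\<^sup>2) / (pi * (64 * a\<^sup>2))) \<le> emeasure lborel (slab (9 * a) b z)"
    using ab by (intro ennreal_divide_leI) auto
  also have "unit_vol TYPE('n) * (a\<^sup>2) ^ CARD('n) * (pi * b\<^sup>2) / (pi * (64 * a\<^sup>2)) =
      unit_vol TYPE('n) * (a\<^sup>2) ^ CARD('n) * (b / a)\<^sup>2 / 64"
    using ab by (simp add: field_simps)
  finally show ?thesis .
qed

section \<open>Volume of Bergman balls\<close>

lemma open_hyp_ball: "open (hyp_ball K z)"
proof -
  have "open {w. (cmod (1 - hinner w z))\<^sup>2 < K * bdist z * bdist w}"
    by (intro open_Collect_less continuous_intros)
  then have "open (ball 0 1 \<inter> {w. (cmod (1 - hinner w z))\<^sup>2 < K * bdist z * bdist w})"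
    by (intro open_Int open_ball)
  moreover have "hyp_ball K z = ball 0 1 \<inter> {w. (cmod (1 - hinner w z))\<^sup>2 < K * bdist z * bdist w}"
    by (auto simp: hyp_ball_def)
  ultimately show ?thesis by simp
qed

lemma hyp_ball_borel [measurable]: "hyp_ball K z \<in> sets borel"
  by (simp add: open_hyp_ball)

text \<open>Comparability of \<open>bdist\<close> gives
  \<open>cmod (1 - hinner w z) < 2 * K * bdist z\<close>. The first size follows from
  \<open>norm_diff_le_hinner\<close>, the second from \<open>hinner (w - z) z\<close> being
  \<open>bdist z\<close> minus \<open>1 - hinner w z\<close>.\<close>

lemma hyp_ball_subset_slab:
  assumes w: "w \<in> hyp_ball K z" and z: "z \<in> ball 0 1"
  shows "w - z \<in> slab (2 * sqrt (K * bdist z)) ((1 + 2 * K) * bdist z) z"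
proof -
  have wb: "w \<in> ball 0 1" and wk: "(cmod (1 - hinner w z))\<^sup>2 < K * bdist z * bdist w"
    using w by (auto simp: hyp_ball_def)
  note p = bdist_pos[OF wb] bdist_pos[OF z]
  have K: "K > 0" using hyp_ball_bdist(3)[OF w z] .
  have "(cmod (1 - hinner w z))\<^sup>2 < K * bdist z * (4 * K * bdist z)"
    using K p mult_left_mono[OF hyp_ball_bdist(1)[OF w z], of "K * bdist z"]
    by (intro order_less_le_trans[OF wk]) simp
  then have "(cmod (1 - hinner w z))\<^sup>2 < (2 * K * bdist z)\<^sup>2" by (simp add: power2_eq_square mult_ac)
  then have A: "cmod (1 - hinner w z) < 2 * K * bdist z"
    by (rule power2_less_imp_less) (use K p in auto)
  have "(norm (w - z))\<^sup>2 \<le> 2 * cmod (1 - hinner w z)"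
    using norm_diff_le_hinner[of z w] z wb by simp
  also have "\<dots> < (2 * sqrt (K * bdist z))\<^sup>2" using A K p by (simp add: power_mult_distrib)
  finally have "norm (w - z) < 2 * sqrt (K * bdist z)"
    by (rule power2_less_imp_less) (use K p in auto)
  moreover have "hinner (w - z) z = of_real (bdist z) - (1 - hinner w z)"
    by (simp add: hinner_diff_left hinner_self bdist_def)
  then have "cmod (hinner (w - z) z) \<le> bdist z + cmod (1 - hinner w z)"
    using norm_triangle_ineq4[of "of_real (bdist z)" "1 - hinner w z"] p by simp
  then have "cmod (hinner (w - z) z) < (1 + 2 * K) * bdist z" using A by (simp add: algebra_simps)
  ultimately show ?thesis by (simp add: slab_def)
qed

text \<open>Away from the origin the surrounding slab has a of order d^(1/2) and b of order d, so
  its volume a^(2n) (b/a)^2 is of order d^(n+1). For \<open>norm z < 1 / 2\<close> one has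
  \<open>bdist z \<ge> 3 / 4\<close>, and the volume of the unit ball suffices.\<close>

lemma emeasure_hyp_ball_le:
  "\<exists>C>0. \<forall>z::complex ^ 'n. z \<in> ball 0 1 \<longrightarrow>
     emeasure lborel (hyp_ball K z) \<le> ennreal (C * bdist z ^ (CARD('n) + 1))"
proof -
  \<comment> \<open>The maximum covers arbitrary real \<open>K\<close>; for \<open>K \<le> 0\<close>
    the set is empty.\<close>
  define L where "L = max K 1"
  have L: "L \<ge> 1" "K \<le> L" by (auto simp: L_def)
  define V where "V = unit_vol TYPE('n)"
  have V: "V > 0" by (simp add: V_def)
  define C where "C = V * (4 / 3) ^ (CARD('n) + 1) + 16 * V * (16 * L) ^ CARD('n) * (1 + 2 * L)\<^sup>2 / (4 * L)"
  have C: "V * (4 / 3) ^ (CARD('n) + 1) \<le> C" "16 * V * (16 * L) ^ CARD('n) * (1 + 2 * L)\<^sup>2 / (4 * L) \<le> C"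
    using V L by (auto simp: C_def)
  have "C > 0" using C(1) V by (meson less_le_trans mult_pos_pos zero_less_power zero_less_divide_iff zero_less_numeral)
  moreover have "emeasure lborel (hyp_ball K z) \<le> ennreal (C * bdist z ^ (CARD('n) + 1))"
    if z: "z \<in> ball 0 1" for z :: "complex ^ 'n"
  proof (cases "norm z < 1 / 2")
    case True
    have "(norm z)\<^sup>2 \<le> (1 / 2)\<^sup>2" using True by (intro power_mono) auto
    then have d: "bdist z \<ge> 3 / 4" by (simp add: bdist_def power2_eq_square)
    have "emeasure lborel (hyp_ball K z) \<le> emeasure lborel (ball (0 :: complex ^ 'n) 1)"
      by (intro emeasure_mono hyp_ball_subset) simp
    also have "\<dots> = ennreal (V * 1)" by (simp add: emeasure_ball_vec V_def)
    also have "\<dots> \<le> ennreal (V * (4 / 3 * bdist z) ^ (CARD('n) + 1))"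
      using V d by (intro ennreal_leI mult_left_mono one_le_power) auto
    also have "\<dots> \<le> ennreal (C * bdist z ^ (CARD('n) + 1))"
      unfolding power_mult_distrib mult.assoc[symmetric]
      using C d by (intro ennreal_leI mult_right_mono) auto
    finally show ?thesis .
  next
    case False
    define d where "d = bdist z"
    have d: "d > 0" using bdist_pos[OF z] by (simp add: d_def)
    have "emeasure lborel (hyp_ball K z) \<le> emeasure lborel (hyp_ball L z)"
      by (intro emeasure_mono hyp_ball_mono L z) simp
    also have "\<dots> \<le> emeasure lborel ((\<lambda>w. - z + w) -` slab (2 * sqrt (L * d)) ((1 + 2 * L) * d) z)"
    proof (rule emeasure_mono)
      show "hyp_ball L z \<subseteq> (\<lambda>w. - z + w) -` slab (2 * sqrt (L * d)) ((1 + 2 * L) * d) z"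
        using hyp_ball_subset_slab[OF _ z, of _ L] by (auto simp: d_def)
      have "(\<lambda>w. - z + w) -` slab (2 * sqrt (L * d)) ((1 + 2 * L) * d) z \<in> sets borel"
        by (rule measurable_sets_borel[OF _ slab_borel]) measurable
      then show "(\<lambda>w. - z + w) -` slab (2 * sqrt (L * d)) ((1 + 2 * L) * d) z \<in> sets lborel" by simp
    qed
    also have "\<dots> = emeasure (distr lborel borel ((+) (- z))) (slab (2 * sqrt (L * d)) ((1 + 2 * L) * d) z)"
      by (subst emeasure_distr) auto
    also have "\<dots> = emeasure lborel (slab (2 * sqrt (L * d)) ((1 + 2 * L) * d) z)"
      by (simp only: lborel_distr_plus)
    also have "\<dots> \<le> ennreal (16 * V * (4 * (2 * sqrt (L * d))\<^sup>2) ^ CARD('n) * ((1 + 2 * L) * d / (2 * sqrt (L * d)))\<^sup>2)"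
      unfolding V_def by (rule emeasure_slab_le) (use d L False z in auto)
    also have "16 * V * (4 * (2 * sqrt (L * d))\<^sup>2) ^ CARD('n) * ((1 + 2 * L) * d / (2 * sqrt (L * d)))\<^sup>2
        = (16 * V * (16 * L) ^ CARD('n) * (1 + 2 * L)\<^sup>2 / (4 * L)) * d ^ (CARD('n) + 1)"
      using d L by (simp add: power_mult_distrib power_divide) (simp add: power2_eq_square field_simps)
    also have "\<dots> \<le> C * d ^ (CARD('n) + 1)"
      using C d by (intro mult_right_mono) auto
    finally show ?thesis using ennreal_leI by (auto simp: d_def)
  qed
  ultimately show ?thesis by blast
qed

text \<open>For such \<open>v\<close> the point \<open>z + v\<close> satisfies
  \<open>bdist (z + v) \<ge> d * (1 - 3 * c)\<close>, while the Hermitian distance to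
  \<open>z\<close> is at most \<open>d + c * d\<close>. It remains to ensure
  \<open>(1 + c)\<^sup>2 < K * (1 - 3 * c)\<close>.\<close>

lemma slab_subset_hyp_ball:
  assumes K: "K > 1"
  obtains c where "c > 0" "c \<le> 1 / 81"
    "\<And>z v :: complex ^ 'n. z \<in> ball 0 1 \<Longrightarrow> norm v \<le> sqrt (c * bdist z) \<Longrightarrow>
       cmod (hinner v z) \<le> c * bdist z \<Longrightarrow> z + v \<in> hyp_ball K z"
proof
  \<comment> \<open>The second entry of the minimum yields that strict inequality. The first makes
    \<open>c * d \<le> sqrt (c * d) / 9\<close>, the condition \<open>b \<le> a\<close> under which
    \<open>emeasure_slab_ge\<close> bounds a slab of radius \<open>9 * a\<close>.\<close>
  define c where "c = min (1 / 81) ((K - 1) / (4 * (K + 1)))"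
  show c: "c > 0" "c \<le> 1 / 81"
    using K by (simp add: c_def, simp only: c_def min.cobounded1)
  have "c \<le> (K - 1) / (4 * (K + 1))" by (simp add: c_def)
  then have cK: "4 * c * (K + 1) \<le> K - 1" using K by (simp add: field_simps)
  fix z v :: "complex ^ 'n"
  assume z: "z \<in> ball 0 1" and v: "norm v \<le> sqrt (c * bdist z)" "cmod (hinner v z) \<le> c * bdist z"
  define d where "d = bdist z"
  have d: "d > 0" using bdist_pos[OF z] by (simp add: d_def)
  have nv: "(norm v)\<^sup>2 \<le> c * d"
    using power_mono[OF v(1), of 2] c d by (simp add: d_def)
  have "\<bar>Re (hinner v z)\<bar> \<le> c * d" using v(2) abs_Re_le_cmod[of "hinner v z"] by (simp add: d_def)
  moreover have "bdist (z + v) = d - 2 * Re (hinner v z) - (norm v)\<^sup>2"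
    by (simp add: bdist_def d_def norm_add_hinner Re_hinner inner_commute)
  ultimately have bd: "bdist (z + v) \<ge> d * (1 - 3 * c)" using nv by (simp add: algebra_simps)
  then have "bdist (z + v) > 0" using d c mult_pos_pos[of d "1 - 3 * c"] by linarith
  then have inb: "z + v \<in> ball 0 1" by (simp add: bdist_def abs_square_less_1)
  have "1 - hinner (z + v) z = of_real d - hinner v z"
    by (simp add: hinner_add_left hinner_self d_def bdist_def)
  then have "cmod (1 - hinner (z + v) z) \<le> d + c * d"
    using norm_triangle_ineq4[of "of_real d" "hinner v z"] v(2) d by (simp add: d_def)
  then have "(cmod (1 - hinner (z + v) z))\<^sup>2 \<le> (d + c * d)\<^sup>2" by (intro power_mono) auto
  also have "\<dots> = d\<^sup>2 * (1 + c)\<^sup>2" by (simp add: power2_eq_square algebra_simps)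
  also have "\<dots> < d\<^sup>2 * (K * (1 - 3 * c))"
  proof (intro mult_strict_left_mono)
    have "c * c \<le> c * 1" using c by (intro mult_left_mono) auto
    then have "(1 + c)\<^sup>2 \<le> 1 + 3 * c" by (simp add: power2_eq_square algebra_simps)
    also have "\<dots> < K * (1 - 3 * c)"
      using cK c K mult_pos_pos[of c "K + 1"] by (simp add: algebra_simps)
    finally show "(1 + c)\<^sup>2 < K * (1 - 3 * c)" .
  qed (use d in simp)
  also have "\<dots> = K * d * (d * (1 - 3 * c))" by (simp add: power2_eq_square)
  also have "\<dots> \<le> K * d * bdist (z + v)" using bd K d by (intro mult_left_mono) auto
  finally show "z + v \<in> hyp_ball K z" using inb by (simp add: hyp_ball_def d_def)
qed

text \<open>Near the origin the slab contains a ball of radius \<open>c * bdist z\<close>; elsewhere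
  \<open>emeasure_slab_ge\<close> applies with a = sqrt(c d) / 9 and b = c d.\<close>

lemma emeasure_slab_bdist_ge:
  assumes c: "c > 0" "c \<le> 1 / 81"
  shows "\<exists>\<kappa>>0. \<forall>z::complex ^ 'n. z \<in> ball 0 1 \<longrightarrow>
     ennreal (\<kappa> * bdist z ^ (CARD('n) + 1)) \<le> emeasure lborel (slab (sqrt (c * bdist z)) (c * bdist z) z)"
proof -
  define V where "V = unit_vol TYPE('n)"
  have V: "V > 0" by (simp add: V_def)
  define k where "k = min (V * (c * (3 / 4)) ^ (2 * CARD('n))) (V * (c / 81) ^ CARD('n) * (81 * c) / 64)"
  have k: "k > 0" "k \<le> V * (c * (3 / 4)) ^ (2 * CARD('n))" "k \<le> V * (c / 81) ^ CARD('n) * (81 * c) / 64"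
    using V c by (auto simp: k_def)
  have "ennreal (k * bdist z ^ (CARD('n) + 1)) \<le> emeasure lborel (slab (sqrt (c * bdist z)) (c * bdist z) z)"
    if z: "z \<in> ball 0 1" for z :: "complex ^ 'n"
  proof (cases "norm z < 1 / 2")
    case True
    have "(norm z)\<^sup>2 \<le> (1 / 2)\<^sup>2" using True by (intro power_mono) auto
    then have d: "bdist z \<ge> 3 / 4" "bdist z \<le> 1" by (simp_all add: bdist_def power2_eq_square)
    have "k * bdist z ^ (CARD('n) + 1) \<le> k * 1"
      using k d by (intro mult_left_mono power_le_one) auto
    also have "\<dots> \<le> V * (c * (3 / 4)) ^ (2 * CARD('n))" using k by simp
    also have "\<dots> \<le> V * (c * bdist z) ^ (2 * CARD('n))"
      using V c d by (intro mult_left_mono power_mono) auto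
    finally have "ennreal (k * bdist z ^ (CARD('n) + 1)) \<le> emeasure lborel (ball (0 :: complex ^ 'n) (c * bdist z))"
      using c d by (simp add: emeasure_ball_vec V_def ennreal_leI)
    also have "\<dots> \<le> emeasure lborel (slab (sqrt (c * bdist z)) (c * bdist z) z)"
    proof (intro emeasure_mono subsetI)
      fix v :: "complex ^ 'n" assume v: "v \<in> ball 0 (c * bdist z)"
      have "c * bdist z \<le> 1 * 1" using c d by (intro mult_mono) auto
      then have "(c * bdist z) * (c * bdist z) \<le> (c * bdist z) * 1"
        using c d by (intro mult_left_mono) auto
      then have "c * bdist z \<le> sqrt (c * bdist z)" by (intro real_le_rsqrt) (simp add: power2_eq_square)
      moreover have "cmod (hinner v z) \<le> norm v * 1"
        using norm_hinner_le[of v z] mult_left_mono[of "norm z" 1 "norm v"] True by simp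
      ultimately show "v \<in> slab (sqrt (c * bdist z)) (c * bdist z) z" using v by (simp add: slab_def)
    qed simp
    finally show ?thesis .
  next
    case False
    define d where "d = bdist z"
    have d: "d > 0" "d \<le> 1" using bdist_pos[OF z] bdist_le_1[of z] by (simp_all add: d_def)
    have cd: "sqrt (c * d) > 0" "(sqrt (c * d))\<^sup>2 = c * d" using c d by auto
    have "c * d \<le> 1 / 81 * 1" using c d by (intro mult_mono) auto
    then have "sqrt (c * d) \<le> sqrt ((1 / 9)\<^sup>2)" by (intro real_sqrt_le_mono) (simp add: power2_eq_square)
    then have "sqrt (c * d) * sqrt (c * d) \<le> 1 / 9 * sqrt (c * d)" using cd by (intro mult_right_mono) auto
    then have ba: "c * d \<le> sqrt (c * d) / 9" using cd by (simp add: power2_eq_square)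
    have "k * d ^ (CARD('n) + 1) \<le> (V * (c / 81) ^ CARD('n) * (81 * c) / 64) * d ^ (CARD('n) + 1)"
      using k d by (intro mult_right_mono) auto
    also have "\<dots> = V * ((sqrt (c * d) / 9)\<^sup>2) ^ CARD('n) * (c * d / (sqrt (c * d) / 9))\<^sup>2 / 64"
      using c d by (simp add: power_mult_distrib power_divide) (simp add: power2_eq_square field_simps)
    finally have "ennreal (k * d ^ (CARD('n) + 1)) \<le> ennreal \<dots>" by (rule ennreal_leI)
    also have "\<dots> \<le> emeasure lborel (slab (9 * (sqrt (c * d) / 9)) (c * d) z)"
      unfolding V_def by (rule emeasure_slab_ge) (use c d ba False z in auto)
    finally show ?thesis by (simp add: d_def)
  qed
  with k(1) show ?thesis by blast
qed

section \<open>Sub-mean-value inequalities\<close>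

text \<open>Nothing is known of \<open>h\<close> outside the ball, so global measurability is
  obtained for the extension by zero.\<close>

lemma line_hol_borel [measurable]:
  "line_hol h \<Longrightarrow> (\<lambda>x. indicator (ball 0 1) x *\<^sub>R h x) \<in> borel_measurable borel"
  by (rule borel_measurable_continuous_on_indicator[OF _ line_hol_cont]) simp_all

lemma cis_borel [measurable]: "cis \<in> borel_measurable borel"
  by (intro borel_measurable_continuous_onI continuous_intros)

lemma norm_le_circle_mean:
  assumes h: "line_hol h" and b: "\<And>t. cmod t \<le> 1 \<Longrightarrow> z + t *s v \<in> ball 0 1"
  shows "ennreal (2 * pi * cmod (h z)) \<le> (\<integral>\<^sup>+\<theta>\<in>{0..2*pi}. ennreal (cmod (h (z + cis \<theta> *s v))) \<partial>lborel)"
proof -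
  have c: "continuous_on S (\<lambda>\<theta>. h (z + cis \<theta> *s v))" for S :: "real set"
    by (intro continuous_on_compose2[OF line_hol_cont[OF h]] continuous_intros) (use b in auto)
  have "2 * pi * cmod (h z) = cmod (integral {0..2*pi} (\<lambda>\<theta>. h (z + cis \<theta> *s v)))"
    by (subst circle_mean_deriv(2)[OF h b]) (simp_all add: norm_divide norm_mult)
  also have "\<dots> \<le> integral {0..2*pi} (\<lambda>\<theta>. cmod (h (z + cis \<theta> *s v)))"
    by (intro integral_norm_bound_integral integrable_continuous_interval continuous_intros c) simp
  finally have "ennreal (2 * pi * cmod (h z)) \<le> ennreal (integral {0..2*pi} (\<lambda>\<theta>. cmod (h (z + cis \<theta> *s v))))"
    by (rule ennreal_leI)
  also have "\<dots> = (\<integral>\<^sup>+\<theta>\<in>{0..2*pi}. ennreal (cmod (h (z + cis \<theta> *s v))) \<partial>lborel)"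
  proof -
    have "(\<integral>\<^sup>+\<theta>. ennreal (indicator {0..2*pi} \<theta> * cmod (h (z + cis \<theta> *s v))) \<partial>lborel)
        = ennreal (integral {0..2*pi} (\<lambda>\<theta>. cmod (h (z + cis \<theta> *s v))))"
    proof (rule nn_integral_has_integral_lborel)
      have [measurable]: "(\<lambda>\<theta>. cmod (h (z + cis \<theta> *s v))) \<in> borel_measurable borel"
        by (intro borel_measurable_continuous_onI continuous_intros c)
      show "(\<lambda>\<theta>. indicator {0..2*pi} \<theta> * cmod (h (z + cis \<theta> *s v))) \<in> borel_measurable borel"
        by measurable
      have "((\<lambda>\<theta>. cmod (h (z + cis \<theta> *s v))) has_integral integral {0..2*pi} (\<lambda>\<theta>. cmod (h (z + cis \<theta> *s v)))) {0..2*pi}"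
        by (intro integrable_integral integrable_continuous_interval continuous_intros c)
      then have "((\<lambda>\<theta>. if \<theta> \<in> {0..2*pi} then cmod (h (z + cis \<theta> *s v)) else 0) has_integral
          integral {0..2*pi} (\<lambda>\<theta>. cmod (h (z + cis \<theta> *s v)))) UNIV"
        by (simp only: has_integral_restrict_UNIV)
      then show "((\<lambda>\<theta>. indicator {0..2*pi} \<theta> * cmod (h (z + cis \<theta> *s v))) has_integral
          integral {0..2*pi} (\<lambda>\<theta>. cmod (h (z + cis \<theta> *s v)))) UNIV"
        by (rule has_integral_eq[rotated]) auto
    qed simp
    then show ?thesis by (simp add: ennreal_mult' ennreal_indicator mult.commute)
  qed
  finally show ?thesis .
qed

lemma slab_rotate: "cmod t = 1 \<Longrightarrow> t *s v \<in> slab a b z \<longleftrightarrow> v \<in> slab a b z"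
  by (simp add: slab_def norm_smult hinner_smult_left norm_mult)

text \<open>The circle inequality is averaged over \<open>v\<close> in the slab. After exchanging
  the integrals, each rotation is a linear isometry preserving the slab and drops out. The centre
  \<open>w\<close> is kept separate from the orienting vector \<open>z\<close>, since the slab is
  later moved to a maximum point without being turned.\<close>

lemma slab_mean:
  fixes z :: "complex ^ 'n"
  assumes h: "line_hol h" and b: "\<And>v. v \<in> slab a b z \<Longrightarrow> w + v \<in> ball 0 1"
  shows "ennreal (cmod (h w)) * emeasure lborel (slab a b z) \<le> (\<integral>\<^sup>+v\<in>slab a b z. ennreal (cmod (h (w + v))) \<partial>lborel)"
proof -
  define H where "H x = ennreal (cmod (indicator (ball 0 1) x *\<^sub>R h x))" for x
  have [measurable]: "H \<in> borel_measurable borel" unfolding H_def using h by measurable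
  define \<Phi> where "\<Phi> v = indicator (slab a b z) v * H (w + v)" for v
  have [measurable]: "\<Phi> \<in> borel_measurable borel" unfolding \<Phi>_def by measurable
  let ?I = "indicator {0..2*pi} :: real \<Rightarrow> ennreal"
  have "ennreal (2 * pi) * (ennreal (cmod (h w)) * emeasure lborel (slab a b z)) =
      (\<integral>\<^sup>+v. indicator (slab a b z) v * ennreal (2 * pi * cmod (h w)) \<partial>lborel)"
    by (subst nn_integral_multc) (simp_all add: ennreal_mult mult_ac)
  also have "\<dots> \<le> (\<integral>\<^sup>+v. \<integral>\<^sup>+\<theta>. ?I \<theta> * \<Phi> (cis \<theta> *s v) \<partial>lborel \<partial>lborel)"
  proof (rule nn_integral_mono)
    fix v
    show "indicator (slab a b z) v * ennreal (2 * pi * cmod (h w)) \<le> (\<integral>\<^sup>+\<theta>. ?I \<theta> * \<Phi> (cis \<theta> *s v) \<partial>lborel)"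
    proof (cases "v \<in> slab a b z")
      case True
      have tb: "w + t *s v \<in> ball 0 1" if "cmod t \<le> 1" for t
      proof (rule b)
        have "cmod t * norm v \<le> 1 * norm v" "cmod t * cmod (hinner v z) \<le> 1 * cmod (hinner v z)"
          using that by (intro mult_right_mono; simp)+
        then show "t *s v \<in> slab a b z"
          using True by (simp add: slab_def norm_smult hinner_smult_left norm_mult)
      qed
      have "ennreal (2 * pi * cmod (h w)) \<le> (\<integral>\<^sup>+\<theta>\<in>{0..2*pi}. ennreal (cmod (h (w + cis \<theta> *s v))) \<partial>lborel)"
        by (rule norm_le_circle_mean[OF h tb])
      also have "\<dots> = (\<integral>\<^sup>+\<theta>. ?I \<theta> * \<Phi> (cis \<theta> *s v) \<partial>lborel)"
        using True tb by (intro nn_integral_cong) (simp add: \<Phi>_def H_def slab_rotate mult.commute del: mem_ball)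
      finally show ?thesis using True by simp
    qed simp
  qed
  also have "\<dots> = (\<integral>\<^sup>+\<theta>. \<integral>\<^sup>+v. ?I \<theta> * \<Phi> (cis \<theta> *s v) \<partial>lborel \<partial>lborel)"
    by (rule lborel_pair.Fubini'[symmetric]) measurable
  also have "\<dots> = (\<integral>\<^sup>+\<theta>. ?I \<theta> * (\<integral>\<^sup>+v. \<Phi> v \<partial>lborel) \<partial>lborel)"
  proof (rule nn_integral_cong)
    fix \<theta>
    have lin: "linear (\<lambda>v :: complex ^ 'n. cis \<theta> *s v)"
      using bounded_bilinear.bounded_linear_right[OF bounded_bilinear_smult] by (simp add: linear_conv_bounded_linear)
    have "(\<integral>\<^sup>+v. \<Phi> (cis \<theta> *s v) \<partial>lborel) = (\<integral>\<^sup>+v. \<Phi> v \<partial>lborel)"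
      by (rule nn_integral_lborel_isometry[OF _ lin]) (simp_all add: norm_smult)
    then show "(\<integral>\<^sup>+v. ?I \<theta> * \<Phi> (cis \<theta> *s v) \<partial>lborel) = ?I \<theta> * (\<integral>\<^sup>+v. \<Phi> v \<partial>lborel)"
      by (subst nn_integral_cmult) simp_all
  qed
  also have "\<dots> = ennreal (2 * pi) * (\<integral>\<^sup>+v. \<Phi> v \<partial>lborel)"
    by (subst nn_integral_multc) simp_all
  also have "(\<integral>\<^sup>+v. \<Phi> v \<partial>lborel) = (\<integral>\<^sup>+v\<in>slab a b z. ennreal (cmod (h (w + v))) \<partial>lborel)"
    using b by (intro nn_integral_cong) (auto simp: \<Phi>_def H_def indicator_def)
  finally show ?thesis
    by (subst (asm) ennreal_mult_le_mult_iff) auto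
qed

text \<open>Either \<open>x\<close> is below \<open>A / 2\<close>, a part that can be absorbed, or x
  / A lies between 1 / 2 and \<Lambda>, and then the power x^(1-p) is comparable to A^(1-p). The
  condition \<open>\<Lambda> \<ge> 2\<close> accounts for the lower end.\<close>

lemma le_half_plus_powr:
  fixes x A \<Lambda> p :: real
  assumes "0 \<le> x" "x \<le> \<Lambda> * A" "A > 0" "\<Lambda> \<ge> 2"
  shows "x \<le> A / 2 + \<Lambda> powr \<bar>1 - p\<bar> * A powr (1 - p) * x powr p"
proof (cases "x \<le> A / 2")
  case True
  then show ?thesis using assms by (intro add_increasing2) auto
next
  case False
  then have x: "x > 0" using assms by linarith
  have "ln x \<le> ln (\<Lambda> * A)" "ln (A / 2) \<le> ln x" using False assms x by (simp_all add: ln_mono)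
  then have "ln x - ln A \<le> ln \<Lambda>" "- ln 2 \<le> ln x - ln A"
    using assms by (simp_all add: ln_mult ln_div)
  moreover have "ln 2 \<le> ln \<Lambda>" using assms by (intro ln_mono) auto
  ultimately have "\<bar>ln x - ln A\<bar> \<le> ln \<Lambda>" by linarith
  then have "\<bar>1 - p\<bar> * \<bar>ln x - ln A\<bar> \<le> \<bar>1 - p\<bar> * ln \<Lambda>" by (intro mult_left_mono) auto
  then have "(1 - p) * (ln x - ln A) \<le> \<bar>1 - p\<bar> * ln \<Lambda>"
    using abs_ge_self[of "(1 - p) * (ln x - ln A)"] by (simp add: abs_mult)
  then have "ln x \<le> \<bar>1 - p\<bar> * ln \<Lambda> + (1 - p) * ln A + p * ln x" by (simp add: algebra_simps)
  then have "exp (ln x) \<le> exp (\<bar>1 - p\<bar> * ln \<Lambda> + (1 - p) * ln A + p * ln x)" by simp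
  then have "x \<le> \<Lambda> powr \<bar>1 - p\<bar> * A powr (1 - p) * x powr p"
    using x assms by (simp add: exp_add powr_def)
  then show ?thesis using assms by simp
qed

lemma emeasure_slab_finite:
  fixes z :: "complex ^ 'n"
  shows "emeasure lborel (slab a b z) < \<infinity>"
proof -
  have "emeasure lborel (slab a b z) \<le> emeasure lborel (ball (0 :: complex ^ 'n) a)"
    by (intro emeasure_mono) (auto simp: slab_def)
  then show ?thesis using emeasure_lborel_ball_finite le_less_trans by blast
qed

lemma emeasure_slab_scale:
  fixes z :: "complex ^ 'n"
  assumes s: "s > 0"
  shows "emeasure lborel (slab (s * a) (s * b) z) = ennreal (s ^ (2 * CARD('n))) * emeasure lborel (slab a b z)"
proof -
  have "indicator (slab (s * a) (s * b) z) (s *\<^sub>R v) = (indicator (slab a b z) v :: ennreal)" for v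
    using s by (simp add: indicator_def slab_def hinner_scaleR_left norm_mult)
  then show ?thesis
    using nn_integral_lborel_scale[of "indicator (slab (s * a) (s * b) z)" s] s
    by (simp add: mult.commute)
qed

text \<open>For \<open>p < 1\<close> the power \<open>\<bar>h\<bar>\<^sup>p\<close> is not obtained from the mean value property by
  convexity. Instead, maximise \<open>\<bar>h\<bar>\<^sup>p\<close> times a power of the distance to the boundary of the
  slab: on a smaller slab about the maximum point, \<open>\<bar>h\<bar>\<close> is at most a constant times its value at
  the centre, which bounds the mean of \<open>\<bar>h\<bar>\<close> by that of \<open>\<bar>h\<bar>\<^sup>p\<close>.\<close>

lemma slab_submean:
  fixes p :: real
  assumes p: "p > 0"
  shows "\<exists>C>0. \<forall>(h :: complex ^ 'n \<Rightarrow> complex) z a b. line_hol h \<longrightarrow> a > 0 \<longrightarrow> b > 0 \<longrightarrow>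
     (\<forall>v. norm v \<le> a \<and> cmod (hinner v z) \<le> b \<longrightarrow> z + v \<in> ball 0 1) \<longrightarrow>
     ennreal (cmod (h z) powr p) * emeasure lborel (slab a b z) \<le>
       ennreal C * (\<integral>\<^sup>+v\<in>slab a b z. ennreal (cmod (h (z + v)) powr p) \<partial>lborel)"
proof -
  \<comment> \<open>The power of the weight in the maximised function is the real dimension. A slab
    shrunk by d / 2 has (d / 2)^m times the volume, so the factor d^m at the maximum cancels against
    it.\<close>
  define m where "m = 2 * CARD('n)"
  \<comment> \<open>Near the maximum the weight drops at most by the factor 2^m, so |h| grows at
    most by 2^(m/p); the 2 is required by \<open>le_half_plus_powr\<close>.\<close>
  define \<Lambda> where "\<Lambda> = max 2 (2 powr (real m / p))"
  have \<Lambda>: "\<Lambda> \<ge> 2" "2 powr (real m / p) \<le> \<Lambda>" by (auto simp: \<Lambda>_def)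
  define C where "C = \<Lambda> powr \<bar>1 - p\<bar>"
  have C: "C > 0" using \<Lambda> by (simp add: C_def)
  have "ennreal (cmod (h z) powr p) * emeasure lborel (slab a b z) \<le>
       ennreal (2 ^ (m + 1) * C) * (\<integral>\<^sup>+v\<in>slab a b z. ennreal (cmod (h (z + v)) powr p) \<partial>lborel)"
    if h: "line_hol h" and ab: "a > 0" "b > 0"
      and inb: "\<And>v. norm v \<le> a \<Longrightarrow> cmod (hinner v z) \<le> b \<Longrightarrow> z + v \<in> ball 0 1"
    for h :: "complex ^ 'n \<Rightarrow> complex" and z a b
  proof (cases "h z = 0")
    case False
    \<comment> \<open>\<open>N\<close> is the Minkowski functional of the slab, so
      \<open>1 - N v\<close> measures the distance to its boundary.\<close>
    define N where "N v = max (norm v / a) (cmod (hinner v z) / b)" for v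
    have N_le: "N v \<le> r \<longleftrightarrow> norm v \<le> r * a \<and> cmod (hinner v z) \<le> r * b" for v r
      using ab by (simp add: N_def field_simps)
    have N_less: "N v < r \<longleftrightarrow> v \<in> slab (r * a) (r * b) z" for v r
      using ab by (simp add: N_def slab_def field_simps)
    have N_nn: "0 \<le> N v" for v using ab by (simp add: N_def le_max_iff_disj)
    have N_add: "N (v + w) \<le> N v + N w" for v w
    proof -
      have "norm v \<le> N v * a" "norm w \<le> N w * a" "cmod (hinner v z) \<le> N v * b" "cmod (hinner w z) \<le> N w * b"
        using N_le[of v "N v"] N_le[of w "N w"] by auto
      then show ?thesis
        unfolding N_le hinner_add_left distrib_right
        using norm_triangle_ineq[of v w] norm_triangle_ineq[of "hinner v z" "hinner w z"] by linarith
    qed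
    define S where "S = {v. N v \<le> 1}"
    have S: "z + v \<in> ball 0 1" if "v \<in> S" for v using inb that by (simp add: S_def N_le)
    have contN: "continuous_on A N" for A unfolding N_def using ab by (intro continuous_intros) auto
    define F where "F v = cmod (h (z + v)) powr p * (1 - N v) ^ m" for v
    have "closed S" unfolding S_def by (intro closed_Collect_le contN continuous_intros)
    moreover have "bounded S" unfolding bounded_iff by (rule exI[of _ a]) (simp add: S_def N_le)
    ultimately have "compact S" by (simp add: compact_eq_bounded_closed)
    moreover have "0 \<in> S" by (simp add: S_def N_def)
    moreover have "continuous_on S F" unfolding F_def
      by (intro continuous_intros contN continuous_on_powr' continuous_on_compose2[OF line_hol_cont[OF h]])
        (use S p in auto)
    ultimately obtain v0 where v0: "v0 \<in> S" "\<And>v. v \<in> S \<Longrightarrow> F v \<le> F v0"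
      using continuous_attains_sup[of S F] by auto
    have F0: "F 0 = cmod (h z) powr p" by (simp add: F_def N_def)
    have "F 0 \<le> F v0" using v0 \<open>0 \<in> S\<close> by blast
    moreover have "F 0 > 0" using False by (simp add: F0)
    ultimately have Fpos: "F v0 > 0" by linarith
    define d where "d = 1 - N v0"
    define A where "A = cmod (h (z + v0))"
    have "d \<ge> 0" using v0 by (simp add: d_def S_def)
    moreover have "d \<noteq> 0" using Fpos by (auto simp: F_def d_def m_def power_0_left)
    ultimately have d: "d > 0" "d \<le> 1" using N_nn[of v0] by (auto simp: d_def)
    have A: "A > 0" using Fpos by (auto simp: F_def A_def)
    have FA: "F v0 = A powr p * d ^ m" by (simp add: F_def A_def d_def)
    \<comment> \<open>Half of the remaining distance is used: on the translate of \<open>T\<close>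
      by \<open>v0\<close> the weight \<open>1 - N\<close> is still above
      \<open>d / 2\<close>.\<close>
    define T where "T = slab (d / 2 * a) (d / 2 * b) z"
    have Tin: "N (v0 + v) < 1 - d / 2" if "v \<in> T" for v
    proof -
      have "N v < d / 2" using that N_less[of v "d / 2"] by (simp add: T_def)
      then show ?thesis using N_add[of v0 v] unfolding d_def by argo
    qed
    have bound: "cmod (h (z + v0 + v)) \<le> \<Lambda> * A" if v: "v \<in> T" for v
    proof -
      have "v0 + v \<in> S" using Tin[OF v] d by (simp add: S_def)
      then have "F (v0 + v) \<le> A powr p * d ^ m" using v0(2) FA by metis
      moreover have "cmod (h (z + v0 + v)) powr p * (d / 2) ^ m \<le> F (v0 + v)"
        unfolding F_def using Tin[OF v] d by (intro mult_mono power_mono) (auto simp: add.assoc)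
      ultimately have "cmod (h (z + v0 + v)) powr p * (d / 2) ^ m \<le> A powr p * d ^ m" by linarith
      then have "cmod (h (z + v0 + v)) powr p \<le> 2 ^ m * A powr p"
        using d by (simp add: power_divide field_simps)
      then have "(cmod (h (z + v0 + v)) powr p) powr (1 / p) \<le> (2 ^ m * A powr p) powr (1 / p)"
        using p by (intro powr_mono2) auto
      also have "\<dots> = 2 powr (real m / p) * A"
        using p A by (simp add: powr_mult powr_powr flip: powr_realpow)
      also have "\<dots> \<le> \<Lambda> * A" using A \<Lambda> by (intro mult_right_mono) auto
      finally show ?thesis using p by (simp add: powr_powr)
    qed
    have Tb: "z + v0 + v \<in> ball 0 1" if "v \<in> T" for v
      using S[of "v0 + v"] Tin[OF that] d by (simp add: S_def add.assoc)
    define H where "H x = ennreal (cmod (indicator (ball 0 1) x *\<^sub>R h x) powr p)" for x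
    have [measurable]: "H \<in> borel_measurable borel" unfolding H_def using h by measurable
    have [measurable]: "T \<in> sets borel" by (simp add: T_def)
    have Tfin: "emeasure lborel T < \<infinity>" unfolding T_def by (rule emeasure_slab_finite)
    define J where "J = (\<integral>\<^sup>+v\<in>T. H (z + v0 + v) \<partial>lborel)"
    have "ennreal A * emeasure lborel T \<le> (\<integral>\<^sup>+v\<in>T. ennreal (cmod (h (z + v0 + v))) \<partial>lborel)"
      unfolding A_def T_def by (rule slab_mean[OF h]) (use Tb in \<open>simp add: T_def\<close>)
    also have "\<dots> \<le> (\<integral>\<^sup>+v. ennreal (A / 2) * indicator T v + ennreal (C * A powr (1 - p)) * (H (z + v0 + v) * indicator T v) \<partial>lborel)"
    proof (rule nn_integral_mono)
      fix v
      show "ennreal (cmod (h (z + v0 + v))) * indicator T v \<le>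
          ennreal (A / 2) * indicator T v + ennreal (C * A powr (1 - p)) * (H (z + v0 + v) * indicator T v)"
      proof (cases "v \<in> T")
        case True
        have "cmod (h (z + v0 + v)) \<le> A / 2 + C * A powr (1 - p) * cmod (h (z + v0 + v)) powr p"
          unfolding C_def by (rule le_half_plus_powr) (use bound[OF True] A \<Lambda> in auto)
        then have "ennreal (cmod (h (z + v0 + v))) \<le> ennreal (A / 2 + C * A powr (1 - p) * cmod (h (z + v0 + v)) powr p)"
          by (rule ennreal_leI)
        also have "\<dots> = ennreal (A / 2) + ennreal (C * A powr (1 - p)) * H (z + v0 + v)"
          using A C Tb[OF True] by (simp add: H_def ennreal_plus ennreal_mult)
        finally show ?thesis using True by simp
      qed simp
    qed
    also have "\<dots> = ennreal (A / 2) * emeasure lborel T + ennreal (C * A powr (1 - p)) * J"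
      unfolding J_def by (subst nn_integral_add) (simp_all add: nn_integral_cmult)
    finally have main: "ennreal A * emeasure lborel T \<le> ennreal (A / 2) * emeasure lborel T + ennreal (C * A powr (1 - p)) * J" .
    \<comment> \<open>The half is subtracted, which is legitimate since \<open>T\<close> has finite
      volume, and the result is multiplied by A^(p-1). For infinite \<open>J\<close> there is
      nothing to show.\<close>
    have main2: "ennreal (A powr p) * emeasure lborel T \<le> ennreal (2 * C) * J"
    proof (cases J)
      case (real j)
      obtain t where t: "emeasure lborel T = ennreal t" "t \<ge> 0"
        using Tfin by (cases "emeasure lborel T") auto
      have "ennreal A * emeasure lborel T = ennreal (A * t)"
        "ennreal (A / 2) * emeasure lborel T = ennreal (A / 2 * t)"
        "ennreal (C * A powr (1 - p)) * J = ennreal (C * A powr (1 - p) * j)"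
        unfolding t(1) real using A C t(2) real by (intro ennreal_mult[symmetric]; simp)+
      moreover have "ennreal (A / 2 * t) + ennreal (C * A powr (1 - p) * j) = ennreal (A / 2 * t + C * A powr (1 - p) * j)"
        using A C t(2) real by (intro ennreal_plus[symmetric]) auto
      ultimately have "ennreal (A * t) \<le> ennreal (A / 2 * t + C * A powr (1 - p) * j)"
        using main by metis
      then have "A * t \<le> A / 2 * t + C * A powr (1 - p) * j"
        using A C real t by (subst (asm) ennreal_le_iff) auto
      then have "A / 2 * t \<le> C * A powr (1 - p) * j" by simp
      then have "A powr (p - 1) * (A / 2 * t) \<le> A powr (p - 1) * (C * A powr (1 - p) * j)"
        by (intro mult_left_mono) auto
      moreover have "A powr p = A powr (p - 1) * A" "A powr (p - 1) * A powr (1 - p) = 1"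
        using A powr_add[of A "p - 1" 1] powr_add[of A "p - 1" "1 - p"] by auto
      moreover from this have "A powr (p - 1) * (C * A powr (1 - p) * j) = C * j"
        by (metis mult.assoc mult.left_commute mult.left_neutral)
      ultimately have "A powr p * t \<le> 2 * C * j" by simp
      then show ?thesis using t real C by (simp add: ennreal_leI flip: ennreal_mult)
    next
      case top
      then show ?thesis using C by (simp add: ennreal_mult_top)
    qed
    have J: "J \<le> (\<integral>\<^sup>+v\<in>slab a b z. ennreal (cmod (h (z + v)) powr p) \<partial>lborel)"
    proof -
      have "J = (\<integral>\<^sup>+v. H (z + (v0 + v)) * indicator T (- v0 + (v0 + v)) \<partial>lborel)"
        by (simp add: J_def add.assoc)
      also have "\<dots> = (\<integral>\<^sup>+v. H (z + v) * indicator T (- v0 + v) \<partial>lborel)"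
        by (rule nn_integral_lborel_translate[of "\<lambda>v. H (z + v) * indicator T (- v0 + v)"]) measurable
      also have "\<dots> \<le> (\<integral>\<^sup>+v\<in>slab a b z. ennreal (cmod (h (z + v)) powr p) \<partial>lborel)"
      proof (rule nn_integral_mono)
        fix v
        show "H (z + v) * indicator T (- v0 + v) \<le> ennreal (cmod (h (z + v)) powr p) * indicator (slab a b z) v"
        proof (cases "- v0 + v \<in> T")
          case True
          then have "v \<in> slab a b z" using Tin[OF True] N_less[of v 1] d by simp
          then show ?thesis by (simp add: H_def indicator_def)
        qed simp
      qed
      finally show ?thesis .
    qed
    have "emeasure lborel T = ennreal ((d / 2) ^ m) * emeasure lborel (slab a b z)"
      unfolding T_def m_def by (rule emeasure_slab_scale) (use d in simp)
    then have "ennreal (A powr p) * (ennreal ((d / 2) ^ m) * emeasure lborel (slab a b z)) \<le> ennreal (2 * C) * J"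
      using main2 by simp
    then have 1: "ennreal (2 ^ m) * (ennreal (A powr p) * (ennreal ((d / 2) ^ m) * emeasure lborel (slab a b z))) \<le> ennreal (2 ^ m) * (ennreal (2 * C) * J)"
      by (rule mult_left_mono) simp
    have "ennreal (cmod (h z) powr p) * emeasure lborel (slab a b z) \<le> ennreal (A powr p * d ^ m) * emeasure lborel (slab a b z)"
      using \<open>F 0 \<le> F v0\<close> unfolding F0 FA by (intro mult_right_mono ennreal_leI) auto
    also have "A powr p * d ^ m = 2 ^ m * (A powr p * (d / 2) ^ m)" by (simp add: power_divide)
    also have "ennreal (2 ^ m * (A powr p * (d / 2) ^ m)) * emeasure lborel (slab a b z) =
        ennreal (2 ^ m) * (ennreal (A powr p) * (ennreal ((d / 2) ^ m) * emeasure lborel (slab a b z)))"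
      using d by (simp add: ennreal_mult mult.assoc del: ennreal_power)
    also note 1
    also have "ennreal (2 ^ m) * (ennreal (2 * C) * J) = ennreal (2 ^ (m + 1) * C) * J"
      using C by (simp add: ennreal_mult mult_ac del: ennreal_power)
    also have "\<dots> \<le> ennreal (2 ^ (m + 1) * C) * (\<integral>\<^sup>+v\<in>slab a b z. ennreal (cmod (h (z + v)) powr p) \<partial>lborel)"
      using J by (rule mult_left_mono) simp
    finally show ?thesis .
  qed (use p in simp)
  moreover have "2 ^ (m + 1) * C > 0" using C by simp
  ultimately show ?thesis by blast
qed

text \<open>The slab inequality for a slab inside the Bergman ball whose volume is at least a
  constant times \<open>bdist z ^ (CARD('n) + 1)\<close>.\<close>

lemma hyp_ball_submean:
  assumes K: "K > 1" and p: "p > 0"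
  shows "\<exists>C>0. \<forall>(h :: complex ^ 'n \<Rightarrow> complex) z. line_hol h \<longrightarrow> z \<in> ball 0 1 \<longrightarrow>
     ennreal (cmod (h z) powr p * bdist z ^ (CARD('n) + 1)) \<le>
       ennreal C * (\<integral>\<^sup>+w\<in>hyp_ball K z. ennreal (cmod (h w) powr p) \<partial>lborel)"
proof -
  obtain c where c: "c > 0" "c \<le> 1 / 81"
    "\<And>z v :: complex ^ 'n. z \<in> ball 0 1 \<Longrightarrow> norm v \<le> sqrt (c * bdist z) \<Longrightarrow>
       cmod (hinner v z) \<le> c * bdist z \<Longrightarrow> z + v \<in> hyp_ball K z"
    using slab_subset_hyp_ball[OF K] by blast
  obtain \<kappa> where \<kappa>: "\<kappa> > 0" "\<And>z::complex ^ 'n. z \<in> ball 0 1 \<Longrightarrow>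
     ennreal (\<kappa> * bdist z ^ (CARD('n) + 1)) \<le> emeasure lborel (slab (sqrt (c * bdist z)) (c * bdist z) z)"
    using emeasure_slab_bdist_ge[OF c(1,2)] by blast
  obtain C where C: "C > 0" "\<And>(h :: complex ^ 'n \<Rightarrow> complex) z a b. line_hol h \<Longrightarrow> a > 0 \<Longrightarrow> b > 0 \<Longrightarrow>
     (\<And>v. norm v \<le> a \<Longrightarrow> cmod (hinner v z) \<le> b \<Longrightarrow> z + v \<in> ball 0 1) \<Longrightarrow>
     ennreal (cmod (h z) powr p) * emeasure lborel (slab a b z) \<le>
       ennreal C * (\<integral>\<^sup>+v\<in>slab a b z. ennreal (cmod (h (z + v)) powr p) \<partial>lborel)"
    using slab_submean[OF p] by blast
  have "ennreal (cmod (h z) powr p * bdist z ^ (CARD('n) + 1)) \<le>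
       ennreal (C / \<kappa>) * (\<integral>\<^sup>+w\<in>hyp_ball K z. ennreal (cmod (h w) powr p) \<partial>lborel)"
    if h: "line_hol h" and z: "z \<in> ball 0 1" for h :: "complex ^ 'n \<Rightarrow> complex" and z
  proof -
    define d where "d = bdist z"
    have d: "d > 0" using bdist_pos[OF z] by (simp add: d_def)
    let ?S = "slab (sqrt (c * d)) (c * d) z"
    let ?e = "cmod (h z) powr p" and ?D = "d ^ (CARD('n) + 1)"
    define H where "H x = ennreal (cmod (indicator (ball 0 1) x *\<^sub>R h x) powr p)" for x
    have [measurable]: "H \<in> borel_measurable borel" unfolding H_def using h by measurable
    have "ennreal \<kappa> * ennreal (?e * ?D) = ennreal ?e * ennreal (\<kappa> * ?D)"
      using \<kappa> d by (simp add: mult_ac flip: ennreal_mult)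
    also have "\<dots> \<le> ennreal ?e * emeasure lborel ?S"
      using \<kappa>(2)[OF z] by (intro mult_left_mono) (simp_all add: d_def)
    also have "\<dots> \<le> ennreal C * (\<integral>\<^sup>+v\<in>?S. ennreal (cmod (h (z + v)) powr p) \<partial>lborel)"
    proof (rule C(2)[OF h])
      show "z + v \<in> ball 0 1" if "norm v \<le> sqrt (c * d)" "cmod (hinner v z) \<le> c * d" for v
        using c(3)[OF z] that hyp_ball_subset[of K z] unfolding d_def by blast
    qed (use c(1) d in simp_all)
    also have "(\<integral>\<^sup>+v\<in>?S. ennreal (cmod (h (z + v)) powr p) \<partial>lborel) \<le>
        (\<integral>\<^sup>+v. H (z + v) * indicator (hyp_ball K z) (z + v) \<partial>lborel)"
    proof (rule nn_integral_mono)
      fix v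
      show "ennreal (cmod (h (z + v)) powr p) * indicator ?S v \<le> H (z + v) * indicator (hyp_ball K z) (z + v)"
      proof (cases "v \<in> ?S")
        case True
        then have "z + v \<in> hyp_ball K z" by (intro c(3)[OF z]) (auto simp: slab_def d_def)
        then show ?thesis using hyp_ball_subset[of K z] by (auto simp: H_def indicator_def)
      qed simp
    qed
    also have "\<dots> = (\<integral>\<^sup>+w. H w * indicator (hyp_ball K z) w \<partial>lborel)"
      by (rule nn_integral_lborel_translate[of "\<lambda>w. H w * indicator (hyp_ball K z) w"]) measurable
    also have "\<dots> = (\<integral>\<^sup>+w\<in>hyp_ball K z. ennreal (cmod (h w) powr p) \<partial>lborel)"
      using hyp_ball_subset[of K z] by (intro nn_integral_cong) (auto simp: H_def indicator_def)
    finally have "ennreal \<kappa> * ennreal (?e * ?D) \<le> ennreal C * (\<integral>\<^sup>+w\<in>hyp_ball K z. ennreal (cmod (h w) powr p) \<partial>lborel)"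
      by (simp add: mult_left_mono)
    then have "ennreal (1 / \<kappa>) * (ennreal \<kappa> * ennreal (?e * ?D)) \<le>
        ennreal (1 / \<kappa>) * (ennreal C * (\<integral>\<^sup>+w\<in>hyp_ball K z. ennreal (cmod (h w) powr p) \<partial>lborel))"
      by (rule mult_left_mono) simp
    moreover have "ennreal (1 / \<kappa>) * (ennreal \<kappa> * x) = x" for x
      using \<kappa> by (simp add: mult.assoc[symmetric] flip: ennreal_mult)
    moreover have "ennreal (1 / \<kappa>) * (ennreal C * x) = ennreal (C / \<kappa>) * x" for x
      using \<kappa> C by (simp add: mult.assoc[symmetric] flip: ennreal_mult)
    ultimately show ?thesis by (simp add: d_def)
  qed
  moreover have "C / \<kappa> > 0" using C \<kappa> by simp
  ultimately show ?thesis by blast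
qed

section \<open>Integrals over Bergman balls\<close>

lemma powr_le_of_comparable:
  fixes x y :: real
  assumes "x > 0" "y > 0" "x \<le> L * y" "y \<le> L * x" "L > 0"
  shows "x powr a \<le> L powr \<bar>a\<bar> * y powr a"
proof -
  have "ln x \<le> ln (L * y)" "ln y \<le> ln (L * x)" using assms by (simp_all add: ln_mono)
  then have "\<bar>ln x - ln y\<bar> \<le> ln L" using assms by (simp add: ln_mult abs_le_iff)
  then have "\<bar>a\<bar> * \<bar>ln x - ln y\<bar> \<le> \<bar>a\<bar> * ln L" by (intro mult_left_mono) auto
  then have "a * (ln x - ln y) \<le> \<bar>a\<bar> * ln L"
    using abs_ge_self[of "a * (ln x - ln y)"] by (simp add: abs_mult)
  then have "exp (a * ln x) \<le> exp (\<bar>a\<bar> * ln L + a * ln y)" by (simp add: algebra_simps)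
  then show ?thesis using assms by (simp add: powr_def exp_add)
qed

lemma bdist_powr_comparable:
  assumes "w \<in> hyp_ball K z" "z \<in> ball 0 1"
  shows "bdist w powr a \<le> (4 * K) powr \<bar>a\<bar> * bdist z powr a"
    "bdist z powr a \<le> (4 * K) powr \<bar>a\<bar> * bdist w powr a"
  using hyp_ball_bdist[OF assms] bdist_pos[OF assms(2)] bdist_pos[of w] hyp_ball_subset[of K z] assms
  by (auto intro!: powr_le_of_comparable)

lemma bdist_borel [measurable]: "bdist \<in> borel_measurable borel"
  by (intro borel_measurable_continuous_onI continuous_intros)

text \<open>Weight and power are bundled and cut off outside the ball, so that multiplication by a
  power of \<open>bdist\<close> is a shift of \<open>a\<close>, and values of \<open>h\<close> off
  the ball disappear.\<close>

definition hpow :: "(complex ^ 'n \<Rightarrow> complex) \<Rightarrow> real \<Rightarrow> real \<Rightarrow> complex ^ 'n \<Rightarrow> ennreal" where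
  "hpow h a p z = indicator (ball 0 1) z * ennreal (bdist z powr a * cmod (h z) powr p)"

lemma hpow_eq: "z \<in> ball 0 1 \<Longrightarrow> hpow h a p z = ennreal (bdist z powr a * cmod (h z) powr p)"
  by (simp add: hpow_def)

lemma hpow_borel [measurable]: "line_hol h \<Longrightarrow> hpow h a p \<in> borel_measurable borel"
proof -
  assume h: "line_hol h"
  have "hpow h a p = (\<lambda>z. indicator (ball 0 1) z * ennreal (bdist z powr a * cmod (indicator (ball 0 1) z *\<^sub>R h z) powr p))"
    by (auto simp: hpow_def indicator_def)
  then show ?thesis by (simp only:) (use h in measurable)
qed

lemma hpow_mult: "z \<in> ball 0 1 \<Longrightarrow> ennreal (bdist z powr b) * hpow h a p z = hpow h (b + a) p z"
  by (simp add: hpow_def powr_add mult.assoc flip: ennreal_mult)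

abbreviation hyp_int :: "real \<Rightarrow> complex ^ 'n \<Rightarrow> (complex ^ 'n \<Rightarrow> ennreal) \<Rightarrow> ennreal" where
  "hyp_int K z F \<equiv> (\<integral>\<^sup>+u\<in>hyp_ball K z. F u \<partial>lborel)"

text \<open>\<open>hyp_ball_submean\<close> with all powers of \<open>bdist z\<close> moved under
  the integral, where they are comparable to those of \<open>bdist u\<close>. Lowering
  \<open>a\<close> by n + 1 amounts to integrating against the invariant measure.\<close>

lemma hpow_le_integral_center:
  fixes K a p :: real
  assumes K: "K > 1" and p: "p > 0"
  shows "\<exists>C>0. \<forall>(h :: complex ^ 'n \<Rightarrow> complex) z. line_hol h \<longrightarrow> z \<in> ball 0 1 \<longrightarrow>
     hpow h a p z \<le> ennreal C * hyp_int K z (hpow h (a - real (CARD('n) + 1)) p)"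
proof -
  define m where "m = CARD('n) + 1"
  obtain C where C: "C > 0" "\<And>(h :: complex ^ 'n \<Rightarrow> complex) z. line_hol h \<Longrightarrow> z \<in> ball 0 1 \<Longrightarrow>
     ennreal (cmod (h z) powr p * bdist z ^ m) \<le>
       ennreal C * (\<integral>\<^sup>+w\<in>hyp_ball K z. ennreal (cmod (h w) powr p) \<partial>lborel)"
    using hyp_ball_submean[OF K p] unfolding m_def by blast
  define B where "B = (4 * K) powr \<bar>a - real m\<bar>"
  have B: "B > 0" using K by (simp add: B_def)
  have "hpow h a p z \<le> ennreal (C * B) * hyp_int K z (hpow h (a - real m) p)"
    if h: "line_hol h" and z: "z \<in> ball 0 1" for h :: "complex ^ 'n \<Rightarrow> complex" and z
  proof -
    note [measurable] = hpow_borel[OF h]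
    note d = bdist_pos[OF z]
    have "hpow h a p z = ennreal (bdist z powr (a - real m)) * ennreal (cmod (h z) powr p * bdist z ^ m)"
      using z d powr_add[of "bdist z" "a - real m" "real m"]
      by (simp add: hpow_def powr_realpow mult_ac flip: ennreal_mult)
    also have "\<dots> \<le> ennreal (bdist z powr (a - real m)) * (ennreal C * (\<integral>\<^sup>+u\<in>hyp_ball K z. ennreal (cmod (h u) powr p) \<partial>lborel))"
      using C(2)[OF h z] by (rule mult_left_mono) simp
    also have "(\<integral>\<^sup>+u\<in>hyp_ball K z. ennreal (cmod (h u) powr p) \<partial>lborel) = hyp_int K z (hpow h 0 p)"
    proof (rule nn_integral_cong)
      fix u
      show "ennreal (cmod (h u) powr p) * indicator (hyp_ball K z) u = hpow h 0 p u * indicator (hyp_ball K z) u"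
      proof (cases "u \<in> hyp_ball K z")
        case True
        then have "u \<in> ball 0 1" using hyp_ball_subset by blast
        then show ?thesis using bdist_pos[of u] by (simp add: hpow_eq)
      qed simp
    qed
    also have "ennreal (bdist z powr (a - real m)) * (ennreal C * \<dots>) =
        ennreal C * (\<integral>\<^sup>+u. ennreal (bdist z powr (a - real m)) * (hpow h 0 p u * indicator (hyp_ball K z) u) \<partial>lborel)"
      by (subst nn_integral_cmult) (simp_all add: mult.left_commute)
    also have "\<dots> \<le> ennreal C * (\<integral>\<^sup>+u. ennreal B * (hpow h (a - real m) p u * indicator (hyp_ball K z) u) \<partial>lborel)"
    proof (intro mult_left_mono nn_integral_mono)
      fix u
      show "ennreal (bdist z powr (a - real m)) * (hpow h 0 p u * indicator (hyp_ball K z) u)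
          \<le> ennreal B * (hpow h (a - real m) p u * indicator (hyp_ball K z) u)"
      proof (cases "u \<in> hyp_ball K z")
        case True
        have ub: "u \<in> ball 0 1" using True hyp_ball_subset by blast
        have "ennreal (bdist z powr (a - real m)) * hpow h 0 p u \<le> ennreal (B * bdist u powr (a - real m)) * hpow h 0 p u"
          using bdist_powr_comparable(2)[OF True z, of "a - real m"]
          by (intro mult_right_mono ennreal_leI) (simp_all add: B_def)
        also have "\<dots> = ennreal B * hpow h (a - real m) p u"
          using hpow_mult[OF ub, of "a - real m" h 0 p] B by (simp add: ennreal_mult mult.assoc)
        finally show ?thesis using True by simp
      qed simp
    qed simp
    also have "\<dots> = ennreal (C * B) * hyp_int K z (hpow h (a - real m) p)"
      using C B by (subst nn_integral_cmult) (simp_all add: ennreal_mult mult.assoc)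
    finally show ?thesis .
  qed
  moreover have "C * B > 0" using C B by simp
  ultimately show ?thesis unfolding m_def by blast
qed

text \<open>A bound uniform in \<open>w\<close>: the ball with constant 2 about \<open>w\<close>
  lies in a fixed larger ball about \<open>z\<close>, with constant 144 * 2 * K by
  \<open>hyp_ball_trans\<close>.\<close>

lemma hpow_le_integral:
  fixes K a p :: real
  assumes p: "p > 0"
  shows "\<exists>C>0. \<forall>(h :: complex ^ 'n \<Rightarrow> complex) z w. line_hol h \<longrightarrow> z \<in> ball 0 1 \<longrightarrow> w \<in> hyp_ball K z \<longrightarrow>
     hpow h a p w \<le> ennreal C * hyp_int (288 * K) z (hpow h (a - real (CARD('n) + 1)) p)"
proof -
  have two: "1 < (2 :: real)" by simp
  obtain C where C: "C > 0" "\<And>(h :: complex ^ 'n \<Rightarrow> complex) w. line_hol h \<Longrightarrow> w \<in> ball 0 1 \<Longrightarrow>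
     hpow h a p w \<le> ennreal C * hyp_int 2 w (hpow h (a - real (CARD('n) + 1)) p)"
    using hpow_le_integral_center[OF two p] by blast
  have "hpow h a p w \<le> ennreal C * hyp_int (288 * K) z (hpow h (a - real (CARD('n) + 1)) p)"
    if h: "line_hol h" and z: "z \<in> ball 0 1" and w: "w \<in> hyp_ball K z"
    for h :: "complex ^ 'n \<Rightarrow> complex" and z w
  proof -
    have wb: "w \<in> ball 0 1" using w hyp_ball_subset by blast
    have "hyp_ball 2 w \<subseteq> hyp_ball (288 * K) z" using hyp_ball_trans[OF _ w z, of _ 2] by auto
    then have "hyp_int 2 w (hpow h (a - real (CARD('n) + 1)) p) \<le>
        hyp_int (288 * K) z (hpow h (a - real (CARD('n) + 1)) p)"
      by (intro nn_integral_mono mult_left_mono) (auto simp: indicator_def)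
    then show ?thesis using C(2)[OF h wb] by (meson mult_left_mono order_trans zero_le)
  qed
  with C(1) show ?thesis by blast
qed

lemma hyp_ball_pred [measurable]:
  "Measurable.pred (borel \<Otimes>\<^sub>M borel) (\<lambda>(z, u). u \<in> hyp_ball K (z :: complex ^ 'n))"
  unfolding hyp_ball_def by simp

lemma borel_measurable_integral_hyp_ball:
  assumes [measurable]: "\<Phi> \<in> borel_measurable borel"
  shows "(\<lambda>z. \<integral>\<^sup>+u\<in>hyp_ball K z. \<Phi> u \<partial>lborel) \<in> borel_measurable borel"
proof -
  have "(\<lambda>z. \<integral>\<^sup>+u\<in>hyp_ball K z. \<Phi> u \<partial>lborel) = (\<lambda>z. \<integral>\<^sup>+u. (if u \<in> hyp_ball K z then \<Phi> u else 0) \<partial>lborel)"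
    by (intro ext nn_integral_cong) (auto simp: indicator_def)
  also have "\<dots> \<in> borel_measurable borel" by measurable
  finally show ?thesis .
qed

lemma integral_bdist_hyp_ball_le:
  "\<exists>C>0. \<forall>u::complex ^ 'n. u \<in> ball 0 1 \<longrightarrow>
     (\<integral>\<^sup>+z\<in>hyp_ball K u. ennreal (bdist z powr b) \<partial>lborel) \<le> ennreal (C * bdist u powr (b + real (CARD('n) + 1)))"
proof -
  obtain C where C: "C > 0" "\<And>z::complex ^ 'n. z \<in> ball 0 1 \<Longrightarrow>
     emeasure lborel (hyp_ball K z) \<le> ennreal (C * bdist z ^ (CARD('n) + 1))"
    using emeasure_hyp_ball_le by blast
  define B where "B = (4 * max K 1) powr \<bar>b\<bar>"
  have B: "B > 0" by (simp add: B_def)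
  have "(\<integral>\<^sup>+z\<in>hyp_ball K u. ennreal (bdist z powr b) \<partial>lborel) \<le> ennreal (B * C * bdist u powr (b + real (CARD('n) + 1)))"
    if u: "u \<in> ball 0 1" for u :: "complex ^ 'n"
  proof -
    have "(\<integral>\<^sup>+z\<in>hyp_ball K u. ennreal (bdist z powr b) \<partial>lborel) \<le> (\<integral>\<^sup>+z\<in>hyp_ball K u. ennreal (B * bdist u powr b) \<partial>lborel)"
    proof (rule nn_integral_mono)
      fix z
      show "ennreal (bdist z powr b) * indicator (hyp_ball K u) z \<le> ennreal (B * bdist u powr b) * indicator (hyp_ball K u) z"
      proof (cases "z \<in> hyp_ball K u")
        case True
        then have "z \<in> hyp_ball (max K 1) u" using hyp_ball_mono[of K "max K 1" u] u by auto
        from bdist_powr_comparable(1)[OF this u, of b] show ?thesis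
          by (intro mult_right_mono ennreal_leI) (simp_all add: B_def)
      qed simp
    qed
    also have "\<dots> = ennreal (B * bdist u powr b) * emeasure lborel (hyp_ball K u)"
      by (subst nn_integral_cmult_indicator) simp_all
    also have "\<dots> \<le> ennreal (B * bdist u powr b) * ennreal (C * bdist u ^ (CARD('n) + 1))"
      using C(2)[OF u] by (rule mult_left_mono) simp
    also have "\<dots> = ennreal (B * C * bdist u powr (b + real (CARD('n) + 1)))"
      using B C bdist_pos[OF u] unfolding powr_add
      by (simp only: powr_realpow) (simp add: mult_ac flip: ennreal_mult)
    finally show ?thesis .
  qed
  moreover have "B * C > 0" using B C by simp
  ultimately show ?thesis by blast
qed

text \<open>Membership in \<open>hyp_ball\<close> is symmetric, so Tonelli's theorem leaves the
  integral of a power of \<open>bdist\<close> over the ball about \<open>u\<close>, of order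
  d(u)^(b+n+1).\<close>

lemma integral_hyp_ball_Fubini:
  "\<exists>C>0. \<forall>\<Phi> :: complex ^ 'n \<Rightarrow> ennreal. \<Phi> \<in> borel_measurable borel \<longrightarrow>
     (\<integral>\<^sup>+z\<in>ball 0 1. ennreal (bdist z powr b) * (\<integral>\<^sup>+u\<in>hyp_ball K z. \<Phi> u \<partial>lborel) \<partial>lborel) \<le>
     ennreal C * (\<integral>\<^sup>+u\<in>ball 0 1. ennreal (bdist u powr (b + real (CARD('n) + 1))) * \<Phi> u \<partial>lborel)"
proof -
  obtain C where C: "C > 0" "\<And>u::complex ^ 'n. u \<in> ball 0 1 \<Longrightarrow>
     (\<integral>\<^sup>+z\<in>hyp_ball K u. ennreal (bdist z powr b) \<partial>lborel) \<le> ennreal (C * bdist u powr (b + real (CARD('n) + 1)))"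
    using integral_bdist_hyp_ball_le by blast
  have "(\<integral>\<^sup>+z\<in>ball 0 1. ennreal (bdist z powr b) * (\<integral>\<^sup>+u\<in>hyp_ball K z. \<Phi> u \<partial>lborel) \<partial>lborel) \<le>
     ennreal C * (\<integral>\<^sup>+u\<in>ball 0 1. ennreal (bdist u powr (b + real (CARD('n) + 1))) * \<Phi> u \<partial>lborel)"
    if [measurable]: "\<Phi> \<in> borel_measurable borel" for \<Phi> :: "complex ^ 'n \<Rightarrow> ennreal"
  proof -
    let ?I = "\<lambda>z u. indicator (ball 0 1) z * ennreal (bdist z powr b) * (if u \<in> hyp_ball K z then \<Phi> u else 0)"
    have "(\<integral>\<^sup>+z\<in>ball 0 1. ennreal (bdist z powr b) * (\<integral>\<^sup>+u\<in>hyp_ball K z. \<Phi> u \<partial>lborel) \<partial>lborel)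
        = (\<integral>\<^sup>+z. \<integral>\<^sup>+u. ?I z u \<partial>lborel \<partial>lborel)"
    proof (rule nn_integral_cong)
      fix z :: "complex ^ 'n"
      have "(\<integral>\<^sup>+u. ?I z u \<partial>lborel) = indicator (ball 0 1) z * ennreal (bdist z powr b) * (\<integral>\<^sup>+u. (if u \<in> hyp_ball K z then \<Phi> u else 0) \<partial>lborel)"
        by (rule nn_integral_cmult) measurable
      also have "(\<integral>\<^sup>+u. (if u \<in> hyp_ball K z then \<Phi> u else 0) \<partial>lborel) = (\<integral>\<^sup>+u\<in>hyp_ball K z. \<Phi> u \<partial>lborel)"
        by (intro nn_integral_cong) (auto simp: indicator_def)
      finally show "ennreal (bdist z powr b) * (\<integral>\<^sup>+u\<in>hyp_ball K z. \<Phi> u \<partial>lborel) * indicator (ball 0 1) z = (\<integral>\<^sup>+u. ?I z u \<partial>lborel)"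
        by (simp add: mult_ac)
    qed
    also have "\<dots> = (\<integral>\<^sup>+u. \<integral>\<^sup>+z. ?I z u \<partial>lborel \<partial>lborel)"
      by (rule lborel_pair.Fubini'[symmetric]) measurable
    also have "\<dots> \<le> (\<integral>\<^sup>+u. ennreal C * (ennreal (bdist u powr (b + real (CARD('n) + 1))) * \<Phi> u * indicator (ball 0 1) u) \<partial>lborel)"
    proof (rule nn_integral_mono)
      fix u :: "complex ^ 'n"
      show "(\<integral>\<^sup>+z. ?I z u \<partial>lborel) \<le> ennreal C * (ennreal (bdist u powr (b + real (CARD('n) + 1))) * \<Phi> u * indicator (ball 0 1) u)"
      proof (cases "u \<in> ball 0 1")
        case True
        have "(\<integral>\<^sup>+z. ?I z u \<partial>lborel) = (\<integral>\<^sup>+z. ennreal (bdist z powr b) * indicator (hyp_ball K u) z * \<Phi> u \<partial>lborel)"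
        proof (rule nn_integral_cong)
          fix z
          show "?I z u = ennreal (bdist z powr b) * indicator (hyp_ball K u) z * \<Phi> u"
          proof (cases "z \<in> ball 0 1")
            case z: True
            then show ?thesis using hyp_ball_sym[OF z True, of K] by (simp add: indicator_def)
          next
            case False
            then have "z \<notin> hyp_ball K u" using hyp_ball_subset by blast
            then show ?thesis using False by simp
          qed
        qed
        also have "\<dots> = (\<integral>\<^sup>+z\<in>hyp_ball K u. ennreal (bdist z powr b) \<partial>lborel) * \<Phi> u"
          by (rule nn_integral_multc) measurable
        also have "\<dots> \<le> ennreal (C * bdist u powr (b + real (CARD('n) + 1))) * \<Phi> u"
          using C(2)[OF True] by (rule mult_right_mono) simp
        finally show ?thesis using C True by (simp add: ennreal_mult mult.assoc)
      next
        case False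
        then have "u \<notin> hyp_ball K z" for z using hyp_ball_subset by blast
        then show ?thesis by simp
      qed
    qed
    also have "\<dots> = ennreal C * (\<integral>\<^sup>+u\<in>ball 0 1. ennreal (bdist u powr (b + real (CARD('n) + 1))) * \<Phi> u \<partial>lborel)"
      by (rule nn_integral_cmult) measurable
    finally show ?thesis .
  qed
  with C(1) show ?thesis by blast
qed

text \<open>The n + 1 gained by Tonelli cancels the n + 1 of the invariant measure: averaging over
  Bergman balls preserves the weight exponent.\<close>

lemma integral_hpow_hyp_ball:
  "\<exists>C>0. \<forall>h :: complex ^ 'n \<Rightarrow> complex. line_hol h \<longrightarrow>
     (\<integral>\<^sup>+z\<in>ball 0 1. ennreal (bdist z powr b) * hyp_int K z (hpow h (a - real (CARD('n) + 1)) p) \<partial>lborel) \<le>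
     ennreal C * (\<integral>\<^sup>+u. hpow h (a + b) p u \<partial>lborel)"
proof -
  obtain C where C: "C > 0" "\<And>\<Phi> :: complex ^ 'n \<Rightarrow> ennreal. \<Phi> \<in> borel_measurable borel \<Longrightarrow>
     (\<integral>\<^sup>+z\<in>ball 0 1. ennreal (bdist z powr b) * (\<integral>\<^sup>+u\<in>hyp_ball K z. \<Phi> u \<partial>lborel) \<partial>lborel) \<le>
     ennreal C * (\<integral>\<^sup>+u\<in>ball 0 1. ennreal (bdist u powr (b + real (CARD('n) + 1))) * \<Phi> u \<partial>lborel)"
    using integral_hyp_ball_Fubini by blast
  have "(\<integral>\<^sup>+z\<in>ball 0 1. ennreal (bdist z powr b) * hyp_int K z (hpow h (a - real (CARD('n) + 1)) p) \<partial>lborel) \<le>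
     ennreal C * (\<integral>\<^sup>+u. hpow h (a + b) p u \<partial>lborel)" if h: "line_hol h" for h :: "complex ^ 'n \<Rightarrow> complex"
  proof -
    have "(\<integral>\<^sup>+u\<in>ball 0 1. ennreal (bdist u powr (b + real (CARD('n) + 1))) * hpow h (a - real (CARD('n) + 1)) p u \<partial>lborel)
      = (\<integral>\<^sup>+u. hpow h (a + b) p u \<partial>lborel)"
    proof (rule nn_integral_cong)
      fix u :: "complex ^ 'n"
      show "ennreal (bdist u powr (b + real (CARD('n) + 1))) * hpow h (a - real (CARD('n) + 1)) p u * indicator (ball 0 1) u = hpow h (a + b) p u"
      proof (cases "u \<in> ball 0 1")
        case True
        then show ?thesis using hpow_mult[OF True, of "b + real (CARD('n) + 1)" h "a - real (CARD('n) + 1)" p]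
          by (simp add: add.commute)
      qed (simp add: hpow_def)
    qed
    with C(2)[OF hpow_borel[OF h, of "a - real (CARD('n) + 1)" p]] show ?thesis by (simp only:)
  qed
  with C(1) show ?thesis by blast
qed

section \<open>Radial derivatives and weighted integrals\<close>

lemma powr_add_le:
  fixes x y p :: real
  assumes "0 \<le> x" "0 \<le> y" "p > 0"
  shows "(x + y) powr p \<le> 2 powr p * (x powr p + y powr p)"
proof -
  have "(x + y) powr p \<le> (2 * max x y) powr p" using assms by (intro powr_mono2) auto
  also have "\<dots> = 2 powr p * max x y powr p" using assms by (simp add: powr_mult)
  also have "max x y powr p \<le> x powr p + y powr p" by (simp add: max_def)
  finally show ?thesis by simp
qed

text \<open>Cauchy's estimate for h(z + t z) on the disc |t| \<le> c d(z), which keeps the points in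
  a Bergman ball about \<open>z\<close>; its derivative at 0 is the radial derivative. The point
  \<open>w\<close> is where the modulus is maximal on the disc.\<close>

lemma hpow_radial_deriv_le_hpow:
  fixes a p :: real
  assumes p: "p > 0"
  shows "\<exists>C>0. \<forall>(h :: complex ^ 'n \<Rightarrow> complex) z. line_hol h \<longrightarrow> z \<in> ball 0 1 \<longrightarrow>
     (\<exists>w\<in>hyp_ball 2 z. hpow (radial_deriv h) (a + p) p z \<le> ennreal C * hpow h a p w)"
proof -
  have two: "1 < (2 :: real)" by simp
  obtain c where c: "c > 0" "c \<le> 1 / 81"
    "\<And>z v :: complex ^ 'n. z \<in> ball 0 1 \<Longrightarrow> norm v \<le> sqrt (c * bdist z) \<Longrightarrow>
       cmod (hinner v z) \<le> c * bdist z \<Longrightarrow> z + v \<in> hyp_ball 2 z"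
    using slab_subset_hyp_ball[OF two] by blast
  \<comment> \<open>The 8 is 4 times the ball constant 2, from
    \<open>bdist_powr_comparable\<close>.\<close>
  define B where "B = (8::real) powr \<bar>a\<bar>"
  have "\<exists>w\<in>hyp_ball 2 z. hpow (radial_deriv h) (a + p) p z \<le> ennreal ((1 / c) powr p * B) * hpow h a p w"
    if h: "line_hol h" and z: "z \<in> ball 0 1" for h :: "complex ^ 'n \<Rightarrow> complex" and z
  proof -
    define r where "r = c * bdist z"
    have d: "bdist z > 0" "bdist z \<le> 1" using bdist_pos[OF z] bdist_le_1[of z] by auto
    have r: "r > 0" "r \<le> 1"
      using c d mult_mono[of c 1 "bdist z" 1] by (auto simp: r_def)
    have "r * r \<le> r * 1" using r by (intro mult_left_mono) auto
    then have "r \<le> sqrt r" by (intro real_le_rsqrt) (simp add: power2_eq_square)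
    have inb: "z + t *s z \<in> hyp_ball 2 z" if "cmod t \<le> r" for t
    proof (rule c(3)[OF z])
      have "cmod t * norm z \<le> r * 1" using z that r by (intro mult_mono) auto
      then show "norm (t *s z) \<le> sqrt (c * bdist z)" using \<open>r \<le> sqrt r\<close> by (simp add: norm_smult r_def)
      have "(norm z)\<^sup>2 \<le> 1" using z by (simp add: power_le_one)
      then have "cmod t * (norm z)\<^sup>2 \<le> r * 1" using that r by (intro mult_mono) auto
      then show "cmod (hinner (t *s z) z) \<le> c * bdist z"
        by (simp add: hinner_smult_left hinner_self norm_mult r_def norm_power)
    qed
    then have inb1: "z + t *s z \<in> ball 0 1" if "cmod t \<le> r" for t using that hyp_ball_subset by blast
    have hol: "(\<lambda>t. h (z + t *s z)) holomorphic_on cball 0 r"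
      using line_hol_holomorphic[OF h, of z z]
      by (rule holomorphic_on_subset) (use inb1 in \<open>auto simp: dist_norm\<close>)
    then have cont: "continuous_on (cball 0 r) (\<lambda>t. h (z + t *s z))" by (rule holomorphic_on_imp_continuous_on)
    have "continuous_on (cball 0 r) (\<lambda>t. cmod (h (z + t *s z)))" by (intro continuous_intros cont)
    then obtain t0 where t0: "t0 \<in> cball 0 r" "\<And>t. t \<in> cball 0 r \<Longrightarrow> cmod (h (z + t *s z)) \<le> cmod (h (z + t0 *s z))"
      using continuous_attains_sup[of "cball (0::complex) r" "\<lambda>t. cmod (h (z + t *s z))"] r by auto
    define w where "w = z + t0 *s z"
    have w: "w \<in> hyp_ball 2 z" "w \<in> ball 0 1" using inb[of t0] inb1[of t0] t0(1) by (auto simp: w_def)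
    have "cmod ((deriv ^^ 1) (\<lambda>t. h (z + t *s z)) 0) \<le> fact 1 * cmod (h w) / r ^ 1"
    proof (rule Cauchy_inequality)
      show "(\<lambda>t. h (z + t *s z)) holomorphic_on ball 0 r" using hol by (rule holomorphic_on_subset) auto
    qed (use cont r t0 in \<open>auto simp: w_def\<close>)
    moreover have "(deriv ^^ 1) (\<lambda>t. h (z + t *s z)) 0 = radial_deriv h z"
      unfolding radial_deriv_eq[OF h z] dir_deriv_def by simp
    ultimately have "cmod (radial_deriv h z) \<le> cmod (h w) / r"
      by (simp only: fact_1 mult_1 power_one_right)
    then have "bdist z * cmod (radial_deriv h z) \<le> bdist z * (cmod (h w) / r)"
      using d by (intro mult_left_mono) auto
    also have "\<dots> = 1 / c * cmod (h w)" using d by (simp add: r_def)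
    finally have "(bdist z * cmod (radial_deriv h z)) powr p \<le> (1 / c * cmod (h w)) powr p"
      using d p by (intro powr_mono2) auto
    then have "bdist z powr a * (bdist z * cmod (radial_deriv h z)) powr p \<le> bdist z powr a * (1 / c * cmod (h w)) powr p"
      by (intro mult_left_mono) auto
    also have "\<dots> = (1 / c) powr p * (bdist z powr a * cmod (h w) powr p)"
      using c by (subst powr_mult) simp_all
    also have "bdist z powr a * cmod (h w) powr p \<le> (B * bdist w powr a) * cmod (h w) powr p"
      using bdist_powr_comparable(2)[OF w(1) z, of a] by (intro mult_right_mono) (auto simp: B_def)
    finally have "bdist z powr (a + p) * cmod (radial_deriv h z) powr p \<le> (1 / c) powr p * B * (bdist w powr a * cmod (h w) powr p)"
      using d by (simp add: powr_mult powr_add mult_left_mono mult.assoc)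
    then have "hpow (radial_deriv h) (a + p) p z \<le> ennreal ((1 / c) powr p * B * (bdist w powr a * cmod (h w) powr p))"
      unfolding hpow_eq[OF z] by (rule ennreal_leI)
    also have "\<dots> = ennreal ((1 / c) powr p * B) * hpow h a p w"
      unfolding hpow_eq[OF w(2)] by (rule ennreal_mult) (auto simp: B_def)
    finally show ?thesis using w by blast
  qed
  moreover have "(1 / c) powr p * B > 0" using c by (simp add: B_def)
  ultimately show ?thesis by blast
qed

text \<open>The pointwise Cauchy estimate, the maximum replaced by a mean over a larger Bergman
  ball, and Tonelli with \<open>b = 0\<close>. Each radial derivative costs one factor
  \<open>bdist\<close>, hence \<open>a + p\<close>.\<close>

lemma integral_hpow_radial_deriv_le:
  fixes a p :: real
  assumes p: "p > 0"
  shows "\<exists>C>0. \<forall>h :: complex ^ 'n \<Rightarrow> complex. line_hol h \<longrightarrow>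
     (\<integral>\<^sup>+z. hpow (radial_deriv h) (a + p) p z \<partial>lborel) \<le> ennreal C * (\<integral>\<^sup>+z. hpow h a p z \<partial>lborel)"
proof -
  define m where "m = real (CARD('n) + 1)"
  obtain C1 where C1: "C1 > 0" "\<And>(h :: complex ^ 'n \<Rightarrow> complex) z. line_hol h \<Longrightarrow> z \<in> ball 0 1 \<Longrightarrow>
     (\<exists>w\<in>hyp_ball 2 z. hpow (radial_deriv h) (a + p) p z \<le> ennreal C1 * hpow h a p w)"
    using hpow_radial_deriv_le_hpow[OF p] by blast
  obtain C2 where C2: "C2 > 0" "\<And>(h :: complex ^ 'n \<Rightarrow> complex) z w. line_hol h \<Longrightarrow> z \<in> ball 0 1 \<Longrightarrow> w \<in> hyp_ball 2 z \<Longrightarrow>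
     hpow h a p w \<le> ennreal C2 * hyp_int (288 * 2) z (hpow h (a - m) p)"
    using hpow_le_integral[OF p, of 2 a] unfolding m_def by blast
  have "\<exists>C3>0. \<forall>h :: complex ^ 'n \<Rightarrow> complex. line_hol h \<longrightarrow>
     (\<integral>\<^sup>+z\<in>ball 0 1. ennreal (bdist z powr 0) * hyp_int (288 * 2) z (hpow h (a - m) p) \<partial>lborel) \<le>
     ennreal C3 * (\<integral>\<^sup>+u. hpow h (a + 0) p u \<partial>lborel)"
    unfolding m_def by (rule integral_hpow_hyp_ball)
  then obtain C3 where C3: "C3 > 0" "\<forall>h :: complex ^ 'n \<Rightarrow> complex. line_hol h \<longrightarrow>
     (\<integral>\<^sup>+z\<in>ball 0 1. ennreal (bdist z powr 0) * hyp_int (288 * 2) z (hpow h (a - m) p) \<partial>lborel) \<le>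
     ennreal C3 * (\<integral>\<^sup>+u. hpow h (a + 0) p u \<partial>lborel)"
    by (elim exE conjE)
  have "(\<integral>\<^sup>+z. hpow (radial_deriv h) (a + p) p z \<partial>lborel) \<le> ennreal (C1 * C2 * C3) * (\<integral>\<^sup>+z. hpow h a p z \<partial>lborel)"
    if h: "line_hol h" for h :: "complex ^ 'n \<Rightarrow> complex"
  proof -
    define G where "G z = hyp_int (288 * 2) z (hpow h (a - m) p)" for z
    have [measurable]: "G \<in> borel_measurable borel"
      unfolding G_def by (rule borel_measurable_integral_hyp_ball[OF hpow_borel[OF h]])
    have "(\<integral>\<^sup>+z. hpow (radial_deriv h) (a + p) p z \<partial>lborel) \<le>
        (\<integral>\<^sup>+z. ennreal (C1 * C2) * (ennreal (bdist z powr 0) * G z * indicator (ball 0 1) z) \<partial>lborel)"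
    proof (rule nn_integral_mono)
      fix z :: "complex ^ 'n"
      show "hpow (radial_deriv h) (a + p) p z \<le> ennreal (C1 * C2) * (ennreal (bdist z powr 0) * G z * indicator (ball 0 1) z)"
      proof (cases "z \<in> ball 0 1")
        case True
        obtain w where w: "w \<in> hyp_ball 2 z" "hpow (radial_deriv h) (a + p) p z \<le> ennreal C1 * hpow h a p w"
          using C1(2)[OF h True] by blast
        note w(2)
        also have "ennreal C1 * hpow h a p w \<le> ennreal C1 * (ennreal C2 * G z)"
          unfolding G_def by (intro mult_left_mono C2(2)[OF h True w(1)]) simp
        finally show ?thesis using True bdist_pos[OF True] C1 C2 by (simp add: ennreal_mult mult.assoc)
      qed (simp add: hpow_def)
    qed
    also have "\<dots> = ennreal (C1 * C2) * (\<integral>\<^sup>+z\<in>ball 0 1. ennreal (bdist z powr 0) * G z \<partial>lborel)"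
      by (rule nn_integral_cmult) measurable
    also have "\<dots> \<le> ennreal (C1 * C2) * (ennreal C3 * (\<integral>\<^sup>+u. hpow h (a + 0) p u \<partial>lborel))"
      unfolding G_def by (intro mult_left_mono C3(2)[rule_format, OF h]) simp
    finally show ?thesis using C1 C2 C3 by (simp add: ennreal_mult mult.assoc)
  qed
  moreover have "C1 * C2 * C3 > 0" using C1 C2 C3 by simp
  ultimately show ?thesis by blast
qed

text \<open>Here 1 - \<tau> |z|^2 = d(z) + (1 - \<tau>) |z|^2 is at most (1 + L) d(z), and d only
  grows when moving inwards. Using 2 + L instead of 1 + L makes the inequality strict.\<close>

lemma radial_segment_in_hyp_ball:
  assumes z: "z \<in> ball 0 1" and t: "0 \<le> \<tau>" "\<tau> \<le> 1" "1 - \<tau> \<le> L * (1 - norm z)" and L: "L > 0"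
  shows "\<tau> *\<^sub>R z \<in> hyp_ball ((2 + L)\<^sup>2) z" "bdist z \<le> bdist (\<tau> *\<^sub>R z)"
proof -
  have nz: "norm z < 1" using z by simp
  have d: "bdist z > 0" using bdist_pos[OF z] .
  have s: "1 - norm z \<le> bdist z"
    using nz mult_left_mono[of "norm z" 1 "norm z"] by (simp add: bdist_def power2_eq_square)
  have "\<tau> * norm z \<le> 1 * norm z" using t by (intro mult_right_mono) auto
  then have tz: "norm (\<tau> *\<^sub>R z) \<le> norm z" using t by simp
  then have "(norm (\<tau> *\<^sub>R z))\<^sup>2 \<le> (norm z)\<^sup>2" by (intro power_mono) auto
  then show bd: "bdist z \<le> bdist (\<tau> *\<^sub>R z)" by (simp add: bdist_def)
  have "1 - hinner (\<tau> *\<^sub>R z) z = of_real (1 - \<tau> * (norm z)\<^sup>2)"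
    by (simp add: hinner_scaleR_left hinner_self)
  then have "cmod (1 - hinner (\<tau> *\<^sub>R z) z) = \<bar>1 - \<tau> * (norm z)\<^sup>2\<bar>" by (simp only: norm_of_real)
  moreover have "\<tau> * (norm z)\<^sup>2 \<le> 1 * 1" using t nz by (intro mult_mono) (auto simp: power_le_one)
  moreover have "1 - \<tau> * (norm z)\<^sup>2 = bdist z + (1 - \<tau>) * (norm z)\<^sup>2" by (simp add: bdist_def algebra_simps)
  moreover have "(1 - \<tau>) * (norm z)\<^sup>2 \<le> (L * bdist z) * 1"
  proof (intro mult_mono)
    show "1 - \<tau> \<le> L * bdist z" using t(3) mult_left_mono[OF s, of L] L by linarith
  qed (use nz t L d in \<open>auto simp: power_le_one\<close>)
  ultimately have "cmod (1 - hinner (\<tau> *\<^sub>R z) z) \<le> (1 + L) * bdist z" by (simp add: algebra_simps)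
  also have "\<dots> < (2 + L) * bdist z" using d by (simp add: algebra_simps)
  finally have "(cmod (1 - hinner (\<tau> *\<^sub>R z) z))\<^sup>2 < ((2 + L) * bdist z)\<^sup>2"
    by (intro power_strict_mono) auto
  also have "\<dots> = (2 + L)\<^sup>2 * bdist z * bdist z" by (simp add: power2_eq_square)
  also have "\<dots> \<le> (2 + L)\<^sup>2 * bdist z * bdist (\<tau> *\<^sub>R z)" using bd d by (intro mult_left_mono) auto
  finally show "\<tau> *\<^sub>R z \<in> hyp_ball ((2 + L)\<^sup>2) z" using tz nz by (simp add: hyp_ball_def)
qed

lemma radial_deriv_along_ray:
  assumes h: "line_hol h" and b: "\<tau> *\<^sub>R z \<in> ball 0 1"
  shows "((\<lambda>t. h (t *s z)) has_field_derivative dir_deriv z h (\<tau> *\<^sub>R z)) (at (of_real \<tau>))"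
    "radial_deriv h (\<tau> *\<^sub>R z) = of_real \<tau> * dir_deriv z h (\<tau> *\<^sub>R z)"
  using line_hol_derivative[OF h, of 0 "of_real \<tau>" z] b radial_deriv_eq[OF h b]
    dir_deriv_scale[OF h b, of "of_real \<tau>" z]
  by (simp_all add: smult_of_real)

text \<open>Mean value inequality on the segment from t z to z, of parameter length at most L d(z).
  The derivative along \<open>z\<close> at \<tau> z is the radial derivative divided by \<tau>, at
  most twice as large since \<open>1 / 2 \<le> t\<close>. Its maximum over the segment is replaced
  by a mean over a Bergman ball.\<close>

lemma hpow_le_ray:
  fixes a p L :: real
  assumes p: "p > 0" and L: "L > 0"
  shows "\<exists>C>0. \<forall>(h :: complex ^ 'n \<Rightarrow> complex) z t. line_hol h \<longrightarrow> z \<in> ball 0 1 \<longrightarrow> 1 / 2 \<le> t \<longrightarrow> t \<le> 1 \<longrightarrow>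
     1 - t \<le> L * (1 - norm z) \<longrightarrow>
     hpow h a p z \<le> ennreal (2 powr p) * ennreal (bdist z powr a * cmod (h (t *\<^sub>R z)) powr p) +
       ennreal C * hyp_int (288 * (2 + L)\<^sup>2) z (hpow (radial_deriv h) (a + p - real (CARD('n) + 1)) p)"
proof -
  obtain C where C: "C > 0" "\<And>(h :: complex ^ 'n \<Rightarrow> complex) z w. line_hol h \<Longrightarrow> z \<in> ball 0 1 \<Longrightarrow> w \<in> hyp_ball ((2 + L)\<^sup>2) z \<Longrightarrow>
     hpow h (a + p) p w \<le> ennreal C * hyp_int (288 * (2 + L)\<^sup>2) z (hpow h (a + p - real (CARD('n) + 1)) p)"
    using hpow_le_integral[OF p, of "(2 + L)\<^sup>2" "a + p"] by blast
  define B where "B = (4 * (2 + L)\<^sup>2) powr \<bar>a + p\<bar>"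
  define D where "D = 2 powr p * ((2 * L) powr p * B)"
  have "hpow h a p z \<le> ennreal (2 powr p) * ennreal (bdist z powr a * cmod (h (t *\<^sub>R z)) powr p) +
       ennreal (D * C) * hyp_int (288 * (2 + L)\<^sup>2) z (hpow (radial_deriv h) (a + p - real (CARD('n) + 1)) p)"
    if h: "line_hol h" and z: "z \<in> ball 0 1" and t: "1 / 2 \<le> t" "t \<le> 1" "1 - t \<le> L * (1 - norm z)"
    for h :: "complex ^ 'n \<Rightarrow> complex" and z t
  proof -
    have hR: "line_hol (radial_deriv h)" by (rule line_hol_radial_deriv[OF h])
    have d: "bdist z > 0" using bdist_pos[OF z] .
    have hb: "\<tau> *\<^sub>R z \<in> hyp_ball ((2 + L)\<^sup>2) z" if "\<tau> \<in> {t..1}" for \<tau>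
      using radial_segment_in_hyp_ball(1)[OF z _ _ _ L, of \<tau>] t that by auto
    then have inb: "\<tau> *\<^sub>R z \<in> ball 0 1" if "\<tau> \<in> {t..1}" for \<tau> using that hyp_ball_subset by blast
    have "continuous_on {t..1} (\<lambda>\<tau>. cmod (radial_deriv h (\<tau> *\<^sub>R z)))"
      by (intro continuous_intros continuous_on_compose2[OF line_hol_cont[OF hR]]) (use inb in auto)
    then obtain \<tau>0 where \<tau>0: "\<tau>0 \<in> {t..1}" "\<And>\<tau>. \<tau> \<in> {t..1} \<Longrightarrow> cmod (radial_deriv h (\<tau> *\<^sub>R z)) \<le> cmod (radial_deriv h (\<tau>0 *\<^sub>R z))"
      using continuous_attains_sup[of "{t..1}" "\<lambda>\<tau>. cmod (radial_deriv h (\<tau> *\<^sub>R z))"] t by auto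
    define w where "w = \<tau>0 *\<^sub>R z"
    define M where "M = cmod (radial_deriv h w)"
    have seg: "closed_segment (of_real t) (1::complex) = of_real ` {t..1}"
      using closed_segment_of_real[of t 1] t by (simp add: closed_segment_eq_real_ivl)
    have "cmod (h (1 *s z) - h (of_real t *s z)) \<le> (2 * M) * cmod (1 - of_real t)"
    proof (rule field_differentiable_bound[of "closed_segment (of_real t) (1::complex)"])
      fix x assume "x \<in> closed_segment (of_real t) (1::complex)"
      then obtain \<tau> where \<tau>: "x = of_real \<tau>" "\<tau> \<in> {t..1}" unfolding seg by blast
      show "((\<lambda>t. h (t *s z)) has_field_derivative dir_deriv z h (Re x *\<^sub>R z)) (at x within closed_segment (of_real t) 1)"
        using radial_deriv_along_ray(1)[OF h inb[OF \<tau>(2)]] by (simp add: \<tau> has_field_derivative_at_within)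
      have "\<tau> * cmod (dir_deriv z h (\<tau> *\<^sub>R z)) \<le> M"
        using \<tau>0(2)[OF \<tau>(2)] \<tau>(2) t unfolding radial_deriv_along_ray(2)[OF h inb[OF \<tau>(2)]]
        by (simp add: norm_mult M_def w_def)
      moreover have "1 / 2 * cmod (dir_deriv z h (\<tau> *\<^sub>R z)) \<le> \<tau> * cmod (dir_deriv z h (\<tau> *\<^sub>R z))"
        using \<tau>(2) t by (intro mult_right_mono) auto
      ultimately show "cmod (dir_deriv z h (Re x *\<^sub>R z)) \<le> 2 * M" by (simp add: \<tau>)
    qed auto
    then have "cmod (h z - h (t *\<^sub>R z)) \<le> (2 * M) * (1 - t)"
    proof -
      have "cmod (1 - of_real t) = 1 - t"
        using t by (metis abs_of_nonneg diff_ge_0_iff_ge norm_of_real of_real_1 of_real_diff)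
      then show ?thesis using \<open>cmod (h (1 *s z) - h (of_real t *s z)) \<le> _\<close> by (simp add: smult_of_real)
    qed
    also have "\<dots> \<le> (2 * M) * (L * bdist z)"
    proof (intro mult_left_mono)
      have "1 - norm z \<le> bdist z"
        using z mult_left_mono[of "norm z" 1 "norm z"] by (simp add: bdist_def power2_eq_square)
      then show "1 - t \<le> L * bdist z" using t(3) mult_left_mono[of "1 - norm z" "bdist z" L] L by linarith
    qed (simp add: M_def)
    finally have diff: "cmod (h z - h (t *\<^sub>R z)) \<le> (2 * L) * (bdist z * M)" by (simp add: mult_ac)
    have M: "M \<ge> 0" by (simp add: M_def)
    have "cmod (h z) \<le> cmod (h (t *\<^sub>R z)) + cmod (h z - h (t *\<^sub>R z))" by (rule norm_triangle_sub)
    then have "cmod (h z) \<le> cmod (h (t *\<^sub>R z)) + (2 * L) * (bdist z * M)" using diff by linarith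
    then have "cmod (h z) powr p \<le> (cmod (h (t *\<^sub>R z)) + (2 * L) * (bdist z * M)) powr p"
      using p by (intro powr_mono2) auto
    also have "\<dots> \<le> 2 powr p * (cmod (h (t *\<^sub>R z)) powr p + ((2 * L) * (bdist z * M)) powr p)"
      using p L d M by (intro powr_add_le) auto
    also have "((2 * L) * (bdist z * M)) powr p = (2 * L) powr p * (bdist z powr p * M powr p)"
      using L d M by (simp add: powr_mult)
    finally have "bdist z powr a * cmod (h z) powr p \<le>
        bdist z powr a * (2 powr p * (cmod (h (t *\<^sub>R z)) powr p + (2 * L) powr p * (bdist z powr p * M powr p)))"
      by (intro mult_left_mono) auto
    also have "\<dots> = 2 powr p * (bdist z powr a * cmod (h (t *\<^sub>R z)) powr p) + 2 powr p * (2 * L) powr p * (bdist z powr (a + p) * M powr p)"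
      by (simp add: powr_add algebra_simps)
    also have "\<dots> \<le> 2 powr p * (bdist z powr a * cmod (h (t *\<^sub>R z)) powr p) + 2 powr p * (2 * L) powr p * ((B * bdist w powr (a + p)) * M powr p)"
      using bdist_powr_comparable(2)[OF hb[OF \<tau>0(1)] z, of "a + p"]
      by (intro add_mono mult_left_mono mult_right_mono) (auto simp: B_def w_def)
    finally have "hpow h a p z \<le> ennreal (2 powr p * (bdist z powr a * cmod (h (t *\<^sub>R z)) powr p) + D * (bdist w powr (a + p) * M powr p))"
      unfolding hpow_eq[OF z] by (intro ennreal_leI) (simp add: D_def mult_ac)
    also have "\<dots> = ennreal (2 powr p) * ennreal (bdist z powr a * cmod (h (t *\<^sub>R z)) powr p) + ennreal D * hpow (radial_deriv h) (a + p) p w"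
    proof -
      have wb: "w \<in> ball 0 1" using inb[OF \<tau>0(1)] by (simp add: w_def)
      have "D \<ge> 0" by (simp add: D_def B_def)
      then show ?thesis unfolding hpow_eq[OF wb] M_def
        by (subst ennreal_plus) (auto simp flip: ennreal_mult)
    qed
    also have "ennreal D * hpow (radial_deriv h) (a + p) p w \<le> ennreal D * (ennreal C * hyp_int (288 * (2 + L)\<^sup>2) z (hpow (radial_deriv h) (a + p - real (CARD('n) + 1)) p))"
      using hb[OF \<tau>0(1)] by (intro mult_left_mono C(2)[OF hR z]) (auto simp: w_def)
    finally show ?thesis using C by (simp add: D_def B_def ennreal_mult mult.assoc add_left_mono)
  qed
  moreover have "D * C > 0" using C L by (simp add: D_def B_def add_nonneg_eq_0_iff zero_less_mult_iff)
  ultimately show ?thesis by blast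
qed

section \<open>Averaging along rays\<close>

lemma bdist_bounds:
  assumes "z \<in> ball 0 1"
  shows "1 - norm z \<le> bdist z" "bdist z \<le> 2 * (1 - norm z)"
proof -
  have n: "norm z < 1" using assms by simp
  then show "1 - norm z \<le> bdist z"
    using mult_left_mono[of "norm z" 1 "norm z"] by (simp add: bdist_def power2_eq_square)
  have "0 \<le> (1 - norm z)\<^sup>2" by simp
  then show "bdist z \<le> 2 * (1 - norm z)" by (simp add: bdist_def power2_eq_square algebra_simps)
qed

text \<open>The kernel below averages over \<open>t\<close> with \<open>1 - t\<close> between \<open>L s\<close> and \<open>2 L s\<close>, where
  \<open>s = 1 - \<bar>z\<bar>\<close>. A point \<open>y\<close> is hit by \<open>t z\<close> only if \<open>s\<close> is comparable to \<open>(1 - \<bar>y\<bar>) / L\<close>, and then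
  \<open>t\<close> lies in an interval of length \<open>(1 - \<bar>y\<bar>) / L\<close>: this is where the factor
  \<open>L\<^bsup>-(a+1)\<^esup>\<close> comes from.\<close>

definition ray_kernel :: "real \<Rightarrow> real \<Rightarrow> real \<Rightarrow> complex ^ 'n \<Rightarrow> real \<Rightarrow> real" where
  "ray_kernel a L \<epsilon> z t =
    (if norm z < 1 - \<epsilon> \<and> 1 - 1 / (4 * L) < norm z \<and> L * (1 - norm z) \<le> 1 - t \<and> 1 - t \<le> 2 * L * (1 - norm z)
     then bdist z powr a / (L * (1 - norm z)) else 0)"

lemma ray_kernel_borel [measurable (raw)]:
  assumes [measurable]: "f \<in> borel_measurable M" "g \<in> borel_measurable M"
  shows "(\<lambda>x. ray_kernel a L \<epsilon> (f x) (g x)) \<in> borel_measurable M"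
  unfolding ray_kernel_def by measurable

text \<open>The cut-off \<open>1 - 1 / (4 * L) < norm z\<close> forces
  \<open>2 * L * (1 - norm z)\<close> below 1 / 2, which keeps \<open>t\<close> away from 0.\<close>

lemma ray_kernel_supp:
  assumes "ray_kernel a L \<epsilon> z t \<noteq> 0" "L \<ge> 1" "\<epsilon> > 0"
  shows "1 / 2 \<le> t" "t \<le> 1" "norm z < 1 - \<epsilon>" "L * (1 - norm z) \<le> 1 - t" "1 - t \<le> 2 * L * (1 - norm z)"
proof -
  have *: "norm z < 1 - \<epsilon>" "1 - 1 / (4 * L) < norm z" "L * (1 - norm z) \<le> 1 - t" "1 - t \<le> 2 * L * (1 - norm z)"
    using assms(1) by (auto simp: ray_kernel_def split: if_splits)
  have "1 - norm z < 1 / (4 * L)" using * by simp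
  then have "2 * L * (1 - norm z) \<le> 2 * L * (1 / (4 * L))" using assms by (intro mult_left_mono) auto
  also have "\<dots> = 1 / 2" using assms by simp
  finally show "1 / 2 \<le> t" using * by linarith
  have "L * (1 - norm z) \<ge> 0" using * assms by (intro mult_nonneg_nonneg) auto
  then show "t \<le> 1" using * by linarith
  show "norm z < 1 - \<epsilon>" "L * (1 - norm z) \<le> 1 - t" "1 - t \<le> 2 * L * (1 - norm z)" using * by auto
qed

text \<open>With y = t z, s = 1 - |z| and \<sigma> = 1 - |y| one has \<sigma> = (1 - t) + t s, so
  \<sigma> lies between L s and 3 L s, and t exceeds 1 - \<sigma> by t s, at most \<sigma> / L. In
  the bound, 3 is the ratio of \<sigma> to L s, and 6 = 3 * 2 adds the comparison of
  \<open>bdist\<close> with the distance to the sphere.\<close>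

lemma ray_kernel_preimage:
  fixes y :: "complex ^ 'n"
  assumes L: "L \<ge> 1" and e: "\<epsilon> > 0" and nz: "ray_kernel a L \<epsilon> ((1 / t) *\<^sub>R y) t \<noteq> 0"
  shows "norm y < 1 - \<epsilon>" "1 - (1 - norm y) \<le> t" "t \<le> 1 - (1 - norm y) + (1 - norm y) / L"
    "ray_kernel a L \<epsilon> ((1 / t) *\<^sub>R y) t \<le> 3 * 6 powr \<bar>a\<bar> * L powr (- a) * bdist y powr a / (1 - norm y)"
proof -
  define z where "z = (1 / t) *\<^sub>R y"
  define s where "s = 1 - norm z"
  define \<sigma> where "\<sigma> = 1 - norm y"
  have k: "ray_kernel a L \<epsilon> z t \<noteq> 0" using nz by (simp add: z_def)
  note supp = ray_kernel_supp[OF k L e, folded s_def]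
  have t: "t > 0" "t \<le> 1" using supp by auto
  have s: "s > 0" using supp(3) e by (simp add: s_def)
  have y: "norm y = t * norm z" using t by (simp add: z_def)
  have "t * norm z \<le> 1 * norm z" using t by (intro mult_right_mono) auto
  then show "norm y < 1 - \<epsilon>" using supp(3) y by simp
  have eq: "\<sigma> = (1 - t) + t * s" by (simp add: \<sigma>_def s_def y algebra_simps)
  have ts: "0 \<le> t * s" "t * s \<le> s" using t s by (auto simp: mult_left_le_one_le)
  have Ls: "s \<le> L * s" using L s by simp
  have \<sigma>1: "L * s \<le> \<sigma>" "\<sigma> \<le> 3 * (L * s)" using eq ts supp(4,5) Ls by auto
  have \<sigma>0: "\<sigma> > 0" using \<sigma>1 Ls s by linarith
  have s\<sigma>: "s \<le> \<sigma> / L" using \<sigma>1 L by (simp add: field_simps)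
  show "1 - (1 - norm y) \<le> t" "t \<le> 1 - (1 - norm y) + (1 - norm y) / L"
    using eq ts s\<sigma> by (auto simp: \<sigma>_def[symmetric])
  have zb: "z \<in> ball 0 1" using s by (simp add: s_def)
  have yb: "y \<in> ball 0 1" using \<sigma>0 by (simp add: \<sigma>_def)
  have dz: "s \<le> bdist z" "bdist z \<le> 2 * s" using bdist_bounds[OF zb] by (auto simp: s_def)
  have dy: "\<sigma> \<le> bdist y" "bdist y \<le> 2 * \<sigma>" using bdist_bounds[OF yb] by (auto simp: \<sigma>_def)
  have "bdist z powr a \<le> 3 powr \<bar>a\<bar> * (\<sigma> / L) powr a"
  proof (rule powr_le_of_comparable)
    show "bdist z \<le> 3 * (\<sigma> / L)" using dz s\<sigma> s by linarith
    have "\<sigma> / L \<le> 3 * s" using \<sigma>1 L by (simp add: field_simps)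
    then show "\<sigma> / L \<le> 3 * bdist z" using dz by linarith
  qed (use dz s \<sigma>0 L in auto)
  also have "(\<sigma> / L) powr a = L powr (- a) * \<sigma> powr a"
    using \<sigma>0 L by (simp add: powr_divide powr_minus field_simps)
  also have "\<sigma> powr a \<le> 2 powr \<bar>a\<bar> * bdist y powr a"
    by (rule powr_le_of_comparable) (use dy \<sigma>0 in auto)
  finally have "bdist z powr a \<le> 3 powr \<bar>a\<bar> * (L powr (- a) * (2 powr \<bar>a\<bar> * bdist y powr a))"
    by (simp add: mult_left_mono)
  also have "\<dots> = 6 powr \<bar>a\<bar> * L powr (- a) * bdist y powr a"
    using powr_mult[of 3 2 "\<bar>a\<bar>"] by simp
  finally have A: "bdist z powr a \<le> 6 powr \<bar>a\<bar> * L powr (- a) * bdist y powr a" .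
  have B: "1 / (L * s) \<le> 3 / \<sigma>" using \<sigma>1 \<sigma>0 L s by (simp add: field_simps)
  have "ray_kernel a L \<epsilon> z t = bdist z powr a * (1 / (L * s))"
    using k by (auto simp: ray_kernel_def s_def split: if_splits)
  also have "\<dots> \<le> (6 powr \<bar>a\<bar> * L powr (- a) * bdist y powr a) * (3 / \<sigma>)"
    using A B L s by (intro mult_mono) auto
  finally show "ray_kernel a L \<epsilon> ((1 / t) *\<^sub>R y) t \<le> 3 * 6 powr \<bar>a\<bar> * L powr (- a) * bdist y powr a / (1 - norm y)"
    by (simp add: z_def \<sigma>_def mult_ac)
qed

text \<open>A kernel of order L^(-a) d(y)^a / \<sigma> on an interval of length \<sigma> / L;
  \<sigma> cancels and one further power of L is gained.\<close>

lemma integral_ray_kernel_preimage: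
  fixes y :: "complex ^ 'n"
  assumes L: "L \<ge> 1" and e: "\<epsilon> > 0"
  shows "(\<integral>\<^sup>+t. ennreal (ray_kernel a L \<epsilon> ((1 / t) *\<^sub>R y) t) \<partial>lborel) \<le>
    ennreal (3 * 6 powr \<bar>a\<bar> * L powr (- (a + 1)) * bdist y powr a) * indicator (ball 0 (1 - \<epsilon>)) y"
proof (cases "norm y < 1 - \<epsilon>")
  case False
  then have "ray_kernel a L \<epsilon> ((1 / t) *\<^sub>R y) t = 0" for t
    using ray_kernel_preimage(1)[OF L e, of a t y] by blast
  then show ?thesis by simp
next
  case True
  define \<sigma> where "\<sigma> = 1 - norm y"
  have \<sigma>: "\<sigma> > 0" using True e by (simp add: \<sigma>_def)
  define D where "D = 3 * 6 powr \<bar>a\<bar> * L powr (- a) * bdist y powr a / \<sigma>"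
  have "(\<integral>\<^sup>+t. ennreal (ray_kernel a L \<epsilon> ((1 / t) *\<^sub>R y) t) \<partial>lborel) \<le>
      (\<integral>\<^sup>+t. ennreal D * indicator {1 - \<sigma>..1 - \<sigma> + \<sigma> / L} t \<partial>lborel)"
  proof (rule nn_integral_mono)
    fix t
    show "ennreal (ray_kernel a L \<epsilon> ((1 / t) *\<^sub>R y) t) \<le> ennreal D * indicator {1 - \<sigma>..1 - \<sigma> + \<sigma> / L} t"
    proof (cases "ray_kernel a L \<epsilon> ((1 / t) *\<^sub>R y) t = 0")
      case False
      note k = ray_kernel_preimage[OF L e False, folded \<sigma>_def]
      then show ?thesis by (simp add: D_def ennreal_leI)
    qed simp
  qed
  also have "\<dots> = ennreal D * ennreal (\<sigma> / L)"
    using \<sigma> L by (subst nn_integral_cmult_indicator) simp_all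
  also have "\<dots> = ennreal (D * (\<sigma> / L))"
    using \<sigma> L by (intro ennreal_mult[symmetric]) (simp_all add: D_def)
  also have "D * (\<sigma> / L) = 3 * 6 powr \<bar>a\<bar> * L powr (- (a + 1)) * bdist y powr a"
    using \<sigma> L by (simp add: D_def powr_diff)
  finally show ?thesis using True by simp
qed

text \<open>For fixed \<open>t\<close> substitute y = t z, with Jacobian t^(-2n) at most 4^n since t
  \<ge> 1 / 2, then integrate the kernel over \<open>t\<close>. As y lies further inside than z, the
  truncation at \<open>1 - \<epsilon>\<close> survives.\<close>

lemma ray_average:
  fixes H :: "complex ^ 'n \<Rightarrow> ennreal"
  assumes L: "L \<ge> 1" and e: "\<epsilon> > 0" and [measurable]: "H \<in> borel_measurable borel"
  shows "(\<integral>\<^sup>+z. \<integral>\<^sup>+t. ennreal (ray_kernel a L \<epsilon> z t) * H (t *\<^sub>R z) \<partial>lborel \<partial>lborel) \<le>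
    ennreal (4 ^ CARD('n) * (3 * 6 powr \<bar>a\<bar>) * L powr (- (a + 1))) *
      (\<integral>\<^sup>+y\<in>ball 0 (1 - \<epsilon>). ennreal (bdist y powr a) * H y \<partial>lborel)"
proof -
  have "(\<integral>\<^sup>+z. \<integral>\<^sup>+t. ennreal (ray_kernel a L \<epsilon> z t) * H (t *\<^sub>R z) \<partial>lborel \<partial>lborel) =
      (\<integral>\<^sup>+t. \<integral>\<^sup>+z. ennreal (ray_kernel a L \<epsilon> z t) * H (t *\<^sub>R z) \<partial>lborel \<partial>lborel)"
    by (rule lborel_pair.Fubini'[symmetric]) measurable
  also have "\<dots> \<le> (\<integral>\<^sup>+t. \<integral>\<^sup>+y. ennreal (4 ^ CARD('n)) * (ennreal (ray_kernel a L \<epsilon> ((1 / t) *\<^sub>R y) t) * H y) \<partial>lborel \<partial>lborel)"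
  proof (rule nn_integral_mono)
    fix t :: real
    show "(\<integral>\<^sup>+z. ennreal (ray_kernel a L \<epsilon> z t) * H (t *\<^sub>R z) \<partial>lborel) \<le>
      (\<integral>\<^sup>+y. ennreal (4 ^ CARD('n)) * (ennreal (ray_kernel a L \<epsilon> ((1 / t) *\<^sub>R y) t) * H y) \<partial>lborel)"
    proof (cases "1 / 2 \<le> t \<and> t \<le> 1")
      case True
      have "(\<integral>\<^sup>+z. ennreal (ray_kernel a L \<epsilon> z t) * H (t *\<^sub>R z) \<partial>lborel) =
          ennreal ((1 / t) ^ DIM(complex ^ 'n)) * (\<integral>\<^sup>+y. ennreal (ray_kernel a L \<epsilon> ((1 / t) *\<^sub>R y) t) * H (t *\<^sub>R ((1 / t) *\<^sub>R y)) \<partial>lborel)"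
        using True by (intro nn_integral_lborel_scale) auto
      also have "\<dots> \<le> ennreal (4 ^ CARD('n)) * (\<integral>\<^sup>+y. ennreal (ray_kernel a L \<epsilon> ((1 / t) *\<^sub>R y) t) * H y \<partial>lborel)"
      proof (intro mult_mono ennreal_leI)
        have "(1 / t) ^ DIM(complex ^ 'n) \<le> 2 ^ DIM(complex ^ 'n)"
          using True by (intro power_mono) (auto simp: field_simps)
        also have "(2::real) ^ DIM(complex ^ 'n) = 4 ^ CARD('n)"
          using power_mult[of "2::real" 2 "CARD('n)"] by (simp add: mult.commute)
        finally show "(1 / t) ^ DIM(complex ^ 'n) \<le> 4 ^ CARD('n)" .
      qed (use True in \<open>auto intro!: nn_integral_mono\<close>)
      also have "\<dots> = (\<integral>\<^sup>+y. ennreal (4 ^ CARD('n)) * (ennreal (ray_kernel a L \<epsilon> ((1 / t) *\<^sub>R y) t) * H y) \<partial>lborel)"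
        by (rule nn_integral_cmult[symmetric]) measurable
      finally show ?thesis .
    next
      case False
      then have "ray_kernel a L \<epsilon> z t = 0" for z :: "complex ^ 'n" using ray_kernel_supp[OF _ L e] by blast
      then show ?thesis by simp
    qed
  qed
  also have "\<dots> = (\<integral>\<^sup>+y. \<integral>\<^sup>+t. ennreal (4 ^ CARD('n)) * (ennreal (ray_kernel a L \<epsilon> ((1 / t) *\<^sub>R y) t) * H y) \<partial>lborel \<partial>lborel)"
    by (rule lborel_pair.Fubini') measurable
  also have "\<dots> \<le> (\<integral>\<^sup>+y. ennreal (4 ^ CARD('n) * (3 * 6 powr \<bar>a\<bar>) * L powr (- (a + 1))) *
      (ennreal (bdist y powr a) * H y * indicator (ball 0 (1 - \<epsilon>)) y) \<partial>lborel)"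
  proof (rule nn_integral_mono)
    fix y :: "complex ^ 'n"
    have "(\<integral>\<^sup>+t. ennreal (4 ^ CARD('n)) * (ennreal (ray_kernel a L \<epsilon> ((1 / t) *\<^sub>R y) t) * H y) \<partial>lborel) =
        ennreal (4 ^ CARD('n)) * ((\<integral>\<^sup>+t. ennreal (ray_kernel a L \<epsilon> ((1 / t) *\<^sub>R y) t) \<partial>lborel) * H y)"
      by (subst nn_integral_cmult, measurable, subst nn_integral_multc, measurable)
    also have "\<dots> \<le> ennreal (4 ^ CARD('n)) * ((ennreal (3 * 6 powr \<bar>a\<bar> * L powr (- (a + 1)) * bdist y powr a) * indicator (ball 0 (1 - \<epsilon>)) y) * H y)"
      by (intro mult_left_mono mult_right_mono integral_ray_kernel_preimage L e) auto
    also have "\<dots> = ennreal (4 ^ CARD('n) * (3 * 6 powr \<bar>a\<bar>) * L powr (- (a + 1))) *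
      (ennreal (bdist y powr a) * H y * indicator (ball 0 (1 - \<epsilon>)) y)"
      by (simp add: ennreal_mult mult_ac del: ennreal_power)
    finally show "(\<integral>\<^sup>+t. ennreal (4 ^ CARD('n)) * (ennreal (ray_kernel a L \<epsilon> ((1 / t) *\<^sub>R y) t) * H y) \<partial>lborel) \<le> \<dots>" .
  qed
  also have "\<dots> = ennreal (4 ^ CARD('n) * (3 * 6 powr \<bar>a\<bar>) * L powr (- (a + 1))) *
      (\<integral>\<^sup>+y\<in>ball 0 (1 - \<epsilon>). ennreal (bdist y powr a) * H y \<partial>lborel)"
    by (rule nn_integral_cmult) measurable
  finally show ?thesis .
qed

text \<open>The derivative of h(t z) in t is the radial derivative divided by t, which gives no
  bound near t = 0. On |t| = 1 the two have equal modulus, and the maximum principle carries the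
  bound into the disc.\<close>

lemma cmod_diff_center_le:
  fixes h :: "complex ^ 'n \<Rightarrow> complex"
  assumes h: "line_hol h" and z: "z \<in> ball 0 1"
    and M: "\<And>w. norm w = norm z \<Longrightarrow> cmod (radial_deriv h w) \<le> M"
  shows "cmod (h z - h 0) \<le> M"
proof -
  have inb: "t *s z \<in> ball 0 1" if "cmod t \<le> 1" for t
  proof -
    have "cmod t * norm z \<le> 1 * norm z" using that by (intro mult_right_mono) auto
    then show ?thesis using z by (simp add: norm_smult)
  qed
  have hol: "(\<lambda>t. dir_deriv z h (t *s z)) holomorphic_on cball 0 1"
    using line_hol_holomorphic[OF line_hol_dir_deriv[OF h], of z 0 z] inb
    by (auto intro: holomorphic_on_subset)
  have bd: "cmod (dir_deriv z h (t *s z)) \<le> M" if t: "t \<in> cball 0 1" for t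
  proof (rule maximum_modulus_frontier[of "\<lambda>t. dir_deriv z h (t *s z)" "cball 0 1"])
    show "(\<lambda>t. dir_deriv z h (t *s z)) holomorphic_on interior (cball 0 1)"
      by (rule holomorphic_on_subset[OF hol]) auto
    show "continuous_on (closure (cball 0 1)) (\<lambda>t. dir_deriv z h (t *s z))"
      using holomorphic_on_imp_continuous_on[OF hol] by simp
    fix x :: complex assume "x \<in> frontier (cball 0 1)"
    then have x: "cmod x = 1" by simp
    then have "radial_deriv h (x *s z) = x * dir_deriv z h (x *s z)"
      using radial_deriv_eq[OF h inb[of x]] dir_deriv_scale[OF h inb[of x], of x z] by simp
    then have "cmod (radial_deriv h (x *s z)) = cmod (dir_deriv z h (x *s z))"
      using x by (simp add: norm_mult)
    then show "cmod (dir_deriv z h (x *s z)) \<le> M" using M[of "x *s z"] x by (simp add: norm_smult)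
  qed (use t in auto)
  have "cmod (h (1 *s z) - h (0 *s z)) \<le> M * cmod (1 - 0)"
  proof (rule field_differentiable_bound[of "cball 0 1"])
    fix t :: complex assume t: "t \<in> cball 0 1"
    show "((\<lambda>t. h (t *s z)) has_field_derivative dir_deriv z h (t *s z)) (at t within cball 0 1)"
      using line_hol_derivative[OF h, of 0 t z] inb[of t] t by (simp add: has_field_derivative_at_within)
    show "cmod (dir_deriv z h (t *s z)) \<le> M" by (rule bd[OF t])
  qed auto
  then show ?thesis by simp
qed

text \<open>Serves the part of the ball where \<open>ray_kernel\<close> vanishes. On |z| \<le> R the
  weight is bounded above and below, so the maximum of the radial derivative there is bounded by its
  weighted integral for any exponent \<open>a\<close>.\<close>

lemma cmod_powr_le_center:
  fixes a p R :: real
  assumes p: "p > 0" and R: "R < 1"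
  shows "\<exists>C>0. \<forall>(h :: complex ^ 'n \<Rightarrow> complex) z. line_hol h \<longrightarrow> norm z \<le> R \<longrightarrow>
     ennreal (cmod (h z) powr p) \<le>
       ennreal C * (ennreal (cmod (h 0) powr p) + (\<integral>\<^sup>+u. hpow (radial_deriv h) a p u \<partial>lborel))"
proof -
  define m where "m = real (CARD('n) + 1)"
  \<comment> \<open>The exponent is raised by \<open>m\<close> beforehand, so that exactly
    \<open>a\<close> remains under the integral.\<close>
  have "\<exists>C1>0. \<forall>(h :: complex ^ 'n \<Rightarrow> complex) z w. line_hol h \<longrightarrow> z \<in> ball 0 1 \<longrightarrow> w \<in> hyp_ball 2 z \<longrightarrow>
     hpow h (a + m) p w \<le> ennreal C1 * hyp_int (288 * 2) z (hpow h (a + m - m) p)"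
    unfolding m_def by (rule hpow_le_integral[OF p])
  then obtain C1 where C1: "C1 > 0" "\<forall>(h :: complex ^ 'n \<Rightarrow> complex) z w. line_hol h \<longrightarrow> z \<in> ball 0 1 \<longrightarrow> w \<in> hyp_ball 2 z \<longrightarrow>
     hpow h (a + m) p w \<le> ennreal C1 * hyp_int (288 * 2) z (hpow h (a + m - m) p)"
    by (elim exE conjE)
  define L where "L = (1 / (1 - R\<^sup>2)) powr \<bar>a + m\<bar>"
  define C where "C = 2 powr p * (1 + L * C1)"
  have "ennreal (cmod (h z) powr p) \<le>
       ennreal C * (ennreal (cmod (h 0) powr p) + (\<integral>\<^sup>+u. hpow (radial_deriv h) a p u \<partial>lborel))"
    if h: "line_hol h" and z: "norm z \<le> R" for h :: "complex ^ 'n \<Rightarrow> complex" and z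
  proof -
    have hR: "line_hol (radial_deriv h)" by (rule line_hol_radial_deriv[OF h])
    have R0: "R \<ge> 0" using z norm_ge_zero order_trans by blast
    have R2: "R\<^sup>2 < 1" using R R0 by (simp add: abs_square_less_1)
    define J where "J = (\<integral>\<^sup>+u. hpow (radial_deriv h) a p u \<partial>lborel)"
    have "continuous_on (cball 0 R) (\<lambda>w. cmod (radial_deriv h w))"
      by (intro continuous_intros continuous_on_subset[OF line_hol_cont[OF hR]]) (use R in auto)
    then obtain w where w: "norm w \<le> R" "\<And>v. norm v \<le> R \<Longrightarrow> cmod (radial_deriv h v) \<le> cmod (radial_deriv h w)"
      using continuous_attains_sup[of "cball 0 R" "\<lambda>w. cmod (radial_deriv h w)"] R0 by auto
    have wb: "w \<in> ball 0 1" using w R by simp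
    have "cmod (h z - h 0) \<le> cmod (radial_deriv h w)"
      by (rule cmod_diff_center_le[OF h]) (use z R w(2) in auto)
    then have "cmod (h z) \<le> cmod (h 0) + cmod (radial_deriv h w)"
      using norm_triangle_sub[of "h z" "h 0"] by linarith
    then have "cmod (h z) powr p \<le> (cmod (h 0) + cmod (radial_deriv h w)) powr p"
      using p by (intro powr_mono2) auto
    also have "\<dots> \<le> 2 powr p * (cmod (h 0) powr p + cmod (radial_deriv h w) powr p)"
      using p by (intro powr_add_le) auto
    finally have "ennreal (cmod (h z) powr p) \<le> ennreal (2 powr p * (cmod (h 0) powr p + cmod (radial_deriv h w) powr p))"
      by (rule ennreal_leI)
    also have "\<dots> = ennreal (2 powr p) * (ennreal (cmod (h 0) powr p) + ennreal (cmod (radial_deriv h w) powr p))"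
      by (simp add: ennreal_mult)
    also have "ennreal (cmod (radial_deriv h w) powr p) \<le> ennreal (L * C1) * J"
    proof -
      have "(norm w)\<^sup>2 \<le> R\<^sup>2" using w by (intro power_mono) auto
      then have d: "1 - R\<^sup>2 \<le> bdist w" by (simp add: bdist_def)
      have "1 powr (a + m) \<le> L * bdist w powr (a + m)"
        unfolding L_def
      proof (rule powr_le_of_comparable)
        show "1 \<le> 1 / (1 - R\<^sup>2) * bdist w" using d R2 by (simp add: field_simps)
        have "bdist w \<le> 1" "1 \<le> 1 / (1 - R\<^sup>2)" using R2 by (simp_all add: bdist_le_1)
        then show "bdist w \<le> 1 / (1 - R\<^sup>2) * 1" by linarith
      qed (use R2 bdist_pos[OF wb] in auto)
      then have "cmod (radial_deriv h w) powr p \<le> L * (bdist w powr (a + m) * cmod (radial_deriv h w) powr p)"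
        using mult_right_mono[of 1 "L * bdist w powr (a + m)" "cmod (radial_deriv h w) powr p"] by simp
      then have "ennreal (cmod (radial_deriv h w) powr p) \<le> ennreal (L * (bdist w powr (a + m) * cmod (radial_deriv h w) powr p))"
        by (rule ennreal_leI)
      also have "\<dots> = ennreal L * hpow (radial_deriv h) (a + m) p w"
        unfolding hpow_eq[OF wb] by (rule ennreal_mult) (auto simp: L_def)
      also have "hpow (radial_deriv h) (a + m) p w \<le> ennreal C1 * hyp_int (288 * 2) w (hpow (radial_deriv h) (a + m - m) p)"
        using C1(2) hR wb center_in_hyp_ball[OF _ wb, of 2] by simp
      also have "hyp_int (288 * 2) w (hpow (radial_deriv h) (a + m - m) p) \<le> J"
        unfolding J_def by (rule nn_integral_mono) (auto simp: indicator_def)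
      finally show ?thesis using C1 by (simp add: L_def ennreal_mult mult.assoc mult_left_mono)
    qed
    also have "ennreal (2 powr p) * (ennreal (cmod (h 0) powr p) + ennreal (L * C1) * J) \<le>
        ennreal (2 powr p) * (ennreal (1 + L * C1) * ennreal (cmod (h 0) powr p) + ennreal (1 + L * C1) * J)"
    proof (intro mult_left_mono add_mono mult_right_mono)
      have "L \<ge> 0" by (simp add: L_def)
      then show "ennreal (L * C1) \<le> ennreal (1 + L * C1)" by (intro ennreal_leI) simp
      have "1 * ennreal (cmod (h 0) powr p) \<le> ennreal (1 + L * C1) * ennreal (cmod (h 0) powr p)"
        using \<open>L \<ge> 0\<close> C1 by (intro mult_right_mono) (simp_all flip: ennreal_1)
      then show "ennreal (cmod (h 0) powr p) \<le> ennreal (1 + L * C1) * ennreal (cmod (h 0) powr p)" by simp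
    qed auto
    also have "\<dots> = ennreal C * (ennreal (cmod (h 0) powr p) + J)"
    proof -
      have "ennreal C = ennreal (2 powr p) * ennreal (1 + L * C1)"
        unfolding C_def using C1 by (intro ennreal_mult) (auto simp: L_def)
      then show ?thesis by (simp only: distrib_left mult.assoc)
    qed
    finally show ?thesis by (simp add: J_def add_left_mono mult_left_mono)
  qed
  moreover have "C > 0" using C1 by (auto simp: C_def L_def intro!: mult_pos_pos add_pos_nonneg)
  ultimately show ?thesis by blast
qed

text \<open>Provides the finiteness without which a multiple of the integral could not be subtracted
  from both sides.\<close>

lemma integral_hpow_ball_finite:
  fixes h :: "complex ^ 'n \<Rightarrow> complex"
  assumes h: "line_hol h" and p: "p > 0" and e: "\<epsilon> > 0"
  shows "(\<integral>\<^sup>+z\<in>ball 0 (1 - \<epsilon>). hpow h a p z \<partial>lborel) < \<infinity>"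
proof -
  let ?S = "cball (0 :: complex ^ 'n) (1 - \<epsilon>)"
  have sub: "?S \<subseteq> ball 0 1" using e by auto
  have d: "bdist z \<noteq> 0" if "z \<in> ?S" for z using that sub bdist_pos by fastforce
  have "continuous_on ?S (\<lambda>z. bdist z powr a * cmod (h z) powr p)"
    by (intro continuous_on_mult continuous_on_powr continuous_on_powr' continuous_on_bdist continuous_on_norm
        continuous_on_const continuous_on_id continuous_on_subset[OF line_hol_cont[OF h] sub])
      (use d p in auto)
  then have "compact ((\<lambda>z. bdist z powr a * cmod (h z) powr p) ` ?S)"
    by (intro compact_continuous_image) auto
  then have "bounded ((\<lambda>z. bdist z powr a * cmod (h z) powr p) ` ?S)" by (rule compact_imp_bounded)
  then obtain B where B: "\<And>z. z \<in> ?S \<Longrightarrow> bdist z powr a * cmod (h z) powr p \<le> B"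
    unfolding bounded_iff by (force simp: abs_le_iff)
  have "(\<integral>\<^sup>+z\<in>ball 0 (1 - \<epsilon>). hpow h a p z \<partial>lborel) \<le>
      (\<integral>\<^sup>+z. ennreal B * indicator (ball (0 :: complex ^ 'n) (1 - \<epsilon>)) z \<partial>lborel)"
  proof (rule nn_integral_mono)
    fix z :: "complex ^ 'n"
    show "hpow h a p z * indicator (ball 0 (1 - \<epsilon>)) z \<le> ennreal B * indicator (ball 0 (1 - \<epsilon>)) z"
    proof (cases "z \<in> ball 0 (1 - \<epsilon>)")
      case True
      then have z: "z \<in> ?S" by auto
      then have "z \<in> ball 0 1" using sub by blast
      then show ?thesis using True B[OF z] by (simp add: hpow_eq ennreal_leI)
    qed simp
  qed
  also have "\<dots> < \<infinity>"
    using emeasure_lborel_ball_finite[of "0 :: complex ^ 'n" "1 - \<epsilon>"]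
    by (subst nn_integral_cmult_indicator) (auto simp: ennreal_mult_less_top)
  finally show ?thesis .
qed

lemma nn_integral_ball_le_SUP:
  fixes F :: "complex ^ 'n \<Rightarrow> ennreal"
  assumes [measurable]: "F \<in> borel_measurable borel"
    and X: "\<And>\<epsilon>. \<epsilon> > 0 \<Longrightarrow> (\<integral>\<^sup>+z\<in>ball 0 (1 - \<epsilon>). F z \<partial>lborel) \<le> X"
  shows "(\<integral>\<^sup>+z\<in>ball 0 1. F z \<partial>lborel) \<le> X"
proof -
  define f where "f k z = F z * indicator (ball 0 (1 - 1 / real (Suc k))) z" for k and z :: "complex ^ 'n"
  have "(\<integral>\<^sup>+z\<in>ball 0 1. F z \<partial>lborel) \<le> (\<integral>\<^sup>+z. (SUP k. f k z) \<partial>lborel)"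
  proof (rule nn_integral_mono)
    fix z :: "complex ^ 'n"
    show "F z * indicator (ball 0 1) z \<le> (SUP k. f k z)"
    proof (cases "z \<in> ball 0 1")
      case True
      then obtain k where "inverse (real (Suc k)) < 1 - norm z"
        using reals_Archimedean[of "1 - norm z"] by auto
      then have "F z * indicator (ball 0 1) z = f k z"
        using True by (simp add: f_def field_simps)
      also have "\<dots> \<le> (SUP k. f k z)" by (rule SUP_upper) simp
      finally show ?thesis .
    qed simp
  qed
  also have "\<dots> = (SUP k. \<integral>\<^sup>+z. f k z \<partial>lborel)"
  proof (rule nn_integral_monotone_convergence_SUP)
    show "incseq f"
    proof (intro incseq_SucI le_funI)
      fix k :: nat and z :: "complex ^ 'n"
      have "1 - 1 / real (Suc k) \<le> 1 - 1 / real (Suc (Suc k))" by (simp add: field_simps)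
      then have "ball (0 :: complex ^ 'n) (1 - 1 / real (Suc k)) \<subseteq> ball 0 (1 - 1 / real (Suc (Suc k)))"
        by (rule subset_ball)
      then show "f k z \<le> f (Suc k) z" unfolding f_def by (intro mult_left_mono) (auto simp: indicator_def)
    qed
    show "f k \<in> borel_measurable lborel" for k unfolding f_def by measurable
  qed
  also have "\<dots> \<le> X" by (rule SUP_least) (use X in \<open>simp add: f_def\<close>)
  finally show ?thesis .
qed

text \<open>Points with norm at most \<open>R\<close> are compared with the origin, the others with
  inner points on their rays; \<open>R\<close> is the threshold built into
  \<open>ray_kernel\<close>.\<close>

lemma integral_hpow_le_radial_deriv:
  fixes a p :: real
  assumes p: "p > 0" and a: "a > -1"
  shows "\<exists>C>0. \<forall>h :: complex ^ 'n \<Rightarrow> complex. line_hol h \<longrightarrow>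
     (\<integral>\<^sup>+z. hpow h a p z \<partial>lborel) \<le>
       ennreal C * (ennreal (cmod (h 0) powr p) + (\<integral>\<^sup>+z. hpow (radial_deriv h) (a + p) p z \<partial>lborel))"
proof -
  define m where "m = real (CARD('n) + 1)"
  define c0 where "c0 = 2 powr p * (4 ^ CARD('n) * (3 * 6 powr \<bar>a\<bar>))"
  have c0: "c0 > 0" by (simp add: c0_def)
  \<comment> \<open>Chosen so that the constant of \<open>ray_average\<close>, times the 2^p of
    \<open>hpow_le_ray\<close>, is at most 1 / 2. This is possible because \<open>a + 1\<close> is
    positive.\<close>
  define L where "L = max 1 ((2 * c0) powr (1 / (a + 1)))"
  have L: "L \<ge> 1" by (simp add: L_def)
  have "2 * c0 = ((2 * c0) powr (1 / (a + 1))) powr (a + 1)" using a c0 by (simp add: powr_powr)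
  also have "\<dots> \<le> L powr (a + 1)" using a by (intro powr_mono2) (auto simp: L_def)
  finally have cL: "c0 * L powr (- (a + 1)) \<le> 1 / 2"
    using L by (simp add: powr_minus field_simps del: minus_add_distrib)
  \<comment> \<open>The kernel admits \<open>1 - t\<close> up to twice
    \<open>L * (1 - norm z)\<close>, hence \<open>2 * L\<close>.\<close>
  have "\<exists>C1>0. \<forall>(h :: complex ^ 'n \<Rightarrow> complex) z t. line_hol h \<longrightarrow> z \<in> ball 0 1 \<longrightarrow> 1 / 2 \<le> t \<longrightarrow> t \<le> 1 \<longrightarrow>
     1 - t \<le> (2 * L) * (1 - norm z) \<longrightarrow>
     hpow h a p z \<le> ennreal (2 powr p) * ennreal (bdist z powr a * cmod (h (t *\<^sub>R z)) powr p) +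
       ennreal C1 * hyp_int (288 * (2 + 2 * L)\<^sup>2) z (hpow (radial_deriv h) (a + p - m) p)"
    unfolding m_def by (rule hpow_le_ray[OF p]) (use L in simp)
  then obtain C1 where C1: "C1 > 0" "\<forall>(h :: complex ^ 'n \<Rightarrow> complex) z t. line_hol h \<longrightarrow> z \<in> ball 0 1 \<longrightarrow> 1 / 2 \<le> t \<longrightarrow> t \<le> 1 \<longrightarrow>
     1 - t \<le> (2 * L) * (1 - norm z) \<longrightarrow>
     hpow h a p z \<le> ennreal (2 powr p) * ennreal (bdist z powr a * cmod (h (t *\<^sub>R z)) powr p) +
       ennreal C1 * hyp_int (288 * (2 + 2 * L)\<^sup>2) z (hpow (radial_deriv h) (a + p - m) p)"
    by (elim exE conjE)
  have "\<exists>C3>0. \<forall>h :: complex ^ 'n \<Rightarrow> complex. line_hol h \<longrightarrow>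
     (\<integral>\<^sup>+z\<in>ball 0 1. ennreal (bdist z powr 0) * hyp_int (288 * (2 + 2 * L)\<^sup>2) z (hpow h (a + p - m) p) \<partial>lborel) \<le>
     ennreal C3 * (\<integral>\<^sup>+u. hpow h (a + p + 0) p u \<partial>lborel)"
    unfolding m_def by (rule integral_hpow_hyp_ball)
  then obtain C3 where C3: "C3 > 0" "\<forall>h :: complex ^ 'n \<Rightarrow> complex. line_hol h \<longrightarrow>
     (\<integral>\<^sup>+z\<in>ball 0 1. ennreal (bdist z powr 0) * hyp_int (288 * (2 + 2 * L)\<^sup>2) z (hpow h (a + p - m) p) \<partial>lborel) \<le>
     ennreal C3 * (\<integral>\<^sup>+u. hpow h (a + p + 0) p u \<partial>lborel)"
    by (elim exE conjE)
  define R where "R = 1 - 1 / (4 * L)"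
  have R: "R < 1" using L by (simp add: R_def)
  obtain C2 where C2: "C2 > 0" "\<And>(h :: complex ^ 'n \<Rightarrow> complex) z. line_hol h \<Longrightarrow> norm z \<le> R \<Longrightarrow>
     ennreal (cmod (h z) powr p) \<le>
       ennreal C2 * (ennreal (cmod (h 0) powr p) + (\<integral>\<^sup>+u. hpow (radial_deriv h) (a + p) p u \<partial>lborel))"
    using cmod_powr_le_center[OF p R, of "a + p"] by blast
  \<comment> \<open>For the constant function 1, \<open>hpow\<close> is the weight itself, so
    \<open>V\<close> is the weighted mass of a ball. Its radius \<open>1 - 1 / (8 * L)\<close>
    exceeds \<open>R\<close>, so this open ball contains the closed one of radius
    \<open>R\<close>.\<close>
  have "line_hol (\<lambda>z :: complex ^ 'n. 1)" by (simp add: line_hol_def)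
  then have "(\<integral>\<^sup>+z\<in>ball 0 (1 - 1 / (8 * L)). hpow (\<lambda>z :: complex ^ 'n. 1) a p z \<partial>lborel) < \<infinity>"
    by (rule integral_hpow_ball_finite[OF _ p]) (use L in simp)
  then obtain V where V: "V \<ge> 0" "(\<integral>\<^sup>+z\<in>ball 0 (1 - 1 / (8 * L)). hpow (\<lambda>z :: complex ^ 'n. 1) a p z \<partial>lborel) = ennreal V"
    by (cases "\<integral>\<^sup>+z\<in>ball 0 (1 - 1 / (8 * L)). hpow (\<lambda>z :: complex ^ 'n. 1) a p z \<partial>lborel") auto
  define C where "C = 2 * (V * C2 + C1 * C3)"
  have C: "C > 0" using V C1 C2 C3 by (simp add: C_def add_nonneg_pos)
  have "(\<integral>\<^sup>+z. hpow h a p z \<partial>lborel) \<le>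
       ennreal C * (ennreal (cmod (h 0) powr p) + (\<integral>\<^sup>+z. hpow (radial_deriv h) (a + p) p z \<partial>lborel))"
    if h: "line_hol h" for h :: "complex ^ 'n \<Rightarrow> complex"
  proof -
    note [measurable] = hpow_borel[OF h]
    have hR: "line_hol (radial_deriv h)" by (rule line_hol_radial_deriv[OF h])
    define J where "J = (\<integral>\<^sup>+z. hpow (radial_deriv h) (a + p) p z \<partial>lborel)"
    define X where "X = ennreal (cmod (h 0) powr p) + J"
    define G where "G z = hyp_int (288 * (2 + 2 * L)\<^sup>2) z (hpow (radial_deriv h) (a + p - m) p)" for z
    have [measurable]: "G \<in> borel_measurable borel"
      unfolding G_def by (rule borel_measurable_integral_hyp_ball[OF hpow_borel[OF hR]])
    have GJ: "(\<integral>\<^sup>+z\<in>ball 0 1. G z \<partial>lborel) \<le> ennreal C3 * J"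
    proof -
      have "(\<integral>\<^sup>+z\<in>ball 0 1. G z \<partial>lborel) = (\<integral>\<^sup>+z\<in>ball 0 1. ennreal (bdist z powr 0) * G z \<partial>lborel)"
      proof (rule nn_integral_cong)
        fix z :: "complex ^ 'n"
        show "G z * indicator (ball 0 1) z = ennreal (bdist z powr 0) * G z * indicator (ball 0 1) z"
          using bdist_pos[of z] by (cases "z \<in> ball 0 1") auto
      qed
      also have "\<dots> \<le> ennreal C3 * (\<integral>\<^sup>+u. hpow (radial_deriv h) (a + p + 0) p u \<partial>lborel)"
        unfolding G_def by (rule C3(2)[rule_format, OF hR])
      finally show ?thesis by (simp add: J_def)
    qed
    define H where "H x = ennreal (cmod (indicator (ball 0 1) x *\<^sub>R h x) powr p)" for x
    have [measurable]: "H \<in> borel_measurable borel" unfolding H_def using h by measurable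
    have "(\<integral>\<^sup>+z\<in>ball 0 (1 - \<epsilon>). hpow h a p z \<partial>lborel) \<le> ennreal C * X" if e: "\<epsilon> > 0" for \<epsilon>
    proof -
      define I where "I = (\<integral>\<^sup>+z\<in>ball 0 (1 - \<epsilon>). hpow h a p z \<partial>lborel)"
      let ?k = "ray_kernel a L \<epsilon> :: complex ^ 'n \<Rightarrow> real \<Rightarrow> real"
      have pointwise: "hpow h a p z * indicator (ball 0 (1 - \<epsilon>)) z \<le>
          ennreal C2 * X * (hpow (\<lambda>z. 1) a p z * indicator (ball 0 (1 - 1 / (8 * L))) z) +
          (ennreal (2 powr p) * (\<integral>\<^sup>+t. ennreal (?k z t) * H (t *\<^sub>R z) \<partial>lborel) + ennreal C1 * (G z * indicator (ball 0 1) z))"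
        for z :: "complex ^ 'n"
      proof (cases "norm z < 1 - \<epsilon>")
        case z: True
        then have zb: "z \<in> ball 0 1" using e by simp
        show ?thesis
        proof (cases "norm z \<le> R")
          case True
          have "1 / (8 * L) < 1 / (4 * L)" using L by (simp add: field_simps)
          then have "norm z < 1 - 1 / (8 * L)" using True unfolding R_def by linarith
          then have ind: "indicator (ball 0 (1 - 1 / (8 * L))) z = (1 :: ennreal)" by simp
          have "hpow h a p z = ennreal (bdist z powr a) * ennreal (cmod (h z) powr p)"
            unfolding hpow_eq[OF zb] by (rule ennreal_mult) auto
          also have "\<dots> \<le> ennreal (bdist z powr a) * (ennreal C2 * X)"
            unfolding X_def J_def by (intro mult_left_mono C2(2)[OF h True]) simp
          also have "\<dots> = ennreal C2 * X * (hpow (\<lambda>z. 1) a p z * indicator (ball 0 (1 - 1 / (8 * L))) z)"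
            unfolding ind hpow_eq[OF zb] by (simp add: mult_ac)
          finally show ?thesis using z by (intro add_increasing2) auto
        next
          case False
          define s where "s = 1 - norm z"
          have s: "s > 0" "L * s > 0" using zb L by (auto simp: s_def)
          have kz: "?k z t = indicator {1 - 2 * L * s..1 - L * s} t * (bdist z powr a / (L * s))" for t
            using z False unfolding ray_kernel_def R_def[symmetric] s_def[symmetric]
            by (auto simp: indicator_def)
          \<comment> \<open>The interval has length \<open>L * s\<close>, so this is a probability
            density in \<open>t\<close>; times the weight \<open>bdist z powr a\<close> it is the
            kernel.\<close>
          have one: "(\<integral>\<^sup>+t. ennreal (1 / (L * s)) * indicator {1 - 2 * L * s..1 - L * s} t \<partial>lborel) = 1"
            using s L by (subst nn_integral_cmult_indicator) (simp_all flip: ennreal_mult)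
          have "hpow h a p z = (\<integral>\<^sup>+t. ennreal (1 / (L * s)) * indicator {1 - 2 * L * s..1 - L * s} t \<partial>lborel) * hpow h a p z"
            unfolding one by simp
          also have "\<dots> = (\<integral>\<^sup>+t. ennreal (1 / (L * s)) * indicator {1 - 2 * L * s..1 - L * s} t * hpow h a p z \<partial>lborel)"
            by (rule nn_integral_multc[symmetric]) measurable
          also have "\<dots> \<le> (\<integral>\<^sup>+t. ennreal (2 powr p) * (ennreal (?k z t) * H (t *\<^sub>R z)) +
              ennreal (1 / (L * s)) * indicator {1 - 2 * L * s..1 - L * s} t * (ennreal C1 * G z) \<partial>lborel)"
          proof (rule nn_integral_mono)
            fix t :: real
            show "ennreal (1 / (L * s)) * indicator {1 - 2 * L * s..1 - L * s} t * hpow h a p z \<le>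
              ennreal (2 powr p) * (ennreal (?k z t) * H (t *\<^sub>R z)) +
              ennreal (1 / (L * s)) * indicator {1 - 2 * L * s..1 - L * s} t * (ennreal C1 * G z)"
            proof (cases "t \<in> {1 - 2 * L * s..1 - L * s}")
              case True
              have "?k z t \<noteq> 0" using True s L bdist_pos[OF zb] by (simp add: kz)
              note supp = ray_kernel_supp[OF this L e]
              have "t * norm z \<le> 1 * norm z" using supp by (intro mult_right_mono) auto
              then have tz: "t *\<^sub>R z \<in> ball 0 1" using zb supp by simp
              have "hpow h a p z \<le> ennreal (2 powr p) * ennreal (bdist z powr a * cmod (h (t *\<^sub>R z)) powr p) + ennreal C1 * G z"
                unfolding G_def using C1(2) h zb supp by simp
              also have "ennreal (bdist z powr a * cmod (h (t *\<^sub>R z)) powr p) = ennreal (bdist z powr a) * H (t *\<^sub>R z)"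
                using tz by (simp add: H_def ennreal_mult)
              finally have "ennreal (1 / (L * s)) * hpow h a p z \<le>
                  ennreal (1 / (L * s)) * (ennreal (2 powr p) * (ennreal (bdist z powr a) * H (t *\<^sub>R z)) + ennreal C1 * G z)"
                by (rule mult_left_mono) simp
              also have "\<dots> = ennreal (2 powr p) * ((ennreal (1 / (L * s)) * ennreal (bdist z powr a)) * H (t *\<^sub>R z)) +
                  ennreal (1 / (L * s)) * (ennreal C1 * G z)"
                by (simp only: distrib_left mult_ac)
              also have "ennreal (1 / (L * s)) * ennreal (bdist z powr a) = ennreal (?k z t)"
                using True s L by (simp add: kz flip: ennreal_mult)
              finally show ?thesis using True by simp
            qed simp
          qed
          also have "\<dots> = ennreal (2 powr p) * (\<integral>\<^sup>+t. ennreal (?k z t) * H (t *\<^sub>R z) \<partial>lborel) + 1 * (ennreal C1 * G z)"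
            unfolding one[symmetric]
            by (subst nn_integral_add, measurable, subst nn_integral_cmult, measurable, subst nn_integral_multc, measurable)
          finally have "hpow h a p z \<le> ennreal (2 powr p) * (\<integral>\<^sup>+t. ennreal (?k z t) * H (t *\<^sub>R z) \<partial>lborel) + ennreal C1 * G z"
            by simp
          then have "hpow h a p z * 1 \<le> ennreal C2 * X * (hpow (\<lambda>z. 1) a p z * indicator (ball 0 (1 - 1 / (8 * L))) z) +
              (ennreal (2 powr p) * (\<integral>\<^sup>+t. ennreal (?k z t) * H (t *\<^sub>R z) \<partial>lborel) + ennreal C1 * (G z * 1))"
            by (subst (1 2) mult_1_right) (rule add_increasing, rule zero_le)
          moreover have "indicator (ball 0 (1 - \<epsilon>)) z = (1 :: ennreal)" "indicator (ball 0 1) z = (1 :: ennreal)"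
            using z zb by auto
          ultimately show ?thesis by (simp only:)
        qed
      qed simp
      have "I \<le> (\<integral>\<^sup>+z. ennreal C2 * X * (hpow (\<lambda>z. 1) a p z * indicator (ball 0 (1 - 1 / (8 * L))) z) +
          (ennreal (2 powr p) * (\<integral>\<^sup>+t. ennreal (?k z t) * H (t *\<^sub>R z) \<partial>lborel) + ennreal C1 * (G z * indicator (ball 0 1) z)) \<partial>lborel)"
        unfolding I_def by (rule nn_integral_mono) (rule pointwise)
      also have "\<dots> = ennreal C2 * X * ennreal V +
          (ennreal (2 powr p) * (\<integral>\<^sup>+z. \<integral>\<^sup>+t. ennreal (?k z t) * H (t *\<^sub>R z) \<partial>lborel \<partial>lborel) + ennreal C1 * (\<integral>\<^sup>+z\<in>ball 0 1. G z \<partial>lborel))"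
      proof -
        note [measurable] = hpow_borel[OF \<open>line_hol (\<lambda>z :: complex ^ 'n. 1)\<close>]
        show ?thesis
          unfolding V(2)[symmetric]
          by (subst nn_integral_add, measurable, subst nn_integral_cmult, measurable, subst nn_integral_add, measurable,
              subst nn_integral_cmult, measurable, subst nn_integral_cmult, measurable)
      qed
      also have "\<dots> \<le> ennreal C2 * X * ennreal V + (ennreal (1 / 2) * I + ennreal C1 * (ennreal C3 * J))"
      proof (intro add_mono mult_left_mono GJ order_refl)
        have "ennreal (2 powr p) * (\<integral>\<^sup>+z. \<integral>\<^sup>+t. ennreal (?k z t) * H (t *\<^sub>R z) \<partial>lborel \<partial>lborel) \<le>
            ennreal (2 powr p) * (ennreal (4 ^ CARD('n) * (3 * 6 powr \<bar>a\<bar>) * L powr (- (a + 1))) *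
              (\<integral>\<^sup>+y\<in>ball 0 (1 - \<epsilon>). ennreal (bdist y powr a) * H y \<partial>lborel))"
          by (intro mult_left_mono ray_average L e) auto
        \<comment> \<open>The truncated integral of \<open>h\<close> itself reappears on the right,
          now with a factor at most 1 / 2.\<close>
        also have "(\<integral>\<^sup>+y\<in>ball 0 (1 - \<epsilon>). ennreal (bdist y powr a) * H y \<partial>lborel) = I"
          unfolding I_def
        proof (rule nn_integral_cong)
          fix y :: "complex ^ 'n"
          show "ennreal (bdist y powr a) * H y * indicator (ball 0 (1 - \<epsilon>)) y = hpow h a p y * indicator (ball 0 (1 - \<epsilon>)) y"
          proof (cases "y \<in> ball 0 (1 - \<epsilon>)")
            case True
            then have "y \<in> ball 0 1" using e by simp
            then show ?thesis by (simp add: H_def hpow_def ennreal_mult)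
          qed simp
        qed
        also have "ennreal (2 powr p) * (ennreal (4 ^ CARD('n) * (3 * 6 powr \<bar>a\<bar>) * L powr (- (a + 1))) * I) =
            ennreal (c0 * L powr (- (a + 1))) * I"
          by (simp add: c0_def ennreal_mult mult_ac del: ennreal_power)
        also have "\<dots> \<le> ennreal (1 / 2) * I" by (intro mult_right_mono ennreal_leI cL) simp
        finally show "ennreal (2 powr p) * (\<integral>\<^sup>+z. \<integral>\<^sup>+t. ennreal (?k z t) * H (t *\<^sub>R z) \<partial>lborel \<partial>lborel) \<le> ennreal (1 / 2) * I" .
      qed simp_all
      also have "\<dots> \<le> ennreal (1 / 2) * I + ennreal (V * C2 + C1 * C3) * X"
      proof -
        have "J \<le> X" by (simp add: X_def)
        then have "ennreal C1 * (ennreal C3 * J) \<le> ennreal C1 * (ennreal C3 * X)" by (intro mult_left_mono) auto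
        moreover have "ennreal (V * C2 + C1 * C3) * X = ennreal C2 * X * ennreal V + ennreal C1 * (ennreal C3 * X)"
        proof -
          have "ennreal (V * C2 + C1 * C3) = ennreal V * ennreal C2 + ennreal C1 * ennreal C3"
            using V(1) C1(1) C2(1) C3(1) by (simp add: ennreal_plus ennreal_mult)
          then show ?thesis by (simp only: distrib_left distrib_right mult_ac)
        qed
        ultimately show ?thesis by (simp add: add.left_commute add_left_mono)
      qed
      finally have main: "I \<le> ennreal (1 / 2) * I + ennreal (V * C2 + C1 * C3) * X" .
      \<comment> \<open>Finiteness allows half of \<open>I\<close> to be absorbed, which doubles the
        constant to \<open>C\<close>; the bound is free of \<open>\<epsilon>\<close>.\<close>
      have "I < \<infinity>" unfolding I_def by (rule integral_hpow_ball_finite[OF h p e])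
      then obtain i where i: "I = ennreal i" "i \<ge> 0" by (cases I) auto
      show ?thesis
      proof (cases X)
        case (real x)
        have eq: "ennreal (1 / 2) * I + ennreal (V * C2 + C1 * C3) * X = ennreal (1 / 2 * i + (V * C2 + C1 * C3) * x)"
        proof -
          have "0 \<le> V * C2 + C1 * C3" using V(1) C1(1) C2(1) C3(1) by simp
          then show ?thesis
            unfolding i(1) real(2) using i(2) real(1) by (simp only: ennreal_mult[symmetric] ennreal_plus[symmetric] mult_nonneg_nonneg)
        qed
        have "ennreal i \<le> ennreal (1 / 2 * i + (V * C2 + C1 * C3) * x)"
          using main eq i(1) by metis
        then have "i \<le> 1 / 2 * i + (V * C2 + C1 * C3) * x"
          using i real V C1 C2 C3 by (subst (asm) ennreal_le_iff) auto
        then have "i \<le> C * x" by (simp add: C_def algebra_simps)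
        then show ?thesis using C real i unfolding I_def[symmetric]
          by (simp add: ennreal_leI flip: ennreal_mult)
      qed (use C in \<open>simp add: ennreal_mult_top\<close>)
    qed
    then have "(\<integral>\<^sup>+z\<in>ball 0 1. hpow h a p z \<partial>lborel) \<le> ennreal C * X"
      by (intro nn_integral_ball_le_SUP) auto
    moreover have "(\<integral>\<^sup>+z\<in>ball 0 1. hpow h a p z \<partial>lborel) = (\<integral>\<^sup>+z. hpow h a p z \<partial>lborel)"
      by (intro nn_integral_cong) (auto simp: hpow_def indicator_def)
    ultimately show ?thesis by (simp add: X_def J_def)
  qed
  with C show ?thesis by blast
qed

section \<open>Area and maximal functions\<close>

lemma epowr_ennreal: "x \<ge> 0 \<Longrightarrow> epowr (ennreal x) p = ennreal (x powr p)"
  by (simp add: epowr_def)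

lemma epowr_top: "epowr top p = top"
  by (simp add: epowr_def)

lemma epowr_mono: "p > 0 \<Longrightarrow> x \<le> y \<Longrightarrow> epowr x p \<le> epowr y p"
  by (cases x; cases y) (auto simp: epowr_ennreal epowr_top top_unique intro!: ennreal_leI powr_mono2)

lemma epowr_one: "epowr x 1 = x"
  by (cases x) (auto simp: epowr_ennreal epowr_top)

lemma epowr_epowr: "epowr (epowr x p) q = epowr x (p * q)"
  by (cases x) (auto simp: epowr_ennreal epowr_top powr_powr)

lemma epowr_cmult: "c > 0 \<Longrightarrow> epowr (ennreal c * x) p = ennreal (c powr p) * epowr x p"
  by (cases x) (auto simp: epowr_ennreal epowr_top powr_mult ennreal_mult_top simp flip: ennreal_mult)

lemma epowr_add_le:
  assumes "p > 0"
  shows "epowr (x + y) p \<le> ennreal (2 powr p) * (epowr x p + epowr y p)"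
proof (cases "x = top \<or> y = top")
  case True
  then show ?thesis by (auto simp: epowr_top ennreal_mult_top)
next
  case False
  then obtain a b where "x = ennreal a" "a \<ge> 0" "y = ennreal b" "b \<ge> 0"
    by (cases x; cases y) auto
  then show ?thesis using powr_add_le[of a b p] assms
    by (simp add: epowr_ennreal ennreal_leI flip: ennreal_plus ennreal_mult)
qed

lemma epowr_borel [measurable]:
  assumes [measurable]: "f \<in> borel_measurable M"
  shows "(\<lambda>x. epowr (f x) p) \<in> borel_measurable M"
  unfolding epowr_def by measurable

text \<open>Passes between the exponents q and p: both sides are powers of the same quantity d^k
  |h|.\<close>

lemma epowr_hpow:
  assumes "z \<in> ball 0 1" "q > 0"
  shows "epowr (hpow h (k * q) q z) (p / q) = hpow h (k * p) p z"
  using assms by (simp add: hpow_eq epowr_ennreal powr_mult powr_powr)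

section \<open>The measures on the ball as weighted Lebesgue measures\<close>

lemma space_ball_measure [simp]: "space ball_measure = ball 0 1"
  by (simp add: ball_measure_def space_restrict_space)

lemma sets_ball_measure: "sets ball_measure = sets (restrict_space borel (ball 0 1))"
  unfolding ball_measure_def by (intro sets_restrict_space_cong) simp

lemma nn_integral_ball_measure:
  fixes F :: "complex ^ 'n \<Rightarrow> ennreal"
  assumes F: "F \<in> borel_measurable (restrict_space borel (ball 0 1))"
  shows "(\<integral>\<^sup>+z. F z \<partial>ball_measure) = ennreal (1 / unit_vol TYPE('n)) * (\<integral>\<^sup>+z\<in>ball 0 1. F z \<partial>lborel)"
proof -
  let ?b = "ball 0 1 :: (complex ^ 'n) set"
  have [measurable]: "(\<lambda>z. F z * indicator ?b z) \<in> borel_measurable borel"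
    using F by (subst (asm) borel_measurable_restrict_space_iff_ennreal) auto
  have "(\<integral>\<^sup>+z. F z \<partial>ball_measure) = (\<integral>\<^sup>+z. F z * indicator ?b z \<partial>uniform_measure lborel ?b)"
    unfolding ball_measure_def by (rule nn_integral_restrict_space) simp
  also have "\<dots> = (\<integral>\<^sup>+z. F z * indicator ?b z * indicator ?b z \<partial>lborel) / emeasure lborel ?b"
    by (rule nn_integral_uniform_measure) measurable
  also have "(\<integral>\<^sup>+z. F z * indicator ?b z * indicator ?b z \<partial>lborel) = (\<integral>\<^sup>+z\<in>?b. F z \<partial>lborel)"
    by (intro nn_integral_cong) (auto simp: indicator_def)
  also have "\<dots> / emeasure lborel ?b = ennreal (1 / unit_vol TYPE('n)) * \<dots>"
    by (simp add: emeasure_ball_vec divide_ennreal_def inverse_ennreal mult.commute divide_inverse)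
  finally show ?thesis .
qed

lemma nn_integral_density_ball_measure:
  fixes F :: "complex ^ 'n \<Rightarrow> ennreal"
  assumes F: "F \<in> borel_measurable (restrict_space borel (ball 0 1))" and c: "c > 0"
  shows "(\<integral>\<^sup>+z. F z \<partial>density ball_measure (\<lambda>z. ennreal (c * (1 - (norm z)\<^sup>2) powr b))) =
    ennreal (c / unit_vol TYPE('n)) * (\<integral>\<^sup>+z\<in>ball 0 1. ennreal (bdist z powr b) * F z \<partial>lborel)"
proof -
  have [measurable]: "(\<lambda>z :: complex ^ 'n. bdist z powr b) \<in> borel_measurable (restrict_space borel (ball 0 1))"
    by (intro measurable_restrict_space1) measurable
  note F [measurable]
  have [measurable]: "F \<in> borel_measurable ball_measure"
    "(\<lambda>z :: complex ^ 'n. bdist z powr b) \<in> borel_measurable ball_measure"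
    using F by (simp_all cong: measurable_cong_sets add: measurable_cong_sets[OF sets_ball_measure refl])
  have "(\<integral>\<^sup>+z. F z \<partial>density ball_measure (\<lambda>z. ennreal (c * (1 - (norm z)\<^sup>2) powr b))) =
      (\<integral>\<^sup>+z. ennreal (c * bdist z powr b) * F z \<partial>ball_measure)"
    unfolding bdist_def[symmetric] by (rule nn_integral_density) measurable
  also have "\<dots> = ennreal (1 / unit_vol TYPE('n)) * (\<integral>\<^sup>+z\<in>ball 0 1. ennreal (c * bdist z powr b) * F z \<partial>lborel)"
    by (rule nn_integral_ball_measure) measurable
  also have "(\<integral>\<^sup>+z\<in>ball 0 1. ennreal (c * bdist z powr b) * F z \<partial>lborel) =
      (\<integral>\<^sup>+z. ennreal c * (ennreal (bdist z powr b) * F z * indicator (ball 0 1) z) \<partial>lborel)"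
    using c by (intro nn_integral_cong) (simp add: ennreal_mult mult_ac)
  also have "\<dots> = ennreal c * (\<integral>\<^sup>+z\<in>ball 0 1. ennreal (bdist z powr b) * F z \<partial>lborel)"
  proof (rule nn_integral_cmult)
    have "(\<lambda>z. ennreal (bdist z powr b) * F z) \<in> borel_measurable (restrict_space borel (ball 0 1))"
      by measurable
    then show "(\<lambda>z. ennreal (bdist z powr b) * F z * indicator (ball 0 1) z) \<in> borel_measurable lborel"
      by (subst (asm) borel_measurable_restrict_space_iff_ennreal) auto
  qed
  finally show ?thesis using c by (simp add: mult.assoc[symmetric] flip: ennreal_mult)
qed

lemma weight_const_pos: "weight_const n \<alpha> > 0"
  by (auto simp: weight_const_def intro!: divide_pos_pos mult_pos_pos Gamma_real_pos)

definition weight_factor :: "'n::finite itself \<Rightarrow> real \<Rightarrow> real" where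
  "weight_factor _ \<alpha> = weight_const CARD('n) \<alpha> / unit_vol TYPE('n)"

lemma weight_factor_pos: "weight_factor TYPE('n::finite) \<alpha> > 0"
  by (simp add: weight_factor_def weight_const_pos)

lemma nn_integral_weighted_measure:
  fixes F :: "complex ^ 'n \<Rightarrow> ennreal"
  assumes "F \<in> borel_measurable (restrict_space borel (ball 0 1))"
  shows "(\<integral>\<^sup>+z. F z \<partial>weighted_measure \<alpha>) =
    ennreal (weight_factor TYPE('n) \<alpha>) * (\<integral>\<^sup>+z\<in>ball 0 1. ennreal (bdist z powr \<alpha>) * F z \<partial>lborel)"
  unfolding weighted_measure_def weight_factor_def
  by (rule nn_integral_density_ball_measure[OF assms weight_const_pos])

lemma nn_integral_invariant_measure:
  fixes F :: "complex ^ 'n \<Rightarrow> ennreal"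
  assumes "F \<in> borel_measurable (restrict_space borel (ball 0 1))"
  shows "(\<integral>\<^sup>+z. F z \<partial>invariant_measure) =
    ennreal (1 / unit_vol TYPE('n)) * (\<integral>\<^sup>+z\<in>ball 0 1. ennreal (bdist z powr (- (real CARD('n) + 1))) * F z \<partial>lborel)"
  using nn_integral_density_ball_measure[OF assms, of 1 "- (real CARD('n) + 1)"]
  by (simp add: invariant_measure_def)

lemma space_weighted_measure [simp]: "space (weighted_measure \<alpha>) = ball 0 1"
  by (simp add: weighted_measure_def)

lemma measurable_weighted_measure:
  "borel_measurable (weighted_measure \<alpha>) = borel_measurable (restrict_space borel (ball 0 1))"
  by (rule measurable_cong_sets) (simp_all add: weighted_measure_def sets_ball_measure)

lemma norm_weighted_deriv_powr:
  assumes "z \<in> ball 0 1"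
  shows "ennreal (cmod (weighted_deriv k f z) powr q) = hpow ((radial_deriv ^^ k) f) (real k * q) q z"
proof -
  have "cmod (weighted_deriv k f z) = bdist z powr real k * cmod ((radial_deriv ^^ k) f z)"
    using bdist_pos[OF assms] by (simp add: weighted_deriv_def norm_mult powr_realpow norm_power flip: bdist_def)
  then show ?thesis using assms by (simp add: hpow_eq powr_mult powr_powr)
qed

lemma borel_measurable_hpow_restrict:
  "line_hol h \<Longrightarrow> hpow h a p \<in> borel_measurable (restrict_space borel (ball 0 1))"
  by (intro measurable_restrict_space1 hpow_borel)

lemma borel_measurable_weighted_deriv_powr:
  assumes "line_hol f"
  shows "(\<lambda>z. ennreal (cmod (weighted_deriv k f z) powr q)) \<in> borel_measurable (restrict_space borel (ball 0 1))"
proof -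
  have "hpow ((radial_deriv ^^ k) f) (real k * q) q \<in> borel_measurable (restrict_space borel (ball 0 1))"
    by (intro borel_measurable_hpow_restrict line_hol_radial_deriv_iterate assms)
  then show ?thesis
    by (subst measurable_cong) (auto simp: space_restrict_space norm_weighted_deriv_powr)
qed

lemma nn_integral_hyp_ball_hpow:
  fixes f :: "complex ^ 'n \<Rightarrow> complex"
  shows "(\<integral>\<^sup>+u\<in>ball 0 1. ennreal (bdist u powr b) * (ennreal (cmod (weighted_deriv k f u) powr q) * indicator (hyp_ball K z) u) \<partial>lborel)
    = hyp_int K z (hpow ((radial_deriv ^^ k) f) (b + real k * q) q)"
proof (rule nn_integral_cong)
  fix u :: "complex ^ 'n"
  show "ennreal (bdist u powr b) * (ennreal (cmod (weighted_deriv k f u) powr q) * indicator (hyp_ball K z) u) * indicator (ball 0 1) u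
    = hpow ((radial_deriv ^^ k) f) (b + real k * q) q u * indicator (hyp_ball K z) u"
  proof (cases "u \<in> ball 0 1")
    case True
    then show ?thesis
      by (simp add: norm_weighted_deriv_powr hpow_mult[OF True, symmetric] mult.assoc del: mem_ball)
  next
    case False
    then have "u \<notin> hyp_ball K z" using hyp_ball_subset by blast
    then show ?thesis using False by simp
  qed
qed

section \<open>Pointwise bounds for the area and maximal functions\<close>

definition bergman_K :: "real \<Rightarrow> real" where
  "bergman_K \<gamma> = (exp (2 * \<gamma>) + 1)\<^sup>2 / (4 * exp (2 * \<gamma>))"

lemma bergman_K_gt_1: "\<gamma> > 0 \<Longrightarrow> bergman_K \<gamma> > 1"
proof -
  assume "\<gamma> > 0"
  then have "exp (2 * \<gamma>) - 1 > 0" by simp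
  then have "(exp (2 * \<gamma>) - 1)\<^sup>2 > 0" by simp
  then have "4 * exp (2 * \<gamma>) < (exp (2 * \<gamma>) + 1)\<^sup>2" by (simp add: power2_eq_square algebra_simps)
  then show ?thesis by (simp add: bergman_K_def)
qed

lemma area_fun_eq:
  fixes f :: "complex ^ 'n \<Rightarrow> complex"
  assumes f: "line_hol f" and \<gamma>: "\<gamma> > 0" and z: "z \<in> ball 0 1"
  shows "area_fun \<gamma> q k f z = epowr (ennreal (1 / unit_vol TYPE('n)) *
    hyp_int (bergman_K \<gamma>) z (hpow ((radial_deriv ^^ k) f) (real k * q - real (CARD('n) + 1)) q)) (1 / q)"
proof -
  have [measurable]: "(\<lambda>z. ennreal (cmod (weighted_deriv k f z) powr q)) \<in> borel_measurable (restrict_space borel (ball 0 1))"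
    by (rule borel_measurable_weighted_deriv_powr[OF f])
  have [measurable]: "(indicator (hyp_ball (bergman_K \<gamma>) z) :: _ \<Rightarrow> ennreal) \<in> borel_measurable (restrict_space borel (ball 0 1))"
    by (intro measurable_restrict_space1 borel_measurable_indicator hyp_ball_borel)
  have "bergman_ball z \<gamma> = hyp_ball (bergman_K \<gamma>) z"
    using bergman_ball_eq_hyp_ball[OF \<gamma> z] by (simp add: bergman_K_def)
  moreover have "- (real CARD('n) + 1) + real k * q = real k * q - real (CARD('n) + 1)" by simp
  moreover have "(\<integral>\<^sup>+u\<in>hyp_ball (bergman_K \<gamma>) z. ennreal (cmod (weighted_deriv k f u) powr q) \<partial>invariant_measure) =
      ennreal (1 / unit_vol TYPE('n)) * (\<integral>\<^sup>+u\<in>ball 0 1. ennreal (bdist u powr (- (real CARD('n) + 1))) *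
        (ennreal (cmod (weighted_deriv k f u) powr q) * indicator (hyp_ball (bergman_K \<gamma>) z) u) \<partial>lborel)"
    by (rule nn_integral_invariant_measure) measurable
  ultimately show ?thesis
    unfolding area_fun_def nn_integral_hyp_ball_hpow by (simp only:)
qed

text \<open>The sub-mean-value inequality with exponent q bounds (d^k |h|)^q at the centre by the
  q-th power of the area function; raise this to the power p / q.\<close>

lemma center_le_area_fun:
  assumes \<gamma>: "\<gamma> > 0" and q: "q > 0" and p: "p > 0"
  shows "\<exists>C>0. \<forall>(f :: complex ^ 'n \<Rightarrow> complex) z. line_hol f \<longrightarrow> z \<in> ball 0 1 \<longrightarrow>
    hpow ((radial_deriv ^^ k) f) (real k * p) p z \<le> ennreal C * epowr (area_fun \<gamma> q k f z) p"
proof -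
  define u where "u = 1 / unit_vol TYPE('n)"
  have u: "u > 0" by (simp add: u_def)
  obtain C where C: "C > 0" "\<And>(h :: complex ^ 'n \<Rightarrow> complex) z. line_hol h \<Longrightarrow> z \<in> ball 0 1 \<Longrightarrow>
     hpow h (real k * q) q z \<le> ennreal C * hyp_int (bergman_K \<gamma>) z (hpow h (real k * q - real (CARD('n) + 1)) q)"
    using hpow_le_integral_center[OF bergman_K_gt_1[OF \<gamma>] q] by blast
  have "hpow ((radial_deriv ^^ k) f) (real k * p) p z \<le> ennreal ((C / u) powr (p / q)) * epowr (area_fun \<gamma> q k f z) p"
    if f: "line_hol f" and z: "z \<in> ball 0 1" for f :: "complex ^ 'n \<Rightarrow> complex" and z
  proof -
    define T where "T = hyp_int (bergman_K \<gamma>) z (hpow ((radial_deriv ^^ k) f) (real k * q - real (CARD('n) + 1)) q)"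
    have "hpow ((radial_deriv ^^ k) f) (real k * p) p z = epowr (hpow ((radial_deriv ^^ k) f) (real k * q) q z) (p / q)"
      using epowr_hpow[OF z q] by simp
    also have "\<dots> \<le> epowr (ennreal C * T) (p / q)"
      unfolding T_def using p q by (intro epowr_mono C(2) line_hol_radial_deriv_iterate f z) simp
    also have "ennreal C * T = ennreal (C / u) * (ennreal u * T)"
      using C u by (simp add: mult.assoc[symmetric] flip: ennreal_mult)
    also have "epowr \<dots> (p / q) = ennreal ((C / u) powr (p / q)) * epowr (ennreal u * T) (p / q)"
      using C u by (intro epowr_cmult) simp
    also have "epowr (ennreal u * T) (p / q) = epowr (area_fun \<gamma> q k f z) p"
      unfolding area_fun_eq[OF f \<gamma> z] T_def[symmetric] u_def[symmetric] epowr_epowr by simp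
    finally show ?thesis .
  qed
  moreover have "(C / u) powr (p / q) > 0" using C u by simp
  ultimately show ?thesis by blast
qed

text \<open>On the ball about \<open>z\<close>, d^k |h| is bounded by the p-th root of a p-mean over
  a larger ball. This bound leaves the integral, and what remains is the invariant volume of the
  ball.\<close>

lemma area_fun_le_integral:
  assumes \<gamma>: "\<gamma> > 0" and q: "q > 0" and p: "p > 0"
  shows "\<exists>C>0. \<forall>(f :: complex ^ 'n \<Rightarrow> complex) z. line_hol f \<longrightarrow> z \<in> ball 0 1 \<longrightarrow>
    epowr (area_fun \<gamma> q k f z) p \<le> ennreal C *
      hyp_int (288 * bergman_K \<gamma>) z (hpow ((radial_deriv ^^ k) f) (real k * p - real (CARD('n) + 1)) p)"
proof -
  define m where "m = real (CARD('n) + 1)"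
  define v where "v = 1 / unit_vol TYPE('n)"
  have v: "v > 0" by (simp add: v_def)
  obtain C1 where C1: "C1 > 0" "\<And>(h :: complex ^ 'n \<Rightarrow> complex) z w. line_hol h \<Longrightarrow> z \<in> ball 0 1 \<Longrightarrow> w \<in> hyp_ball (bergman_K \<gamma>) z \<Longrightarrow>
     hpow h (real k * p) p w \<le> ennreal C1 * hyp_int (288 * bergman_K \<gamma>) z (hpow h (real k * p - m) p)"
    using hpow_le_integral[OF p] unfolding m_def by blast
  \<comment> \<open>The exponent \<open>- m + m\<close> vanishes: Bergman balls have bounded
    invariant volume.\<close>
  have "\<exists>C2>0. \<forall>u::complex ^ 'n. u \<in> ball 0 1 \<longrightarrow>
     (\<integral>\<^sup>+z\<in>hyp_ball (bergman_K \<gamma>) u. ennreal (bdist z powr (- m)) \<partial>lborel) \<le> ennreal (C2 * bdist u powr (- m + m))"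
    unfolding m_def by (rule integral_bdist_hyp_ball_le)
  then obtain C2 where C2: "C2 > 0" "\<And>u::complex ^ 'n. u \<in> ball 0 1 \<Longrightarrow>
     (\<integral>\<^sup>+z\<in>hyp_ball (bergman_K \<gamma>) u. ennreal (bdist z powr (- m)) \<partial>lborel) \<le> ennreal (C2 * bdist u powr (- m + m))"
    by blast
  have "epowr (area_fun \<gamma> q k f z) p \<le> ennreal ((v * C2) powr (p / q) * C1) *
      hyp_int (288 * bergman_K \<gamma>) z (hpow ((radial_deriv ^^ k) f) (real k * p - m) p)"
    if f: "line_hol f" and z: "z \<in> ball 0 1" for f :: "complex ^ 'n \<Rightarrow> complex" and z
  proof -
    define h where "h = (radial_deriv ^^ k) f"
    have h: "line_hol h" unfolding h_def by (rule line_hol_radial_deriv_iterate[OF f])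
    define G where "G = hyp_int (288 * bergman_K \<gamma>) z (hpow h (real k * p - m) p)"
    \<comment> \<open>\<open>Y\<close> bounds the q-th power of d^k |h| on the ball, and
      \<open>epowr Y (p / q)\<close> returns the p-mean, whatever the order of p and q.\<close>
    define Y where "Y = epowr (ennreal C1 * G) (q / p)"
    have "hyp_int (bergman_K \<gamma>) z (hpow h (real k * q - m) q) \<le>
        (\<integral>\<^sup>+u. Y * (ennreal (bdist u powr (- m)) * indicator (hyp_ball (bergman_K \<gamma>) z) u) \<partial>lborel)"
    proof (rule nn_integral_mono)
      fix u
      show "hpow h (real k * q - m) q u * indicator (hyp_ball (bergman_K \<gamma>) z) u \<le>
          Y * (ennreal (bdist u powr (- m)) * indicator (hyp_ball (bergman_K \<gamma>) z) u)"
      proof (cases "u \<in> hyp_ball (bergman_K \<gamma>) z")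
        case True
        then have ub: "u \<in> ball 0 1" using hyp_ball_subset by blast
        have "hpow h (real k * q) q u = epowr (hpow h (real k * p) p u) (q / p)"
          using epowr_hpow[OF ub p] by simp
        also have "\<dots> \<le> Y"
          unfolding Y_def G_def using p q by (intro epowr_mono C1(2)[OF h z True]) simp
        finally have "ennreal (bdist u powr (- m)) * hpow h (real k * q) q u \<le> ennreal (bdist u powr (- m)) * Y"
          by (rule mult_left_mono) simp
        moreover have "- m + real k * q = real k * q - m" by simp
        ultimately show ?thesis using True hpow_mult[OF ub, of "- m" h "real k * q" q]
          by (simp add: mult.commute)
      qed simp
    qed
    also have "\<dots> = Y * (\<integral>\<^sup>+u\<in>hyp_ball (bergman_K \<gamma>) z. ennreal (bdist u powr (- m)) \<partial>lborel)"
      by (rule nn_integral_cmult) measurable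
    also have "\<dots> \<le> Y * ennreal C2"
      using C2(2)[OF z] bdist_pos[OF z] by (intro mult_left_mono) simp_all
    finally have "ennreal v * hyp_int (bergman_K \<gamma>) z (hpow h (real k * q - m) q) \<le> ennreal v * (Y * ennreal C2)"
      by (rule mult_left_mono) simp
    also have "\<dots> = ennreal (v * C2) * Y" using v C2 by (simp add: ennreal_mult mult_ac)
    finally have le: "ennreal v * hyp_int (bergman_K \<gamma>) z (hpow h (real k * q - m) q) \<le> ennreal (v * C2) * Y" .
    have "epowr (area_fun \<gamma> q k f z) p =
        epowr (ennreal v * hyp_int (bergman_K \<gamma>) z (hpow h (real k * q - m) q)) (p / q)"
      unfolding area_fun_eq[OF f \<gamma> z] epowr_epowr v_def m_def h_def by simp
    also have "\<dots> \<le> epowr (ennreal (v * C2) * Y) (p / q)"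
      using le p q by (intro epowr_mono) simp_all
    also have "\<dots> = ennreal ((v * C2) powr (p / q)) * epowr Y (p / q)"
      using v C2 by (intro epowr_cmult) simp
    also have "epowr Y (p / q) = ennreal C1 * G"
      using p q by (simp add: Y_def epowr_epowr epowr_one)
    finally show ?thesis using C1 by (simp add: G_def h_def ennreal_mult mult.assoc)
  qed
  moreover have "(v * C2) powr (p / q) * C1 > 0" using C1 C2 v by simp
  ultimately show ?thesis unfolding m_def by blast
qed

lemma weighted_integral_bergman_ball:
  fixes f :: "complex ^ 'n \<Rightarrow> complex"
  assumes f: "line_hol f" and \<gamma>: "\<gamma> > 0" and w: "w \<in> ball 0 1"
  shows "(\<integral>\<^sup>+u\<in>bergman_ball w \<gamma>. ennreal (cmod (weighted_deriv k f u) powr q) \<partial>weighted_measure \<alpha>) =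
      ennreal (weight_factor TYPE('n) \<alpha>) *
        hyp_int (bergman_K \<gamma>) w (hpow ((radial_deriv ^^ k) f) (\<alpha> + real k * q) q)"
    and "emeasure (weighted_measure \<alpha>) (bergman_ball w \<gamma>) =
      ennreal (weight_factor TYPE('n) \<alpha>) *
        (\<integral>\<^sup>+u\<in>hyp_ball (bergman_K \<gamma>) w. ennreal (bdist u powr \<alpha>) \<partial>lborel)"
proof -
  have eq: "bergman_ball w \<gamma> = hyp_ball (bergman_K \<gamma>) w"
    using bergman_ball_eq_hyp_ball[OF \<gamma> w] by (simp add: bergman_K_def)
  have [measurable]: "(\<lambda>z. ennreal (cmod (weighted_deriv k f z) powr q)) \<in> borel_measurable (restrict_space borel (ball 0 1))"
    by (rule borel_measurable_weighted_deriv_powr[OF f])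
  have ind [measurable]: "(indicator (hyp_ball (bergman_K \<gamma>) w) :: _ \<Rightarrow> ennreal) \<in> borel_measurable (restrict_space borel (ball 0 1))"
    by (intro measurable_restrict_space1 borel_measurable_indicator hyp_ball_borel)
  show "(\<integral>\<^sup>+u\<in>bergman_ball w \<gamma>. ennreal (cmod (weighted_deriv k f u) powr q) \<partial>weighted_measure \<alpha>) =
      ennreal (weight_factor TYPE('n) \<alpha>) *
        hyp_int (bergman_K \<gamma>) w (hpow ((radial_deriv ^^ k) f) (\<alpha> + real k * q) q)"
    unfolding eq nn_integral_hyp_ball_hpow[symmetric]
    by (rule nn_integral_weighted_measure) measurable
  have "hyp_ball (bergman_K \<gamma>) w \<in> sets (weighted_measure \<alpha>)"
    using hyp_ball_subset[of "bergman_K \<gamma>" w]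
    by (auto simp: weighted_measure_def sets_ball_measure sets_restrict_space image_iff intro!: bexI[of _ "hyp_ball (bergman_K \<gamma>) w"])
  then have "emeasure (weighted_measure \<alpha>) (hyp_ball (bergman_K \<gamma>) w) =
      (\<integral>\<^sup>+u. indicator (hyp_ball (bergman_K \<gamma>) w) u \<partial>weighted_measure \<alpha>)"
    by (rule nn_integral_indicator[symmetric])
  also have "\<dots> = ennreal (weight_factor TYPE('n) \<alpha>) *
      (\<integral>\<^sup>+u\<in>ball 0 1. ennreal (bdist u powr \<alpha>) * indicator (hyp_ball (bergman_K \<gamma>) w) u \<partial>lborel)"
    by (rule nn_integral_weighted_measure[OF ind])
  also have "(\<integral>\<^sup>+u\<in>ball 0 1. ennreal (bdist u powr \<alpha>) * indicator (hyp_ball (bergman_K \<gamma>) w) u \<partial>lborel) =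
      (\<integral>\<^sup>+u\<in>hyp_ball (bergman_K \<gamma>) w. ennreal (bdist u powr \<alpha>) \<partial>lborel)"
    using hyp_ball_subset[of "bergman_K \<gamma>" w] by (intro nn_integral_cong) (auto simp: indicator_def)
  finally show "emeasure (weighted_measure \<alpha>) (bergman_ball w \<gamma>) =
      ennreal (weight_factor TYPE('n) \<alpha>) *
        (\<integral>\<^sup>+u\<in>hyp_ball (bergman_K \<gamma>) w. ennreal (bdist u powr \<alpha>) \<partial>lborel)"
    by (simp add: eq)
qed

lemma ennreal_divide_le_of_le_mult: "a \<le> Y * v \<Longrightarrow> a / v \<le> (Y :: ennreal)"
proof -
  assume a: "a \<le> Y * v"
  consider "v = 0" | "v = top" | "v \<noteq> 0" "v \<noteq> top" by blast
  then show ?thesis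
  proof cases
    case 3
    have "a / v \<le> Y * v / v" by (rule divide_right_mono_ennreal[OF a])
    also have "\<dots> = Y" using 3 by (simp add: mult_divide_eq_ennreal)
    finally show ?thesis .
  \<comment> \<open>If \<open>v = 0\<close> then \<open>a = 0\<close>, so in both degenerate cases
    the quotient is 0.\<close>
  qed (use a in \<open>auto simp: divide_ennreal_def\<close>)
qed

lemma ennreal_le_mult_divide:
  assumes "X * v \<le> c * N" "v \<noteq> 0" "v \<noteq> (top :: ennreal)"
  shows "X \<le> c * (N / v)"
proof -
  have "X = X * v / v" using assms by (simp add: mult_divide_eq_ennreal)
  also have "\<dots> \<le> c * N / v" by (rule divide_right_mono_ennreal[OF assms(1)])
  also have "\<dots> = c * (N / v)" by (simp add: ennreal_times_divide)
  finally show ?thesis .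
qed

text \<open>Every ball competing in the supremum contains \<open>z\<close>, so by symmetry and
  \<open>hyp_ball_trans\<close> it lies in one fixed larger ball about \<open>z\<close>. There d^k
  |h| has a bound independent of \<open>w\<close>, which bounds each average as well.\<close>

lemma maximal_fun_le_integral:
  assumes \<gamma>: "\<gamma> > 0" and q: "q > 0" and p: "p > 0"
  shows "\<exists>C>0. \<forall>(f :: complex ^ 'n \<Rightarrow> complex) z. line_hol f \<longrightarrow> z \<in> ball 0 1 \<longrightarrow>
    epowr (maximal_fun \<gamma> q \<alpha> k f z) p \<le> ennreal C *
      hyp_int (288 * (144 * bergman_K \<gamma> * bergman_K \<gamma>)) z (hpow ((radial_deriv ^^ k) f) (real k * p - real (CARD('n) + 1)) p)"
proof -
  define m where "m = real (CARD('n) + 1)"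
  define K where "K = bergman_K \<gamma>"
  obtain C1 where C1: "C1 > 0" "\<And>(h :: complex ^ 'n \<Rightarrow> complex) z w. line_hol h \<Longrightarrow> z \<in> ball 0 1 \<Longrightarrow> w \<in> hyp_ball (144 * K * K) z \<Longrightarrow>
     hpow h (real k * p) p w \<le> ennreal C1 * hyp_int (288 * (144 * K * K)) z (hpow h (real k * p - m) p)"
    using hpow_le_integral[OF p] unfolding m_def by blast
  have "epowr (maximal_fun \<gamma> q \<alpha> k f z) p \<le> ennreal C1 *
      hyp_int (288 * (144 * K * K)) z (hpow ((radial_deriv ^^ k) f) (real k * p - m) p)"
    if f: "line_hol f" and z: "z \<in> ball 0 1" for f :: "complex ^ 'n \<Rightarrow> complex" and z
  proof -
    define h where "h = (radial_deriv ^^ k) f"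
    have h: "line_hol h" unfolding h_def by (rule line_hol_radial_deriv_iterate[OF f])
    define G where "G = ennreal C1 * hyp_int (288 * (144 * K * K)) z (hpow h (real k * p - m) p)"
    define Y where "Y = epowr G (q / p)"
    have "maximal_fun \<gamma> q \<alpha> k f z \<le> epowr G (1 / p)"
      unfolding maximal_fun_def
    proof (rule SUP_least, clarify)
      fix w :: "complex ^ 'n" assume w: "w \<in> ball 0 1" and zw: "z \<in> bergman_ball w \<gamma>"
      have "z \<in> hyp_ball K w" using zw bergman_ball_eq_hyp_ball[OF \<gamma> w] by (simp add: K_def bergman_K_def)
      then have wz: "w \<in> hyp_ball K z" using hyp_ball_sym[OF w z] by simp
      have "hyp_int K w (hpow h (\<alpha> + real k * q) q) \<le>
          (\<integral>\<^sup>+u. Y * (ennreal (bdist u powr \<alpha>) * indicator (hyp_ball K w) u) \<partial>lborel)"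
      proof (rule nn_integral_mono)
        fix u
        show "hpow h (\<alpha> + real k * q) q u * indicator (hyp_ball K w) u \<le> Y * (ennreal (bdist u powr \<alpha>) * indicator (hyp_ball K w) u)"
        proof (cases "u \<in> hyp_ball K w")
          case True
          then have ub: "u \<in> ball 0 1" using hyp_ball_subset by blast
          have uz: "u \<in> hyp_ball (144 * K * K) z" by (rule hyp_ball_trans[OF True wz z])
          have "hpow h (real k * q) q u = epowr (hpow h (real k * p) p u) (q / p)"
            using epowr_hpow[OF ub p] by simp
          also have "\<dots> \<le> Y"
            unfolding Y_def G_def using p q by (intro epowr_mono C1(2)[OF h z uz]) simp
          finally have "ennreal (bdist u powr \<alpha>) * hpow h (real k * q) q u \<le> ennreal (bdist u powr \<alpha>) * Y"
            by (rule mult_left_mono) simp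
          then show ?thesis using True hpow_mult[OF ub, of \<alpha> h "real k * q" q]
            by (simp add: mult.commute)
        qed simp
      qed
      also have "\<dots> = Y * (\<integral>\<^sup>+u\<in>hyp_ball K w. ennreal (bdist u powr \<alpha>) \<partial>lborel)"
        by (rule nn_integral_cmult) measurable
      finally have "ennreal (weight_factor TYPE('n) \<alpha>) * hyp_int K w (hpow h (\<alpha> + real k * q) q) \<le>
          ennreal (weight_factor TYPE('n) \<alpha>) * (Y * (\<integral>\<^sup>+u\<in>hyp_ball K w. ennreal (bdist u powr \<alpha>) \<partial>lborel))"
        by (rule mult_left_mono) simp
      then have "(\<integral>\<^sup>+u\<in>bergman_ball w \<gamma>. ennreal (cmod (weighted_deriv k f u) powr q) \<partial>weighted_measure \<alpha>) \<le>
          Y * emeasure (weighted_measure \<alpha>) (bergman_ball w \<gamma>)"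
        unfolding weighted_integral_bergman_ball[OF f \<gamma> w] K_def[symmetric] h_def[symmetric]
        by (simp only: mult.left_commute)
      then have "(\<integral>\<^sup>+u\<in>bergman_ball w \<gamma>. ennreal (cmod (weighted_deriv k f u) powr q) \<partial>weighted_measure \<alpha>) /
          emeasure (weighted_measure \<alpha>) (bergman_ball w \<gamma>) \<le> Y"
        by (rule ennreal_divide_le_of_le_mult)
      then have "epowr ((\<integral>\<^sup>+u\<in>bergman_ball w \<gamma>. ennreal (cmod (weighted_deriv k f u) powr q) \<partial>weighted_measure \<alpha>) /
          emeasure (weighted_measure \<alpha>) (bergman_ball w \<gamma>)) (1 / q) \<le> epowr Y (1 / q)"
        using q by (intro epowr_mono) simp_all
      also have "epowr Y (1 / q) = epowr G (1 / p)" using p q by (simp add: Y_def epowr_epowr)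
      finally show "epowr ((\<integral>\<^sup>+u\<in>bergman_ball w \<gamma>. ennreal (cmod (weighted_deriv k f u) powr q) \<partial>weighted_measure \<alpha>) /
          emeasure (weighted_measure \<alpha>) (bergman_ball w \<gamma>)) (1 / q) \<le> epowr G (1 / p)" .
    qed
    then have "epowr (maximal_fun \<gamma> q \<alpha> k f z) p \<le> epowr (epowr G (1 / p)) p" using p by (intro epowr_mono)
    also have "\<dots> = G" using p by (simp add: epowr_epowr epowr_one)
    finally show ?thesis by (simp add: G_def h_def)
  qed
  with C1(1) show ?thesis unfolding m_def K_def by blast
qed

text \<open>Take \<open>w = z\<close> in the supremum. The weighted sub-mean-value inequality bounds
  the numerator below, and the weighted volume of the ball is at most of order d^(\<alpha>+n+1). The
  factor of the measure cancels in the quotient.\<close>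

lemma center_le_maximal_fun:
  assumes \<gamma>: "\<gamma> > 0" and q: "q > 0" and p: "p > 0"
  shows "\<exists>C>0. \<forall>(f :: complex ^ 'n \<Rightarrow> complex) z. line_hol f \<longrightarrow> z \<in> ball 0 1 \<longrightarrow>
    hpow ((radial_deriv ^^ k) f) (real k * p) p z \<le> ennreal C * epowr (maximal_fun \<gamma> q \<alpha> k f z) p"
proof -
  define m where "m = real (CARD('n) + 1)"
  define K where "K = bergman_K \<gamma>"
  have K: "K > 1" unfolding K_def by (rule bergman_K_gt_1[OF \<gamma>])
  have ex: "\<exists>C>0. \<forall>(h :: complex ^ 'n \<Rightarrow> complex) z. line_hol h \<longrightarrow> z \<in> ball 0 1 \<longrightarrow>
     hpow h (a + m) q z \<le> ennreal C * hyp_int K z (hpow h a q)" for a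
  proof -
    have "\<exists>C>0. \<forall>(h :: complex ^ 'n \<Rightarrow> complex) z. line_hol h \<longrightarrow> z \<in> ball 0 1 \<longrightarrow>
       hpow h (a + m) q z \<le> ennreal C * hyp_int K z (hpow h (a + m - m) q)"
      unfolding m_def by (rule hpow_le_integral_center[OF K q])
    then show ?thesis by (simp only: add_diff_cancel_right')
  qed
  obtain C1 where C1: "C1 > 0" "\<And>(h :: complex ^ 'n \<Rightarrow> complex) z. line_hol h \<Longrightarrow> z \<in> ball 0 1 \<Longrightarrow>
     hpow h (\<alpha> + real k * q + m) q z \<le> ennreal C1 * hyp_int K z (hpow h (\<alpha> + real k * q) q)"
    using ex[of "\<alpha> + real k * q"] by blast
  \<comment> \<open>Applied below to the constant function 1, where it shows that the weighted
    volume \<open>V\<close> is not 0, so that division by it is harmless.\<close>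
  obtain C3 where C3: "C3 > 0" "\<And>(h :: complex ^ 'n \<Rightarrow> complex) z. line_hol h \<Longrightarrow> z \<in> ball 0 1 \<Longrightarrow>
     hpow h (\<alpha> + m) q z \<le> ennreal C3 * hyp_int K z (hpow h \<alpha> q)"
    using ex[of \<alpha>] by blast
  have "\<exists>C2>0. \<forall>u::complex ^ 'n. u \<in> ball 0 1 \<longrightarrow>
     (\<integral>\<^sup>+z\<in>hyp_ball K u. ennreal (bdist z powr \<alpha>) \<partial>lborel) \<le> ennreal (C2 * bdist u powr (\<alpha> + m))"
    unfolding m_def by (rule integral_bdist_hyp_ball_le)
  then obtain C2 where C2: "C2 > 0" "\<And>u::complex ^ 'n. u \<in> ball 0 1 \<Longrightarrow>
     (\<integral>\<^sup>+z\<in>hyp_ball K u. ennreal (bdist z powr \<alpha>) \<partial>lborel) \<le> ennreal (C2 * bdist u powr (\<alpha> + m))"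
    by blast
  have "hpow ((radial_deriv ^^ k) f) (real k * p) p z \<le> ennreal ((C2 * C1) powr (p / q)) * epowr (maximal_fun \<gamma> q \<alpha> k f z) p"
    if f: "line_hol f" and z: "z \<in> ball 0 1" for f :: "complex ^ 'n \<Rightarrow> complex" and z
  proof -
    define h where "h = (radial_deriv ^^ k) f"
    have h: "line_hol h" unfolding h_def by (rule line_hol_radial_deriv_iterate[OF f])
    define \<kappa> where "\<kappa> = weight_factor TYPE('n) \<alpha>"
    have \<kappa>: "\<kappa> > 0" by (simp add: \<kappa>_def weight_factor_pos)
    define N where "N = hyp_int K z (hpow h (\<alpha> + real k * q) q)"
    define V where "V = (\<integral>\<^sup>+u\<in>hyp_ball K z. ennreal (bdist u powr \<alpha>) \<partial>lborel)"
    have Vle: "V \<le> ennreal (C2 * bdist z powr (\<alpha> + m))" unfolding V_def by (rule C2(2)[OF z])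
    have "V \<noteq> 0"
    proof
      assume V0: "V = 0"
      have one: "line_hol (\<lambda>z :: complex ^ 'n. 1)" by (simp add: line_hol_def)
      have "hyp_int K z (hpow (\<lambda>z. 1) \<alpha> q) = V"
        unfolding V_def
      proof (rule nn_integral_cong)
        fix u
        show "hpow (\<lambda>z. 1) \<alpha> q u * indicator (hyp_ball K z) u = ennreal (bdist u powr \<alpha>) * indicator (hyp_ball K z) u"
          using hyp_ball_subset[of K z] by (auto simp: hpow_def indicator_def)
      qed
      then have "hpow (\<lambda>z. 1) (\<alpha> + m) q z \<le> 0" using C3(2)[OF one z] V0 by simp
      then show False using bdist_pos[OF z] by (simp add: hpow_eq[OF z])
    qed
    moreover have "V \<noteq> top" using Vle by (auto simp: top_unique)
    moreover have "ennreal \<kappa> \<noteq> 0" using \<kappa> by simp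
    ultimately have \<kappa>V: "ennreal \<kappa> * V \<noteq> 0" "ennreal \<kappa> * V \<noteq> top" by (simp_all add: ennreal_mult_eq_top_iff)
    have "hpow h (real k * q) q z * V \<le> hpow h (real k * q) q z * ennreal (C2 * bdist z powr (\<alpha> + m))"
      using Vle by (rule mult_left_mono) simp
    also have "\<dots> = ennreal C2 * (ennreal (bdist z powr (\<alpha> + m)) * hpow h (real k * q) q z)"
      using C2 by (simp add: ennreal_mult mult_ac)
    also have "ennreal (bdist z powr (\<alpha> + m)) * hpow h (real k * q) q z = hpow h (\<alpha> + real k * q + m) q z"
      using hpow_mult[OF z, of "\<alpha> + m" h "real k * q" q] by (simp add: add_ac)
    also have "ennreal C2 * \<dots> \<le> ennreal C2 * (ennreal C1 * N)"
      unfolding N_def by (intro mult_left_mono C1(2)[OF h z]) simp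
    also have "\<dots> = ennreal (C2 * C1) * N" using C1 C2 by (simp add: ennreal_mult mult.assoc)
    finally have "ennreal \<kappa> * (hpow h (real k * q) q z * V) \<le> ennreal \<kappa> * (ennreal (C2 * C1) * N)"
      by (rule mult_left_mono) simp
    then have "hpow h (real k * q) q z * (ennreal \<kappa> * V) \<le> ennreal (C2 * C1) * (ennreal \<kappa> * N)"
      by (simp only: mult.left_commute)
    then have le: "hpow h (real k * q) q z \<le> ennreal (C2 * C1) * ((ennreal \<kappa> * N) / (ennreal \<kappa> * V))"
      by (rule ennreal_le_mult_divide[OF _ \<kappa>V])
    have "z \<in> bergman_ball z \<gamma>"
      using center_in_hyp_ball[OF K z] bergman_ball_eq_hyp_ball[OF \<gamma> z] by (simp add: K_def bergman_K_def)
    then have zz: "z \<in> {w \<in> ball 0 1. z \<in> bergman_ball w \<gamma>}" using z by blast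
    have "epowr ((ennreal \<kappa> * N) / (ennreal \<kappa> * V)) (1 / q) \<le> maximal_fun \<gamma> q \<alpha> k f z"
      unfolding maximal_fun_def
    proof (rule SUP_upper2[OF zz])
      show "epowr ((ennreal \<kappa> * N) / (ennreal \<kappa> * V)) (1 / q) \<le>
          epowr ((\<integral>\<^sup>+u\<in>bergman_ball z \<gamma>. ennreal (cmod (weighted_deriv k f u) powr q) \<partial>weighted_measure \<alpha>) /
            emeasure (weighted_measure \<alpha>) (bergman_ball z \<gamma>)) (1 / q)"
        unfolding weighted_integral_bergman_ball[OF f \<gamma> z] K_def h_def N_def V_def \<kappa>_def by (rule order_refl)
    qed
    then have "epowr (epowr ((ennreal \<kappa> * N) / (ennreal \<kappa> * V)) (1 / q)) p \<le> epowr (maximal_fun \<gamma> q \<alpha> k f z) p"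
      using p by (rule epowr_mono[rotated])
    then have M: "epowr ((ennreal \<kappa> * N) / (ennreal \<kappa> * V)) (p / q) \<le> epowr (maximal_fun \<gamma> q \<alpha> k f z) p"
      by (simp add: epowr_epowr)
    have "hpow h (real k * p) p z = epowr (hpow h (real k * q) q z) (p / q)" using epowr_hpow[OF z q] by simp
    also have "\<dots> \<le> epowr (ennreal (C2 * C1) * ((ennreal \<kappa> * N) / (ennreal \<kappa> * V))) (p / q)"
      using le p q by (intro epowr_mono) simp_all
    also have "\<dots> = ennreal ((C2 * C1) powr (p / q)) * epowr ((ennreal \<kappa> * N) / (ennreal \<kappa> * V)) (p / q)"
      using C1 C2 by (intro epowr_cmult) simp
    also have "\<dots> \<le> ennreal ((C2 * C1) powr (p / q)) * epowr (maximal_fun \<gamma> q \<alpha> k f z) p"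
      using M by (rule mult_left_mono) simp
    finally show ?thesis by (simp add: h_def)
  qed
  moreover have "(C2 * C1) powr (p / q) > 0" using C1 C2 by simp
  ultimately show ?thesis by blast
qed

text \<open>The bound is required of every holomorphic function, infinite values included. A finite
  right side thus forces a finite left side, and membership statements need no separate
  argument.\<close>

definition dominated ::
  "((complex ^ 'n \<Rightarrow> complex) \<Rightarrow> ennreal) \<Rightarrow> ((complex ^ 'n \<Rightarrow> complex) \<Rightarrow> ennreal) \<Rightarrow> bool" where
  "dominated P Q \<longleftrightarrow> (\<exists>C>0. \<forall>f. line_hol f \<longrightarrow> P f \<le> ennreal C * Q f)"

lemma dominatedI: "C > 0 \<Longrightarrow> (\<And>f. line_hol f \<Longrightarrow> P f \<le> ennreal C * Q f) \<Longrightarrow> dominated P Q"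
  unfolding dominated_def by blast

lemma dominated_trans:
  assumes "dominated P Q" "dominated Q R"
  shows "dominated P R"
proof -
  obtain C where C: "C > 0" "\<And>f. line_hol f \<Longrightarrow> P f \<le> ennreal C * Q f"
    using assms(1) unfolding dominated_def by blast
  obtain D where D: "D > 0" "\<And>f. line_hol f \<Longrightarrow> Q f \<le> ennreal D * R f"
    using assms(2) unfolding dominated_def by blast
  show ?thesis
  proof (rule dominatedI)
    show "C * D > 0" using C D by simp
    fix f :: "complex ^ 'a \<Rightarrow> complex" assume f: "line_hol f"
    have "P f \<le> ennreal C * (ennreal D * R f)"
      using C(2)[OF f] mult_left_mono[OF D(2)[OF f], of "ennreal C"] by (meson order_trans zero_le)
    then show "P f \<le> ennreal (C * D) * R f" using C D by (simp add: ennreal_mult mult.assoc)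
  qed
qed

lemma dominated_refl: "dominated P P"
  by (rule dominatedI[of 1]) simp_all

lemma dominated_add:
  assumes "dominated P R" "dominated Q R"
  shows "dominated (\<lambda>f. P f + Q f) R"
proof -
  obtain C where C: "C > 0" "\<And>f. line_hol f \<Longrightarrow> P f \<le> ennreal C * R f"
    using assms(1) unfolding dominated_def by blast
  obtain D where D: "D > 0" "\<And>f. line_hol f \<Longrightarrow> Q f \<le> ennreal D * R f"
    using assms(2) unfolding dominated_def by blast
  show ?thesis
  proof (rule dominatedI)
    show "C + D > 0" using C D by simp
    fix f :: "complex ^ 'a \<Rightarrow> complex" assume f: "line_hol f"
    have "P f + Q f \<le> ennreal C * R f + ennreal D * R f" by (intro add_mono C D f)
    also have "\<dots> = ennreal (C + D) * R f" using C D by (simp add: ennreal_plus distrib_right)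
    finally show "P f + Q f \<le> ennreal (C + D) * R f" .
  qed
qed

lemma dominated_le: "(\<And>f. line_hol f \<Longrightarrow> P f \<le> Q f) \<Longrightarrow> dominated P Q"
  by (rule dominatedI[of 1]) simp_all

text \<open>The value at the origin is carried along, since \<open>\<R>\<^sup>k f\<close> for \<open>k \<ge> 1\<close> does not determine it.\<close>

definition with_value0 ::
  "real \<Rightarrow> ((complex ^ 'n \<Rightarrow> complex) \<Rightarrow> ennreal) \<Rightarrow> (complex ^ 'n \<Rightarrow> complex) \<Rightarrow> ennreal" where
  "with_value0 p P f = ennreal (cmod (f 0) powr p) + P f"

text \<open>The shape of the norms to be compared. \<open>with_value0\<close> is its p-th power up
  to constants, and is the form in which the integral estimates arise.\<close>

definition norm_value0 ::
  "real \<Rightarrow> ((complex ^ 'n \<Rightarrow> complex) \<Rightarrow> ennreal) \<Rightarrow> (complex ^ 'n \<Rightarrow> complex) \<Rightarrow> ennreal" where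
  "norm_value0 p P f = ennreal (cmod (f 0)) + epowr (P f) (1 / p)"

lemma dominated_with_value0:
  assumes "dominated P (with_value0 p Q)"
  shows "dominated (with_value0 p P) (with_value0 p Q)"
  using dominated_add[OF dominated_le assms, of "\<lambda>f. ennreal (cmod (f 0) powr p)"]
  by (simp add: with_value0_def[abs_def])

lemma dominated_imp_with_value0:
  assumes "dominated P Q"
  shows "dominated (with_value0 p P) (with_value0 p Q)"
  by (rule dominated_with_value0, rule dominated_trans[OF assms], rule dominated_le) (simp add: with_value0_def)

text \<open>Taking the p-th root of a sum of two terms costs only the factor 2^(1/p), for every
  positive p.\<close>

lemma dominated_norm_value0:
  assumes p: "p > 0" and d: "dominated (with_value0 p P) (with_value0 p Q)"
  shows "dominated (norm_value0 p P) (norm_value0 p Q)"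
proof -
  obtain C where C: "C > 0" "\<And>f. line_hol f \<Longrightarrow> with_value0 p P f \<le> ennreal C * with_value0 p Q f"
    using d unfolding dominated_def by blast
  have "dominated (\<lambda>f. epowr (P f) (1 / p)) (norm_value0 p Q)"
  proof (rule dominatedI)
    show "C powr (1 / p) * 2 powr (1 / p) > 0" using C by simp
    fix f :: "complex ^ 'a \<Rightarrow> complex" assume f: "line_hol f"
    have "P f \<le> with_value0 p P f" by (simp add: with_value0_def)
    also note C(2)[OF f]
    finally have "epowr (P f) (1 / p) \<le> epowr (ennreal C * with_value0 p Q f) (1 / p)"
      using p by (intro epowr_mono) simp_all
    also have "\<dots> = ennreal (C powr (1 / p)) * epowr (with_value0 p Q f) (1 / p)"
      using C by (intro epowr_cmult)
    also have "epowr (with_value0 p Q f) (1 / p) \<le>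
        ennreal (2 powr (1 / p)) * (epowr (ennreal (cmod (f 0) powr p)) (1 / p) + epowr (Q f) (1 / p))"
      unfolding with_value0_def using p by (intro epowr_add_le) simp
    also have "epowr (ennreal (cmod (f 0) powr p)) (1 / p) = ennreal (cmod (f 0))"
      using p by (simp add: epowr_ennreal powr_powr)
    finally show "epowr (P f) (1 / p) \<le> ennreal (C powr (1 / p) * 2 powr (1 / p)) * norm_value0 p Q f"
      by (simp add: norm_value0_def ennreal_mult mult.assoc mult_left_mono)
  qed
  then show ?thesis
    using dominated_add[OF dominated_le, of "\<lambda>f. ennreal (cmod (f 0))" "norm_value0 p Q"]
    by (simp add: norm_value0_def[abs_def])
qed

section \<open>Changing the order of the radial derivative\<close>

definition deriv_integral :: "real \<Rightarrow> real \<Rightarrow> nat \<Rightarrow> (complex ^ 'n \<Rightarrow> complex) \<Rightarrow> ennreal" where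
  "deriv_integral p \<alpha> k f = (\<integral>\<^sup>+z. hpow ((radial_deriv ^^ k) f) (\<alpha> + real k * p) p z \<partial>lborel)"

lemma radial_deriv_iterate_0: "k > 0 \<Longrightarrow> (radial_deriv ^^ k) f 0 = 0"
  by (cases k) (simp_all add: radial_deriv_def)

text \<open>The first claim is the Cauchy estimate for the k-th radial derivative. The second is the
  absorption argument for it, where the hypothesis on \<open>k\<close> says that the weight exponent
  exceeds -1.\<close>

lemma deriv_integral_Suc:
  assumes p: "p > 0" and k: "p * real k + \<alpha> > -1"
  shows "dominated (with_value0 p (deriv_integral p \<alpha> (Suc k))) (with_value0 p (deriv_integral p \<alpha> k) :: (complex ^ 'n \<Rightarrow> complex) \<Rightarrow> _)"
    and "dominated (with_value0 p (deriv_integral p \<alpha> k)) (with_value0 p (deriv_integral p \<alpha> (Suc k)) :: (complex ^ 'n \<Rightarrow> complex) \<Rightarrow> _)"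
proof -
  define a where "a = \<alpha> + real k * p"
  have a: "a > -1" using k by (simp add: a_def mult.commute add.commute)
  have Suc: "deriv_integral p \<alpha> (Suc k) f = (\<integral>\<^sup>+z. hpow (radial_deriv ((radial_deriv ^^ k) f)) (a + p) p z \<partial>lborel)"
    for f :: "complex ^ 'n \<Rightarrow> complex"
    by (simp add: deriv_integral_def a_def algebra_simps)
  obtain C where C: "C > 0" "\<And>h :: complex ^ 'n \<Rightarrow> complex. line_hol h \<Longrightarrow>
     (\<integral>\<^sup>+z. hpow (radial_deriv h) (a + p) p z \<partial>lborel) \<le> ennreal C * (\<integral>\<^sup>+z. hpow h a p z \<partial>lborel)"
    using integral_hpow_radial_deriv_le[OF p] by blast
  have "dominated (deriv_integral p \<alpha> (Suc k)) (deriv_integral p \<alpha> k :: (complex ^ 'n \<Rightarrow> complex) \<Rightarrow> _)"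
    using C(2)[OF line_hol_radial_deriv_iterate]
    by (intro dominatedI[OF C(1)]) (simp only: Suc, simp add: deriv_integral_def a_def)
  then show "dominated (with_value0 p (deriv_integral p \<alpha> (Suc k))) (with_value0 p (deriv_integral p \<alpha> k) :: (complex ^ 'n \<Rightarrow> complex) \<Rightarrow> _)"
    by (rule dominated_imp_with_value0)
  obtain D where D: "D > 0" "\<And>h :: complex ^ 'n \<Rightarrow> complex. line_hol h \<Longrightarrow>
     (\<integral>\<^sup>+z. hpow h a p z \<partial>lborel) \<le>
       ennreal D * (ennreal (cmod (h 0) powr p) + (\<integral>\<^sup>+z. hpow (radial_deriv h) (a + p) p z \<partial>lborel))"
    using integral_hpow_le_radial_deriv[OF p a] by blast
  have "dominated (deriv_integral p \<alpha> k) (with_value0 p (deriv_integral p \<alpha> (Suc k)) :: (complex ^ 'n \<Rightarrow> complex) \<Rightarrow> _)"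
  proof (rule dominatedI[OF D(1)])
    fix f :: "complex ^ 'n \<Rightarrow> complex" assume f: "line_hol f"
    define h where "h = (radial_deriv ^^ k) f"
    \<comment> \<open>For \<open>k > 0\<close> the radial derivative vanishes at the origin, and for
      \<open>k = 0\<close> the function \<open>h\<close> is \<open>f\<close>.\<close>
    have "cmod (h 0) powr p \<le> cmod (f 0) powr p"
      using radial_deriv_iterate_0[of k f] by (cases "k = 0") (simp_all add: h_def)
    then have "ennreal (cmod (h 0) powr p) + deriv_integral p \<alpha> (Suc k) f \<le> with_value0 p (deriv_integral p \<alpha> (Suc k)) f"
      unfolding with_value0_def by (intro add_right_mono ennreal_leI)
    then have "ennreal D * (ennreal (cmod (h 0) powr p) + deriv_integral p \<alpha> (Suc k) f) \<le> ennreal D * with_value0 p (deriv_integral p \<alpha> (Suc k)) f"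
      by (rule mult_left_mono) simp
    moreover have "deriv_integral p \<alpha> k f \<le> ennreal D * (ennreal (cmod (h 0) powr p) + deriv_integral p \<alpha> (Suc k) f)"
      using D(2)[OF line_hol_radial_deriv_iterate[OF f, of k]]
      unfolding Suc by (simp add: deriv_integral_def a_def h_def)
    ultimately show "deriv_integral p \<alpha> k f \<le> ennreal D * with_value0 p (deriv_integral p \<alpha> (Suc k)) f"
      by (rule order_trans[rotated])
  qed
  then show "dominated (with_value0 p (deriv_integral p \<alpha> k)) (with_value0 p (deriv_integral p \<alpha> (Suc k)) :: (complex ^ 'n \<Rightarrow> complex) \<Rightarrow> _)"
    by (rule dominated_with_value0)
qed

text \<open>Climbs from \<open>N\<close> one order at a time; the exponent condition at
  \<open>N\<close> persists at every intermediate order because \<open>p > 0\<close>.\<close>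

lemma deriv_integral_order_independent:
  assumes p: "p > 0" and N: "p * real N + \<alpha> > -1" and "N \<le> k"
  shows "dominated (with_value0 p (deriv_integral p \<alpha> k)) (with_value0 p (deriv_integral p \<alpha> N) :: (complex ^ 'n \<Rightarrow> complex) \<Rightarrow> _)
    \<and> dominated (with_value0 p (deriv_integral p \<alpha> N)) (with_value0 p (deriv_integral p \<alpha> k) :: (complex ^ 'n \<Rightarrow> complex) \<Rightarrow> _)"
  using \<open>N \<le> k\<close>
proof (induction k rule: dec_induct)
  case base
  show ?case by (simp add: dominated_refl)
next
  case (step j)
  have "p * real N \<le> p * real j" using p step by (intro mult_left_mono) auto
  then have "p * real j + \<alpha> > -1" using N by linarith
  from deriv_integral_Suc[OF p this] step.IH show ?case by (blast intro: dominated_trans)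
qed

text \<open>Common to both functions, with \<open>\<Psi>\<close> their p-th power. The pointwise
  lower bound integrates directly; the upper bound is an average over Bergman balls, which
  \<open>integral_hpow_hyp_ball\<close> with \<open>b = \<alpha>\<close> returns to the unaveraged
  integral.\<close>

lemma integral_weighted_measure_comparable:
  fixes \<Psi> :: "(complex ^ 'n \<Rightarrow> complex) \<Rightarrow> complex ^ 'n \<Rightarrow> ennreal"
  assumes meas: "\<And>f. line_hol f \<Longrightarrow> \<Psi> f \<in> borel_measurable (restrict_space borel (ball 0 1))"
    and lower: "\<exists>C>0. \<forall>f z. line_hol f \<longrightarrow> z \<in> ball 0 1 \<longrightarrow>
      hpow ((radial_deriv ^^ k) f) (real k * p) p z \<le> ennreal C * \<Psi> f z"
    and upper: "\<exists>C>0. \<forall>f z. line_hol f \<longrightarrow> z \<in> ball 0 1 \<longrightarrow> \<Psi> f z \<le> ennreal C *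
      hyp_int K z (hpow ((radial_deriv ^^ k) f) (real k * p - real (CARD('n) + 1)) p)"
  shows "dominated (deriv_integral p \<alpha> k) (\<lambda>f. \<integral>\<^sup>+z. \<Psi> f z \<partial>weighted_measure \<alpha>)"
    and "dominated (\<lambda>f. \<integral>\<^sup>+z. \<Psi> f z \<partial>weighted_measure \<alpha>) (deriv_integral p \<alpha> k)"
proof -
  define m where "m = real (CARD('n) + 1)"
  define \<kappa> where "\<kappa> = weight_factor TYPE('n) \<alpha>"
  have \<kappa>: "\<kappa> > 0" by (simp add: \<kappa>_def weight_factor_pos)
  have int: "(\<integral>\<^sup>+z. \<Psi> f z \<partial>weighted_measure \<alpha>) = ennreal \<kappa> * (\<integral>\<^sup>+z\<in>ball 0 1. ennreal (bdist z powr \<alpha>) * \<Psi> f z \<partial>lborel)"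
    if "line_hol f" for f
    unfolding \<kappa>_def by (rule nn_integral_weighted_measure[OF meas[OF that]])
  have meas' [measurable]: "(\<lambda>z. ennreal (bdist z powr \<alpha>) * \<Psi> f z * indicator (ball 0 1) z) \<in> borel_measurable borel"
    if f: "line_hol f" for f
  proof -
    have [measurable]: "\<Psi> f \<in> borel_measurable (restrict_space borel (ball 0 1))" by (rule meas[OF f])
    have [measurable]: "(\<lambda>z :: complex ^ 'n. bdist z powr \<alpha>) \<in> borel_measurable (restrict_space borel (ball 0 1))"
      by (intro measurable_restrict_space1) measurable
    have "(\<lambda>z. ennreal (bdist z powr \<alpha>) * \<Psi> f z) \<in> borel_measurable (restrict_space borel (ball 0 1))"
      by measurable
    then show ?thesis
      by (subst (asm) borel_measurable_restrict_space_iff_ennreal) auto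
  qed
  obtain C where C: "C > 0" "\<And>f z. line_hol f \<Longrightarrow> z \<in> ball 0 1 \<Longrightarrow>
      hpow ((radial_deriv ^^ k) f) (real k * p) p z \<le> ennreal C * \<Psi> f z"
    using lower by blast
  show "dominated (deriv_integral p \<alpha> k) (\<lambda>f. \<integral>\<^sup>+z. \<Psi> f z \<partial>weighted_measure \<alpha>)"
  proof (rule dominatedI)
    show "C / \<kappa> > 0" using C \<kappa> by simp
    fix f :: "complex ^ 'n \<Rightarrow> complex" assume f: "line_hol f"
    have "deriv_integral p \<alpha> k f \<le> (\<integral>\<^sup>+z. ennreal C * (ennreal (bdist z powr \<alpha>) * \<Psi> f z * indicator (ball 0 1) z) \<partial>lborel)"
      unfolding deriv_integral_def
    proof (rule nn_integral_mono)
      fix z :: "complex ^ 'n"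
      show "hpow ((radial_deriv ^^ k) f) (\<alpha> + real k * p) p z \<le> ennreal C * (ennreal (bdist z powr \<alpha>) * \<Psi> f z * indicator (ball 0 1) z)"
      proof (cases "z \<in> ball 0 1")
        case True
        have "hpow ((radial_deriv ^^ k) f) (\<alpha> + real k * p) p z = ennreal (bdist z powr \<alpha>) * hpow ((radial_deriv ^^ k) f) (real k * p) p z"
          by (rule hpow_mult[OF True, symmetric])
        also have "\<dots> \<le> ennreal (bdist z powr \<alpha>) * (ennreal C * \<Psi> f z)"
          by (intro mult_left_mono C f True) simp
        finally show ?thesis using True by (simp add: mult_ac)
      qed (simp add: hpow_def)
    qed
    also have "\<dots> = ennreal C * (\<integral>\<^sup>+z\<in>ball 0 1. ennreal (bdist z powr \<alpha>) * \<Psi> f z \<partial>lborel)"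
      using meas'[OF f] by (intro nn_integral_cmult) simp
    also have "\<dots> = ennreal (C / \<kappa>) * (\<integral>\<^sup>+z. \<Psi> f z \<partial>weighted_measure \<alpha>)"
      unfolding int[OF f] using C \<kappa> by (simp add: mult.assoc[symmetric] flip: ennreal_mult)
    finally show "deriv_integral p \<alpha> k f \<le> ennreal (C / \<kappa>) * (\<integral>\<^sup>+z. \<Psi> f z \<partial>weighted_measure \<alpha>)" .
  qed
  define G where "G f z = hyp_int K z (hpow ((radial_deriv ^^ k) f) (real k * p - m) p)"
    for f :: "complex ^ 'n \<Rightarrow> complex" and z
  obtain D where D: "D > 0" "\<And>f z. line_hol f \<Longrightarrow> z \<in> ball 0 1 \<Longrightarrow> \<Psi> f z \<le> ennreal D * G f z"
    using upper unfolding G_def m_def by blast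
  have "\<exists>E>0. \<forall>h :: complex ^ 'n \<Rightarrow> complex. line_hol h \<longrightarrow>
     (\<integral>\<^sup>+z\<in>ball 0 1. ennreal (bdist z powr \<alpha>) * hyp_int K z (hpow h (real k * p - m) p) \<partial>lborel) \<le>
     ennreal E * (\<integral>\<^sup>+u. hpow h (real k * p + \<alpha>) p u \<partial>lborel)"
    unfolding m_def by (rule integral_hpow_hyp_ball)
  then obtain E where E: "E > 0" "\<And>h :: complex ^ 'n \<Rightarrow> complex. line_hol h \<Longrightarrow>
     (\<integral>\<^sup>+z\<in>ball 0 1. ennreal (bdist z powr \<alpha>) * hyp_int K z (hpow h (real k * p - m) p) \<partial>lborel) \<le>
     ennreal E * (\<integral>\<^sup>+u. hpow h (real k * p + \<alpha>) p u \<partial>lborel)"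
    by blast
  show "dominated (\<lambda>f. \<integral>\<^sup>+z. \<Psi> f z \<partial>weighted_measure \<alpha>) (deriv_integral p \<alpha> k)"
  proof (rule dominatedI)
    show "\<kappa> * (D * E) > 0" using \<kappa> D E by simp
    fix f :: "complex ^ 'n \<Rightarrow> complex" assume f: "line_hol f"
    note h = line_hol_radial_deriv_iterate[OF f, of k]
    have [measurable]: "G f \<in> borel_measurable borel"
      unfolding G_def by (intro borel_measurable_integral_hyp_ball hpow_borel h)
    have "(\<integral>\<^sup>+z\<in>ball 0 1. ennreal (bdist z powr \<alpha>) * \<Psi> f z \<partial>lborel) \<le>
        (\<integral>\<^sup>+z. ennreal D * (ennreal (bdist z powr \<alpha>) * G f z * indicator (ball 0 1) z) \<partial>lborel)"
    proof (rule nn_integral_mono)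
      fix z :: "complex ^ 'n"
      show "ennreal (bdist z powr \<alpha>) * \<Psi> f z * indicator (ball 0 1) z \<le> ennreal D * (ennreal (bdist z powr \<alpha>) * G f z * indicator (ball 0 1) z)"
      proof (cases "z \<in> ball 0 1")
        case True
        have "ennreal (bdist z powr \<alpha>) * \<Psi> f z \<le> ennreal (bdist z powr \<alpha>) * (ennreal D * G f z)"
          by (intro mult_left_mono D f True) simp
        then show ?thesis using True by (simp add: mult_ac)
      qed simp
    qed
    also have "\<dots> = ennreal D * (\<integral>\<^sup>+z\<in>ball 0 1. ennreal (bdist z powr \<alpha>) * G f z \<partial>lborel)"
      by (rule nn_integral_cmult) measurable
    also have "\<dots> \<le> ennreal D * (ennreal E * deriv_integral p \<alpha> k f)"
      unfolding G_def deriv_integral_def add.commute[of \<alpha>] by (intro mult_left_mono E(2)[OF h]) simp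
    finally have "ennreal \<kappa> * (\<integral>\<^sup>+z\<in>ball 0 1. ennreal (bdist z powr \<alpha>) * \<Psi> f z \<partial>lborel) \<le>
        ennreal \<kappa> * (ennreal D * (ennreal E * deriv_integral p \<alpha> k f))"
      by (rule mult_left_mono) simp
    then show "(\<integral>\<^sup>+z. \<Psi> f z \<partial>weighted_measure \<alpha>) \<le> ennreal (\<kappa> * (D * E)) * deriv_integral p \<alpha> k f"
      unfolding int[OF f] using \<kappa> D E by (simp add: ennreal_mult mult.assoc)
  qed
qed

section \<open>Measurability and membership\<close>

lemma borel_measurable_area_fun:
  fixes f :: "complex ^ 'n \<Rightarrow> complex"
  assumes f: "line_hol f" and \<gamma>: "\<gamma> > 0"
  shows "area_fun \<gamma> q k f \<in> borel_measurable (restrict_space borel (ball 0 1))"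
proof -
  have "(\<lambda>z. \<integral>\<^sup>+u\<in>hyp_ball (bergman_K \<gamma>) z. hpow ((radial_deriv ^^ k) f) (real k * q - real (CARD('n) + 1)) q u \<partial>lborel) \<in> borel_measurable borel"
    by (intro borel_measurable_integral_hyp_ball hpow_borel line_hol_radial_deriv_iterate f)
  then have "(\<lambda>z. epowr (ennreal (1 / unit_vol TYPE('n)) *
      hyp_int (bergman_K \<gamma>) z (hpow ((radial_deriv ^^ k) f) (real k * q - real (CARD('n) + 1)) q)) (1 / q)) \<in> borel_measurable borel"
    by measurable
  then have "(\<lambda>z. epowr (ennreal (1 / unit_vol TYPE('n)) *
      hyp_int (bergman_K \<gamma>) z (hpow ((radial_deriv ^^ k) f) (real k * q - real (CARD('n) + 1)) q)) (1 / q))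
      \<in> borel_measurable (restrict_space borel (ball 0 1))"
    by (rule measurable_restrict_space1)
  then show ?thesis
    by (rule measurable_cong[THEN iffD1, rotated]) (simp add: area_fun_eq[OF f \<gamma>] space_restrict_space del: mem_ball)
qed

text \<open>The maximal function is lower semicontinuous, the Bergman balls being open.\<close>

lemma borel_measurable_maximal_fun:
  fixes f :: "complex ^ 'n \<Rightarrow> complex"
  assumes \<gamma>: "\<gamma> > 0"
  shows "maximal_fun \<gamma> q \<alpha> k f \<in> borel_measurable (restrict_space borel (ball 0 1))"
proof (rule borel_measurableI_greater)
  fix y :: ennreal
  define c where "c w = epowr ((\<integral>\<^sup>+u\<in>bergman_ball w \<gamma>. ennreal (cmod (weighted_deriv k f u) powr q) \<partial>weighted_measure \<alpha>)
               / emeasure (weighted_measure \<alpha>) (bergman_ball w \<gamma>)) (1 / q)" for w :: "complex ^ 'n"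
  have bb: "bergman_ball w \<gamma> = hyp_ball (bergman_K \<gamma>) w" if "w \<in> ball 0 1" for w :: "complex ^ 'n"
    using bergman_ball_eq_hyp_ball[OF \<gamma> that] by (simp add: bergman_K_def)
  have "{z \<in> space (restrict_space borel (ball 0 1)). y < maximal_fun \<gamma> q \<alpha> k f z} =
      (\<Union>w\<in>{w \<in> ball 0 1. y < c w}. bergman_ball w \<gamma>)"
    unfolding maximal_fun_def c_def[symmetric] less_SUP_iff
    by (auto simp: space_restrict_space bergman_ball_def)
  also have "\<dots> = (\<Union>w\<in>{w \<in> ball 0 1. y < c w}. hyp_ball (bergman_K \<gamma>) w)"
    using bb by (intro SUP_cong) auto
  finally have eq: "{z \<in> space (restrict_space borel (ball 0 1)). y < maximal_fun \<gamma> q \<alpha> k f z} =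
      (\<Union>w\<in>{w \<in> ball 0 1. y < c w}. hyp_ball (bergman_K \<gamma>) w)" .
  have "open (\<Union>w\<in>{w \<in> ball 0 1. y < c w}. hyp_ball (bergman_K \<gamma>) w)"
    by (intro open_UN ballI open_hyp_ball)
  moreover have "(\<Union>w\<in>{w \<in> ball 0 1. y < c w}. hyp_ball (bergman_K \<gamma>) w) \<subseteq> ball 0 1"
    using hyp_ball_subset by blast
  ultimately show "{z \<in> space (restrict_space borel (ball 0 1)). y < maximal_fun \<gamma> q \<alpha> k f z} \<in> sets (restrict_space borel (ball 0 1))"
    unfolding eq by (subst sets_restrict_space_iff) auto
qed

lemma nn_integral_weighted_hpow:
  fixes f :: "complex ^ 'n \<Rightarrow> complex"
  assumes f: "line_hol f" and F: "\<And>z. z \<in> ball 0 1 \<Longrightarrow> F z = hpow ((radial_deriv ^^ k) f) (real k * p) p z"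
  shows "(\<integral>\<^sup>+z. F z \<partial>weighted_measure \<alpha>) = ennreal (weight_factor TYPE('n) \<alpha>) * deriv_integral p \<alpha> k f"
proof -
  have m: "hpow ((radial_deriv ^^ k) f) (real k * p) p \<in> borel_measurable (restrict_space borel (ball 0 1))"
    by (intro borel_measurable_hpow_restrict line_hol_radial_deriv_iterate f)
  have "(\<integral>\<^sup>+z. F z \<partial>weighted_measure \<alpha>) = (\<integral>\<^sup>+z. hpow ((radial_deriv ^^ k) f) (real k * p) p z \<partial>weighted_measure \<alpha>)"
    by (rule nn_integral_cong) (use F in simp)
  also have "\<dots> = ennreal (weight_factor TYPE('n) \<alpha>) *
      (\<integral>\<^sup>+z\<in>ball 0 1. ennreal (bdist z powr \<alpha>) * hpow ((radial_deriv ^^ k) f) (real k * p) p z \<partial>lborel)"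
    by (rule nn_integral_weighted_measure[OF m])
  also have "(\<integral>\<^sup>+z\<in>ball 0 1. ennreal (bdist z powr \<alpha>) * hpow ((radial_deriv ^^ k) f) (real k * p) p z \<partial>lborel) = deriv_integral p \<alpha> k f"
    unfolding deriv_integral_def
  proof (rule nn_integral_cong)
    fix z :: "complex ^ 'n"
    show "ennreal (bdist z powr \<alpha>) * hpow ((radial_deriv ^^ k) f) (real k * p) p z * indicator (ball 0 1) z =
        hpow ((radial_deriv ^^ k) f) (\<alpha> + real k * p) p z"
      by (cases "z \<in> ball 0 1") (simp_all add: hpow_mult del: mem_ball, simp add: hpow_def)
  qed
  finally show ?thesis .
qed

lemma dominated_finite:
  assumes "dominated (with_value0 p P) (with_value0 p Q)" "line_hol f" "Q f < \<infinity>"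
  shows "P f < \<infinity>"
proof -
  obtain C where C: "with_value0 p P f \<le> ennreal C * with_value0 p Q f"
    using assms unfolding dominated_def by blast
  have "with_value0 p Q f < \<infinity>" using assms(3) by (simp add: with_value0_def)
  then have "ennreal C * with_value0 p Q f < \<infinity>" by (simp add: ennreal_mult_less_top)
  with C have "with_value0 p P f < \<infinity>" by (rule le_less_trans)
  then show ?thesis by (simp add: with_value0_def)
qed

lemma dominated_comparable_on:
  assumes "dominated P Q" "dominated Q P" "\<And>f. f \<in> S \<Longrightarrow> line_hol f"
  shows "comparable_on S P Q"
proof -
  obtain C where C: "C > 0" "\<And>f. line_hol f \<Longrightarrow> P f \<le> ennreal C * Q f"
    using assms(1) unfolding dominated_def by blast
  obtain D where D: "D > 0" "\<And>f. line_hol f \<Longrightarrow> Q f \<le> ennreal D * P f"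
    using assms(2) unfolding dominated_def by blast
  have "P f \<le> ennreal (max C D) * Q f \<and> Q f \<le> ennreal (max C D) * P f" if "f \<in> S" for f
  proof -
    have f: "line_hol f" using assms(3)[OF that] .
    have "ennreal C * Q f \<le> ennreal (max C D) * Q f" "ennreal D * P f \<le> ennreal (max C D) * P f"
      by (intro mult_right_mono ennreal_leI; simp)+
    then show ?thesis using C(2)[OF f] D(2)[OF f] by (meson order_trans)
  qed
  moreover have "max C D > 0" using C by simp
  ultimately show ?thesis unfolding comparable_on_def by blast
qed

lemma in_Lp_weighted_iff:
  assumes "g \<in> borel_measurable (restrict_space borel (ball 0 1))"
  shows "in_Lp p (weighted_measure \<alpha>) g \<longleftrightarrow> (\<integral>\<^sup>+z. epowr (g z) p \<partial>weighted_measure \<alpha>) < \<infinity>"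
  using assms by (simp add: in_Lp_def measurable_weighted_measure)

text \<open>The weighted derivative is continuous on the ball, so membership is only a matter of
  finiteness, unaffected by the positive factor between the two integrals.\<close>

lemma gen_bergman_iff:
  fixes f :: "complex ^ 'n \<Rightarrow> complex"
  assumes f: "line_hol f"
  shows "f \<in> gen_bergman p \<alpha> \<longleftrightarrow> deriv_integral p \<alpha> (min_order p \<alpha>) f < \<infinity>"
proof -
  define N where "N = min_order p \<alpha>"
  have "continuous_on (ball 0 1) (weighted_deriv N f)"
    unfolding weighted_deriv_def
    by (intro continuous_intros line_hol_cont line_hol_radial_deriv_iterate f)
  then have "weighted_deriv N f \<in> borel_measurable (weighted_measure \<alpha>)"
    unfolding measurable_weighted_measure by (rule borel_measurable_continuous_on_restrict)
  moreover have "(\<integral>\<^sup>+z. ennreal (cmod (weighted_deriv N f z) powr p) \<partial>weighted_measure \<alpha>) =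
      ennreal (weight_factor TYPE('n) \<alpha>) * deriv_integral p \<alpha> N f"
    by (rule nn_integral_weighted_hpow[OF f norm_weighted_deriv_powr])
  moreover have "weight_factor TYPE('n) \<alpha> > 0" by (rule weight_factor_pos)
  ultimately show ?thesis
    using f by (auto simp: gen_bergman_def in_Lp_complex_def holomorphic_ball_iff_line_hol ennreal_mult_less_top simp flip: N_def)
qed

theorem corollary4p3:
  fixes \<gamma> q \<alpha> p :: real and k :: nat
  assumes "\<gamma> > 0" and "1 < q" and "0 < p" and "p * real k + \<alpha> > -1"
  shows "(\<forall>f :: complex ^ 'n \<Rightarrow> complex. holomorphic_ball f \<longrightarrow>
            (f \<in> gen_bergman p \<alpha> \<longleftrightarrow>
               in_Lp p (weighted_measure \<alpha>) (area_fun \<gamma> q k f)) \<and>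
            (in_Lp p (weighted_measure \<alpha>) (area_fun \<gamma> q k f) \<longleftrightarrow>
               in_Lp p (weighted_measure \<alpha>) (maximal_fun \<gamma> q \<alpha> k f)))
       \<and> comparable_on (gen_bergman p \<alpha> :: (complex ^ 'n \<Rightarrow> complex) set)
           (gen_bergman_norm p \<alpha>)
           (\<lambda>f. ennreal (norm (f 0)) +
              epowr (\<integral>\<^sup>+z. epowr (area_fun \<gamma> q k f z) p \<partial>weighted_measure \<alpha>) (1 / p))
       \<and> comparable_on (gen_bergman p \<alpha> :: (complex ^ 'n \<Rightarrow> complex) set)
           (\<lambda>f. ennreal (norm (f 0)) +
              epowr (\<integral>\<^sup>+z. epowr (area_fun \<gamma> q k f z) p \<partial>weighted_measure \<alpha>) (1 / p))
           (\<lambda>f. ennreal (norm (f 0)) +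
              epowr (\<integral>\<^sup>+z. epowr (maximal_fun \<gamma> q \<alpha> k f z) p \<partial>weighted_measure \<alpha>) (1 / p))"
proof -
  note \<gamma> = assms(1) and p = assms(3)
  have q: "q > 0" using assms(2) by simp
  define N where "N = min_order p \<alpha>"
  have N: "p * real N + \<alpha> > -1" "N \<le> k"
    unfolding N_def min_order_def
    by (rule LeastI[of "\<lambda>N. p * real N + \<alpha> > -1", OF assms(4)], rule Least_le[of "\<lambda>N. p * real N + \<alpha> > -1", OF assms(4)])
  define J where "J j f = deriv_integral p \<alpha> j f" for j and f :: "complex ^ 'n \<Rightarrow> complex"
  define I where "I f = (\<integral>\<^sup>+z. epowr (area_fun \<gamma> q k f z) p \<partial>weighted_measure \<alpha>)" for f :: "complex ^ 'n \<Rightarrow> complex"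
  define M where "M f = (\<integral>\<^sup>+z. epowr (maximal_fun \<gamma> q \<alpha> k f z) p \<partial>weighted_measure \<alpha>)" for f :: "complex ^ 'n \<Rightarrow> complex"
  \<comment> \<open>With the normalising factor included, \<open>norm_value0 p W\<close> equals
    \<open>gen_bergman_norm\<close> exactly on holomorphic functions.\<close>
  define W where "W f = ennreal (weight_factor TYPE('n) \<alpha>) * J N f" for f :: "complex ^ 'n \<Rightarrow> complex"
  have area: "dominated (J k) I" "dominated I (J k)"
    unfolding J_def[abs_def] I_def[abs_def]
    by (rule integral_weighted_measure_comparable[OF _ center_le_area_fun[OF \<gamma> q p] area_fun_le_integral[OF \<gamma> q p]],
        intro epowr_borel borel_measurable_area_fun \<gamma>, assumption)+
  have max: "dominated (J k) M" "dominated M (J k)"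
    unfolding J_def[abs_def] M_def[abs_def]
    by (rule integral_weighted_measure_comparable[OF _ center_le_maximal_fun[OF \<gamma> q p] maximal_fun_le_integral[OF \<gamma> q p]],
        intro epowr_borel borel_measurable_maximal_fun \<gamma>)+
  \<comment> \<open>The given order \<open>k\<close> is at least the minimal order \<open>N\<close>,
    so all changes of order start from \<open>N\<close>.\<close>
  have JN: "dominated (with_value0 p (J k)) (with_value0 p (J N))" "dominated (with_value0 p (J N)) (with_value0 p (J k))"
    unfolding J_def[abs_def] using deriv_integral_order_independent[OF p N, where 'n='n] by blast+
  have WJ: "dominated W (J N)"
    unfolding W_def[abs_def] by (rule dominatedI[OF weight_factor_pos[where 'n='n, of \<alpha>]]) simp
  have JW: "dominated (J N) W"
  proof (rule dominatedI)
    show "1 / weight_factor TYPE('n) \<alpha> > 0" using weight_factor_pos[where 'n='n, of \<alpha>] by simp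
    show "J N f \<le> ennreal (1 / weight_factor TYPE('n) \<alpha>) * W f" for f
      using weight_factor_pos[where 'n='n, of \<alpha>]
      by (simp add: W_def mult.assoc[symmetric] flip: ennreal_mult)
  qed
  note v = dominated_imp_with_value0[where p=p]
  have NI: "dominated (with_value0 p (J N)) (with_value0 p I)" "dominated (with_value0 p I) (with_value0 p (J N))"
    using dominated_trans[OF JN(2) v[OF area(1)]] dominated_trans[OF v[OF area(2)] JN(1)] by auto
  have IM: "dominated (with_value0 p I) (with_value0 p M)" "dominated (with_value0 p M) (with_value0 p I)"
    using v[OF dominated_trans[OF area(2) max(1)]] v[OF dominated_trans[OF max(2) area(1)]] by auto
  have WI: "dominated (with_value0 p W) (with_value0 p I)" "dominated (with_value0 p I) (with_value0 p W)"
    using dominated_trans[OF v[OF WJ] NI(1)] dominated_trans[OF NI(2) v[OF JW]] by auto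
  have hol: "line_hol f" if "f \<in> gen_bergman p \<alpha>" for f :: "complex ^ 'n \<Rightarrow> complex"
    using that by (simp add: gen_bergman_def holomorphic_ball_iff_line_hol)
  have norm_eq: "gen_bergman_norm p \<alpha> f = norm_value0 p W f" if f: "line_hol f" for f :: "complex ^ 'n \<Rightarrow> complex"
  proof -
    have "(\<integral>\<^sup>+z. ennreal ((1 - (norm z)\<^sup>2) powr (p * real (min_order p \<alpha>)) * norm ((radial_deriv ^^ min_order p \<alpha>) f z) powr p) \<partial>weighted_measure \<alpha>) = W f"
      unfolding W_def J_def N_def
      by (rule nn_integral_weighted_hpow[OF f]) (simp add: hpow_eq bdist_def mult.commute del: mem_ball)
    then show ?thesis by (simp add: gen_bergman_norm_def norm_value0_def)
  qed
  show ?thesis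
  proof (intro conjI allI impI)
    fix f :: "complex ^ 'n \<Rightarrow> complex" assume "holomorphic_ball f"
    then have f: "line_hol f" by (simp add: holomorphic_ball_iff_line_hol)
    have iA: "in_Lp p (weighted_measure \<alpha>) (area_fun \<gamma> q k f) \<longleftrightarrow> I f < \<infinity>"
      unfolding I_def by (rule in_Lp_weighted_iff[OF borel_measurable_area_fun[OF f \<gamma>]])
    have iM: "in_Lp p (weighted_measure \<alpha>) (maximal_fun \<gamma> q \<alpha> k f) \<longleftrightarrow> M f < \<infinity>"
      unfolding M_def by (rule in_Lp_weighted_iff[OF borel_measurable_maximal_fun[OF \<gamma>]])
    have iN: "f \<in> gen_bergman p \<alpha> \<longleftrightarrow> J N f < \<infinity>"
      unfolding J_def N_def by (rule gen_bergman_iff[OF f])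
    show "f \<in> gen_bergman p \<alpha> \<longleftrightarrow> in_Lp p (weighted_measure \<alpha>) (area_fun \<gamma> q k f)"
      unfolding iA iN using dominated_finite[OF NI(1) f] dominated_finite[OF NI(2) f] by blast
    show "in_Lp p (weighted_measure \<alpha>) (area_fun \<gamma> q k f) \<longleftrightarrow> in_Lp p (weighted_measure \<alpha>) (maximal_fun \<gamma> q \<alpha> k f)"
      unfolding iA iM using dominated_finite[OF IM(1) f] dominated_finite[OF IM(2) f] by blast
  next
    have "comparable_on (gen_bergman p \<alpha>) (norm_value0 p W) (norm_value0 p I)"
      by (rule dominated_comparable_on[OF dominated_norm_value0[OF p WI(1)] dominated_norm_value0[OF p WI(2)] hol])
    then show "comparable_on (gen_bergman p \<alpha> :: (complex ^ 'n \<Rightarrow> complex) set) (gen_bergman_norm p \<alpha>)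
        (\<lambda>f. ennreal (norm (f 0)) + epowr (\<integral>\<^sup>+z. epowr (area_fun \<gamma> q k f z) p \<partial>weighted_measure \<alpha>) (1 / p))"
      using norm_eq[OF hol] by (simp add: comparable_on_def norm_value0_def[of p I] I_def)
  next
    have "comparable_on (gen_bergman p \<alpha>) (norm_value0 p I) (norm_value0 p M)"
      by (rule dominated_comparable_on[OF dominated_norm_value0[OF p IM(1)] dominated_norm_value0[OF p IM(2)] hol])
    then show "comparable_on (gen_bergman p \<alpha> :: (complex ^ 'n \<Rightarrow> complex) set)
        (\<lambda>f. ennreal (norm (f 0)) + epowr (\<integral>\<^sup>+z. epowr (area_fun \<gamma> q k f z) p \<partial>weighted_measure \<alpha>) (1 / p))
        (\<lambda>f. ennreal (norm (f 0)) + epowr (\<integral>\<^sup>+z. epowr (maximal_fun \<gamma> q \<alpha> k f z) p \<partial>weighted_measure \<alpha>) (1 / p))"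
      by (simp add: comparable_on_def norm_value0_def I_def M_def)
  qed
qed

end
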